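(* The multi-entailment problem for PfQPL is decidable in linear time.
   Context: PfQPL is the propositional logic whose formulas are built from propositional variables and the constants $\top,\bot$ by the binary connectives $\land,\lor,\to$, given by the Hilbert-style calculus with rules (premises / conclusion): axioms $\top$ and $A\to A$ (for every formula $A$); $\land$I: $A,B\,/\,A\land B$; $\land$E: $A\land B\,/\,A$ and $A\land B\,/\,B$; $\lor$I: $A\,/\,A\lor B$ and $B\,/\,A\lor B$; $\lor$E: $A\lor A\,/\,A$; $\to$I: $B\,/\,A\to B$; $\to$E: $A,\ A\to B\,/\,B$; $\bot$E: $\bot\,/\,A$. A set of hypotheses entails a query if there is a derivation (finite tree of rule applications with leaves axioms or hypotheses) of the query from the hypotheses. The multi-entailment problem: given a finite sequence of hypotheses and a finite sequence of queries, decide which of the queries are entailed by the hypotheses. Linear time refers to the standard computation model of the analysis of algorithms (RAM model), measured in the total length of the input. *)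

theory Defs
  imports Main
begin

section \<open>The logic PfQPL\<close>

datatype form =
    Var nat
  | Top ("\<^bold>\<top>")
  | Bot ("\<^bold>\<bottom>")
  | And form form (infixr "\<^bold>\<and>" 70)
  | Or form form (infixr "\<^bold>\<or>" 65)
  | Imp form form (infixr "\<^bold>\<rightarrow>" 60)

inductive entails :: "form set \<Rightarrow> form \<Rightarrow> bool" (infix "\<turnstile>" 50) for H :: "form set" where
  hyp: "A \<in> H \<Longrightarrow> H \<turnstile> A"
| top_ax: "H \<turnstile> \<^bold>\<top>"
| imp_ax: "H \<turnstile> A \<^bold>\<rightarrow> A"
| andI: "H \<turnstile> A \<Longrightarrow> H \<turnstile> B \<Longrightarrow> H \<turnstile> A \<^bold>\<and> B"
| andE1: "H \<turnstile> A \<^bold>\<and> B \<Longrightarrow> H \<turnstile> A"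
| andE2: "H \<turnstile> A \<^bold>\<and> B \<Longrightarrow> H \<turnstile> B"
| orI1: "H \<turnstile> A \<Longrightarrow> H \<turnstile> A \<^bold>\<or> B"
| orI2: "H \<turnstile> B \<Longrightarrow> H \<turnstile> A \<^bold>\<or> B"
| orE: "H \<turnstile> A \<^bold>\<or> A \<Longrightarrow> H \<turnstile> A"
| impI: "H \<turnstile> B \<Longrightarrow> H \<turnstile> A \<^bold>\<rightarrow> B"
| impE: "H \<turnstile> A \<Longrightarrow> H \<turnstile> A \<^bold>\<rightarrow> B \<Longrightarrow> H \<turnstile> B"
| botE: "H \<turnstile> \<^bold>\<bottom> \<Longrightarrow> H \<turnstile> A"

definition multi_entailment :: "form list \<times> form list \<Rightarrow> bool list" where
  "multi_entailment = (\<lambda>(hyps, queries). map (\<lambda>q. set hyps \<turnstile> q) queries)"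


section \<open>Instances as strings over a finite alphabet\<close>

datatype sym =
  LParen | RParen | SAnd | SOr | SImp | STop | SBot | SVar | Zero | One | Comma | Turnstile

text \<open>Binary numerals, most significant digit first.\<close>
fun numeral_string :: "nat \<Rightarrow> sym list" where
  "numeral_string n =
     (if n < 2 then [] else numeral_string (n div 2)) @ [if even n then Zero else One]"

declare numeral_string.simps [simp del]

text \<open>Fully parenthesised infix notation. The alphabet is finite, so a variable takes as
  many symbols as its name is long, not one.\<close>
fun form_string :: "form \<Rightarrow> sym list" where
  "form_string (Var i) = SVar # numeral_string i"
| "form_string \<^bold>\<top> = [STop]"
| "form_string \<^bold>\<bottom> = [SBot]"
| "form_string (A \<^bold>\<and> B) = LParen # form_string A @ SAnd # form_string B @ [RParen]"
| "form_string (A \<^bold>\<or> B) = LParen # form_string A @ SOr # form_string B @ [RParen]"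
| "form_string (A \<^bold>\<rightarrow> B) = LParen # form_string A @ SImp # form_string B @ [RParen]"

definition forms_string :: "form list \<Rightarrow> sym list" where
  "forms_string As = concat (map (\<lambda>A. form_string A @ [Comma]) As)"

definition instance_string :: "form list \<times> form list \<Rightarrow> sym list" where
  "instance_string = (\<lambda>(hyps, queries). forms_string hyps @ Turnstile # forms_string queries)"

text \<open>Codes are positive because reading past the end of the input yields 0.\<close>
fun sym_code :: "sym \<Rightarrow> nat" where
  "sym_code LParen = 1"
| "sym_code RParen = 2"
| "sym_code SAnd = 3"
| "sym_code SOr = 4"
| "sym_code SImp = 5"
| "sym_code STop = 6"
| "sym_code SBot = 7"
| "sym_code SVar = 8"
| "sym_code Zero = 9"
| "sym_code One = 10"
| "sym_code Comma = 11"
| "sym_code Turnstile = 12"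

definition encode_instance :: "form list \<times> form list \<Rightarrow> nat list" where
  "encode_instance I = map sym_code (instance_string I)"

definition encode_answer :: "bool list \<Rightarrow> nat list" where
  "encode_answer bs = map of_bool bs"


section \<open>Random access machines\<close>

text \<open>Writing M for the memory, the operands of \<open>Load i j\<close> and \<open>Store i j\<close> mean
  \<open>M[i] := M[M[j]]\<close> and \<open>M[M[i]] := M[j]\<close>. Arithmetic is on natural numbers, so subtraction
  is truncated and division by 0 yields 0.\<close>
datatype instr =
    Const nat nat
  | Move nat nat
  | Load nat nat
  | Store nat nat
  | Add nat nat nat
  | Sub nat nat nat
  | Mul nat nat nat
  | Div nat nat nat
  | Read nat
  | Write nat
  | Jump nat
  | JumpZero nat nat
  | JumpLess nat nat nat

record config =
  pc :: nat
  mem :: "nat \<Rightarrow> nat"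
  inp :: "nat list"
  outp :: "nat list"

definition assign :: "nat \<Rightarrow> nat \<Rightarrow> config \<Rightarrow> config" where
  "assign a v s = s\<lparr>pc := Suc (pc s), mem := (mem s)(a := v)\<rparr>"

fun exec :: "instr \<Rightarrow> config \<Rightarrow> config" where
  "exec (Const i c) s = assign i c s"
| "exec (Move i j) s = assign i (mem s j) s"
| "exec (Load i j) s = assign i (mem s (mem s j)) s"
| "exec (Store i j) s = assign (mem s i) (mem s j) s"
| "exec (Add i j k) s = assign i (mem s j + mem s k) s"
| "exec (Sub i j k) s = assign i (mem s j - mem s k) s"
| "exec (Mul i j k) s = assign i (mem s j * mem s k) s"
| "exec (Div i j k) s = assign i (mem s j div mem s k) s"
| "exec (Read i) s =
     (case inp s of [] \<Rightarrow> assign i 0 s | x # xs \<Rightarrow> (assign i x s)\<lparr>inp := xs\<rparr>)"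
| "exec (Write i) s = s\<lparr>pc := Suc (pc s), outp := outp s @ [mem s i]\<rparr>"
| "exec (Jump l) s = s\<lparr>pc := l\<rparr>"
| "exec (JumpZero i l) s = s\<lparr>pc := (if mem s i = 0 then l else Suc (pc s))\<rparr>"
| "exec (JumpLess i j l) s = s\<lparr>pc := (if mem s i < mem s j then l else Suc (pc s))\<rparr>"

text \<open>The machine halts when the program counter leaves the program.\<close>
definition halted :: "instr list \<Rightarrow> config \<Rightarrow> bool" where
  "halted P s \<longleftrightarrow> length P \<le> pc s"

definition step :: "instr list \<Rightarrow> config \<Rightarrow> config" where
  "step P s = (if halted P s then s else exec (P ! pc s) s)"

definition initial :: "nat list \<Rightarrow> config" where
  "initial xs = \<lparr>pc = 0, mem = (\<lambda>_. 0), inp = xs, outp = []\<rparr>"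

definition run :: "instr list \<Rightarrow> nat list \<Rightarrow> nat \<Rightarrow> config" where
  "run P xs t = (step P ^^ t) (initial xs)"

text \<open>Unit cost is only meaningful for words of \<open>O(log n)\<close> bits, where \<open>n\<close> is the length of
  the input: every memory cell must stay below \<open>(n + 2) ^ k\<close>, that is, below
  \<open>2\<close> to the power \<open>k * log2 (n + 2)\<close>, for a constant \<open>k\<close>. This bounds indirect
  addresses too, as they are contents of cells.\<close>
definition linear_time_computable ::
  "('a \<Rightarrow> nat list) \<Rightarrow> ('b \<Rightarrow> nat list) \<Rightarrow> ('a \<Rightarrow> 'b) \<Rightarrow> bool" where
  "linear_time_computable enc_in enc_out f \<longleftrightarrow>
     (\<exists>P c k. \<forall>x. let xs = enc_in x; n = length xs in
        \<exists>t \<le> c * (n + 1).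
          halted P (run P xs t) \<and>
          outp (run P xs t) = enc_out (f x) \<and>
          (\<forall>t' \<le> t. \<forall>a. mem (run P xs t') a < (n + 2) ^ k))"

end

theory Submission
  imports Defs
begin

text \<open>Entailment is local: if \<open>\<bottom>\<close> is not derivable then every derivation can be
  restricted to subformulas of the hypotheses and the query. So it suffices to number the
  subformulas, equal ones equally, and to saturate a Horn clause system with a constant number of
  clauses per subformula. Numbering takes constant time per input symbol, because the memory is
  initially zero and addresses may be polynomially large: a table of triples (connective, left
  child, right child) can be indexed directly by a quadratic pairing function, without
  hashing. Saturation visits every clause at most twice.\<close>

section \<open>Locality of entailment\<close>

text \<open>Two rules make derivability depend on syntactic identity: the axiom A \<rightarrow> A
  and the elimination of A \<or> A. Equality tests must therefore cost constant time, which is why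
  equal subformulas get equal numbers; the fact or clause for these rules is created when both
  children of a node carry the same number. Variable names are unbounded digit strings, so they are
  numbered by the same table, as paths of a trie. The rule for \<bottom> has no bounded set of
  conclusions and is kept out of the saturation: a query is answered positively if its own node or
  that of \<bottom> was reached. The other obstacle is the machine model: all memory contents,
  addresses included, must stay below a fixed power of n + 2. Values stay linear in n, and addresses
  are polynomials of degree 4 in them, because a triple is coded by two nested quadratic pairings.
  To keep logic and machine apart, the algorithm is verified on abstract states and then written in
  a loop-free language with arrays, to which three loops are added at the level of RAM code.\<close>

text \<open>Extends a set \<open>C\<close> that is saturated within a subformula-closed set \<open>S\<close> to a set of
  formulas closed under all rules, without changing it on \<open>S\<close>.\<close>

fun extend :: "form set \<Rightarrow> form set \<Rightarrow> form \<Rightarrow> bool" where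
  "extend S C (Var i) \<longleftrightarrow> Var i \<in> C"
| "extend S C \<^bold>\<top> \<longleftrightarrow> True"
| "extend S C \<^bold>\<bottom> \<longleftrightarrow> False"
| "extend S C (A \<^bold>\<and> B) \<longleftrightarrow>
     (if A \<^bold>\<and> B \<in> S then A \<^bold>\<and> B \<in> C else extend S C A \<and> extend S C B)"
| "extend S C (A \<^bold>\<or> B) \<longleftrightarrow>
     (if A \<^bold>\<or> B \<in> S then A \<^bold>\<or> B \<in> C else extend S C A \<or> extend S C B)"
| "extend S C (A \<^bold>\<rightarrow> B) \<longleftrightarrow>
     (if A \<^bold>\<rightarrow> B \<in> S then A \<^bold>\<rightarrow> B \<in> C else A = B \<or> extend S C B)"

text \<open>\<open>extend S C\<close> respects every rule on all formulas, so it contains all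
  consequences of \<open>H\<close>. Outside \<open>S\<close>, a compound formula holds only if an
  introduction rule or the axiom for \<rightarrow> gives it, and then its elimination rules return
  what was already there. A formula outside \<open>S\<close> may have subformulas in
  \<open>S\<close>, but not conversely.\<close>

lemma entails_in_closure:
  assumes sub: "\<And>A B. A \<^bold>\<and> B \<in> S \<Longrightarrow> A \<in> S \<and> B \<in> S"
      "\<And>A B. A \<^bold>\<or> B \<in> S \<Longrightarrow> A \<in> S \<and> B \<in> S"
      "\<And>A B. A \<^bold>\<rightarrow> B \<in> S \<Longrightarrow> A \<in> S \<and> B \<in> S"
    and hyps: "H \<subseteq> S" "H \<subseteq> C" and const: "\<^bold>\<top> \<in> C" "\<^bold>\<bottom> \<notin> C"
    and closed: "\<And>A. A \<^bold>\<rightarrow> A \<in> S \<Longrightarrow> A \<^bold>\<rightarrow> A \<in> C"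
      "\<And>A B. A \<^bold>\<and> B \<in> S \<Longrightarrow> A \<^bold>\<and> B \<in> C \<longleftrightarrow> A \<in> C \<and> B \<in> C"
      "\<And>A B. A \<^bold>\<or> B \<in> S \<Longrightarrow> A \<in> C \<or> B \<in> C \<Longrightarrow> A \<^bold>\<or> B \<in> C"
      "\<And>A. A \<^bold>\<or> A \<in> S \<Longrightarrow> A \<^bold>\<or> A \<in> C \<Longrightarrow> A \<in> C"
      "\<And>A B. A \<^bold>\<rightarrow> B \<in> S \<Longrightarrow> B \<in> C \<Longrightarrow> A \<^bold>\<rightarrow> B \<in> C"
      "\<And>A B. A \<^bold>\<rightarrow> B \<in> S \<Longrightarrow> A \<^bold>\<rightarrow> B \<in> C \<Longrightarrow> A \<in> C \<Longrightarrow> B \<in> C"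
    and "H \<turnstile> A" "A \<in> S"
  shows "A \<in> C"
proof -
  \<comment> \<open>A case distinction suffices: on compound members of \<open>S\<close>,
    \<open>extend\<close> consults \<open>C\<close> directly.\<close>
  have agree: "extend S C A \<longleftrightarrow> A \<in> C" if "A \<in> S" for A
    using that const by (cases A) auto
  from \<open>H \<turnstile> A\<close> have "extend S C A"
  proof induction
    case (hyp A)
    then show ?case using hyps agree by blast
  next
    case (andI A B)
    then show ?case using agree sub(1)[of A B] closed(2)[of A B] by auto
  next
    case (andE1 A B)
    then show ?case using agree sub(1)[of A B] closed(2)[of A B] by (auto split: if_splits)
  next
    case (andE2 A B)
    then show ?case using agree sub(1)[of A B] closed(2)[of A B] by (auto split: if_splits)
  next
    case (orI1 A B)
    then show ?case using agree sub(2)[of A B] closed(3)[of A B] by auto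
  next
    case (orI2 B A)
    then show ?case using agree sub(2)[of A B] closed(3)[of A B] by auto
  next
    case (orE A)
    then show ?case using agree sub(2)[of A A] closed(4)[of A] by (auto split: if_splits)
  next
    case (impI B A)
    then show ?case using agree sub(3)[of A B] closed(5)[of A B] by auto
  next
    case (impE A B)
    then show ?case using agree sub(3)[of A B] closed(6)[of A B] by (auto split: if_splits)
  qed (use closed(1) in auto)
  with agree \<open>A \<in> S\<close> show ?thesis by blast
qed

section \<open>Numbering of formulas\<close>

text \<open>Horner evaluation from the most significant digit inverts \<open>numeral_string\<close>;
  injectivity is read off from this.\<close>

lemma numeral_string_value:
  "foldl (\<lambda>m d. 2 * m + of_bool (d = One)) 0 (numeral_string n) = n"
proof (induction n rule: numeral_string.induct)
  case (1 n)
  show ?case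
  proof (cases "n < 2")
    case True
    then have "n = 0 \<or> n = 1" by auto
    then show ?thesis by (auto simp: numeral_string.simps[of n])
  next
    case False
    then show ?thesis using 1 by (auto simp: numeral_string.simps[of n])
  qed
qed

lemma numeral_string_inject: "numeral_string m = numeral_string n \<Longrightarrow> m = n"
  by (metis numeral_string_value)

lemma set_numeral_string: "set (numeral_string n) \<subseteq> {Zero, One}"
proof (induction n rule: numeral_string.induct)
  case (1 n)
  then show ?case by (subst numeral_string.simps) (cases "n < 2"; auto)
qed

lemma numeral_string_nonempty: "numeral_string n \<noteq> []"
  by (subst numeral_string.simps) simp

lemma sym_code_inject [simp]: "sym_code x = sym_code y \<longleftrightarrow> x = y"
  by (cases x; cases y; simp)

text \<open>\<open>T (c, l, r)\<close> is the number of the node with children \<open>l\<close> and \<open>r\<close> whose connective has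
  symbol code \<open>c\<close>, or 0 if there is no such node yet. Nodes 1 and 2 are the constants. Variables
  are paths in a binary trie with root 3: the successor of \<open>x\<close> along the digit \<open>d\<close> is the node
  with connective \<open>d\<close> and both children \<open>x\<close>.\<close>

type_synonym table = "nat \<times> nat \<times> nat \<Rightarrow> nat"

definition walk :: "table \<Rightarrow> nat \<Rightarrow> sym list \<Rightarrow> nat" where
  "walk T = foldl (\<lambda>c d. T (sym_code d, c, c))"

fun node :: "table \<Rightarrow> form \<Rightarrow> nat" where
  "node T (Var i) = walk T 3 (numeral_string i)"
| "node T \<^bold>\<top> = 1"
| "node T \<^bold>\<bottom> = 2"
| "node T (A \<^bold>\<and> B) = T (3, node T A, node T B)"
| "node T (A \<^bold>\<or> B) = T (4, node T A, node T B)"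
| "node T (A \<^bold>\<rightarrow> B) = T (5, node T A, node T B)"

text \<open>Values start at 4 because 1 to 3 are reserved for the constants and the trie root. Since
  children are nonzero, a formula with a nonzero number has only numbered subformulas.\<close>

definition table_ok :: "table \<Rightarrow> nat \<Rightarrow> bool" where
  "table_ok T N \<longleftrightarrow>
     (\<forall>c l r. T (c, l, r) \<noteq> 0 \<longrightarrow> 3 < T (c, l, r) \<and> T (c, l, r) \<le> N \<and> l \<in> {1..N} \<and> r \<in> {1..N}) \<and>
     (\<forall>k k'. T k = T k' \<longrightarrow> T k \<noteq> 0 \<longrightarrow> k = k')"

lemma table_okD:
  assumes "table_ok T N" "T (c, l, r) \<noteq> 0"
  shows "3 < T (c, l, r)" "T (c, l, r) \<le> N" "l \<noteq> 0" "r \<noteq> 0" "l \<le> N" "r \<le> N"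
proof -
  have "3 < T (c, l, r) \<and> T (c, l, r) \<le> N \<and> l \<in> {1..N} \<and> r \<in> {1..N}"
    using assms unfolding table_ok_def by blast
  then show "3 < T (c, l, r)" "T (c, l, r) \<le> N" "l \<noteq> 0" "r \<noteq> 0" "l \<le> N" "r \<le> N"
    by auto
qed

lemma table_ok_inject:
  assumes "table_ok T N" "T k = T k'" "T k \<noteq> 0"
  shows "k = k'"
  using assms unfolding table_ok_def by blast

lemma walk_snoc: "walk T c (ds @ [d]) = T (sym_code d, walk T c ds, walk T c ds)"
  by (simp add: walk_def)

text \<open>Induction from the end of the word, since the last digit is the outermost lookup. The
  empty word gives the root 3 while every other nonzero value exceeds 3, so words of different
  length cannot collide.\<close>

lemma walk_inject:
  assumes ok: "table_ok T N" and "walk T 3 xs = walk T 3 ys" "walk T 3 xs \<noteq> 0"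
  shows "xs = ys"
  using assms(2,3)
proof (induction xs arbitrary: ys rule: rev_induct)
  case Nil
  show ?case
  proof (cases ys rule: rev_cases)
    case (snoc ys' y)
    then show ?thesis
      using table_okD(1)[OF ok, of "sym_code y" "walk T 3 ys'" "walk T 3 ys'"] Nil.prems
      by (simp add: walk_snoc) (simp add: walk_def)
  qed simp
next
  case (snoc x xs)
  let ?k = "(sym_code x, walk T 3 xs, walk T 3 xs)"
  note eq = snoc.prems[unfolded walk_snoc]
  show ?case
  proof (cases ys rule: rev_cases)
    case Nil
    then show ?thesis
      using table_okD(1)[OF ok eq(2)] eq by (simp add: walk_def)
  next
    case ys: (snoc ys' y)
    then have "?k = (sym_code y, walk T 3 ys', walk T 3 ys')"
      using table_ok_inject[OF ok, of ?k] eq by (simp add: walk_snoc)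
    then show ?thesis using table_okD(3)[OF ok eq(2)] snoc.IH[of ys'] ys by simp
  qed
qed

text \<open>The triple at which \<open>node\<close> makes its final lookup. A variable is seen from
  its last digit, so that all formulas other than the constants can be compared uniformly.\<close>

fun key :: "table \<Rightarrow> form \<Rightarrow> nat \<times> nat \<times> nat" where
  "key T (Var i) =
     (let ds = numeral_string i; c = walk T 3 (butlast ds) in (sym_code (last ds), c, c))"
| "key T (A \<^bold>\<and> B) = (3, node T A, node T B)"
| "key T (A \<^bold>\<or> B) = (4, node T A, node T B)"
| "key T (A \<^bold>\<rightarrow> B) = (5, node T A, node T B)"
| "key T _ = (0, 0, 0)"

lemma node_key:
  assumes "A \<noteq> \<^bold>\<top>" "A \<noteq> \<^bold>\<bottom>"
  shows "node T A = T (key T A)"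
proof (cases A)
  case (Var i)
  have "walk T 3 (butlast (numeral_string i) @ [last (numeral_string i)]) = T (key T A)"
    by (simp add: walk_def Var Let_def)
  then show ?thesis using numeral_string_nonempty[of i] by (simp add: Var)
qed (use assms in auto)

text \<open>Digits have codes 9 and 10, connectives 3 to 5, so the trie and the compound formulas
  can share one table.\<close>

lemma fst_key_Var: "fst (key T (Var i)) \<in> {9, 10}"
proof -
  have "last (numeral_string i) \<in> {Zero, One}"
    using set_numeral_string[of i] last_in_set[OF numeral_string_nonempty[of i]] by blast
  then show ?thesis by (auto simp: Let_def)
qed

lemma key_Var_neq [simp]:
  "(3, x) \<noteq> key T (Var i)" "(4, x) \<noteq> key T (Var i)" "(5, x) \<noteq> key T (Var i)"
proof -
  have "(c, x) \<noteq> key T (Var i)" if "c \<notin> {9, 10}" for c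
    using fst_key_Var[of T i] that by (metis fst_conv)
  then show "(3, x) \<noteq> key T (Var i)" "(4, x) \<noteq> key T (Var i)" "(5, x) \<noteq> key T (Var i)"
    by simp_all
qed

declare key.simps(1) [simp del]

text \<open>Equal nonzero values have equal keys, by injectivity of the table; the keys reveal the
  connective and the numbers of the children, which are again nonzero. The value 0 is shared by all
  formulas not yet numbered.\<close>

lemma node_inject:
  assumes ok: "table_ok T N" and eq: "node T A = node T B" and nz: "node T A \<noteq> 0"
  shows "A = B"
  using eq nz
proof (induction A arbitrary: B)
  have big: "3 < node T A" if "A \<noteq> \<^bold>\<top>" "A \<noteq> \<^bold>\<bottom>" "node T A \<noteq> 0" for A
    using that table_okD(1)[OF ok] by (cases "key T A") (simp add: node_key)
  have keys: "key T A = key T B" "B \<noteq> \<^bold>\<top>" "B \<noteq> \<^bold>\<bottom>"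
    if "node T A = node T B" "node T A \<noteq> 0" "A \<noteq> \<^bold>\<top>" "A \<noteq> \<^bold>\<bottom>" for A B
  proof -
    show *: "B \<noteq> \<^bold>\<top>" "B \<noteq> \<^bold>\<bottom>" using big[of A] that by auto
    show "key T A = key T B"
      using that * by (intro table_ok_inject[OF ok]) (simp_all add: node_key)
  qed
  have args: "l \<noteq> 0" "r \<noteq> 0" if "T (c, l, r) \<noteq> 0" for c l r
    using table_okD(3,4)[OF ok that] by auto
  {
    case (Var i)
    have *: "key T (Var i) = key T B" "B \<noteq> \<^bold>\<top>" "B \<noteq> \<^bold>\<bottom>"
      using keys[OF Var] by auto
    then obtain j where "B = Var j"
      using key_Var_neq[of _ T i] by (cases B) auto
    then show ?case
      using Var walk_inject[OF ok] numeral_string_inject by simp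
  next
    case Top
    then show ?case using big[of B] by (cases "B = \<^bold>\<bottom>") auto
  next
    case Bot
    then show ?case using big[of B] by (cases "B = \<^bold>\<top>") auto
  next
    case (And A1 A2)
    have *: "key T (A1 \<^bold>\<and> A2) = key T B" "B \<noteq> \<^bold>\<top>" "B \<noteq> \<^bold>\<bottom>"
      using keys[OF And.prems] by auto
    then obtain B1 B2 where "B = B1 \<^bold>\<and> B2" "node T A1 = node T B1" "node T A2 = node T B2"
      by (cases B) auto
    then show ?case using And.IH And.prems(2) args[of 3 "node T A1" "node T A2"] by simp
  next
    case (Or A1 A2)
    have *: "key T (A1 \<^bold>\<or> A2) = key T B" "B \<noteq> \<^bold>\<top>" "B \<noteq> \<^bold>\<bottom>"
      using keys[OF Or.prems] by auto
    then obtain B1 B2 where "B = B1 \<^bold>\<or> B2" "node T A1 = node T B1" "node T A2 = node T B2"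
      by (cases B) auto
    then show ?case using Or.IH Or.prems(2) args[of 4 "node T A1" "node T A2"] by simp
  next
    case (Imp A1 A2)
    have *: "key T (A1 \<^bold>\<rightarrow> A2) = key T B" "B \<noteq> \<^bold>\<top>" "B \<noteq> \<^bold>\<bottom>"
      using keys[OF Imp.prems] by auto
    then obtain B1 B2 where "B = B1 \<^bold>\<rightarrow> B2" "node T A1 = node T B1" "node T A2 = node T B2"
      by (cases B) auto
    then show ?case using Imp.IH Imp.prems(2) args[of 5 "node T A1" "node T A2"] by simp
  }
qed

section \<open>Stability of numbers under growth of the table\<close>

definition table_le :: "table \<Rightarrow> table \<Rightarrow> bool" where
  "table_le T T' \<longleftrightarrow> (\<forall>k. T k \<noteq> 0 \<longrightarrow> T' k = T k)"

lemma table_le_refl: "table_le T T"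
  by (simp add: table_le_def)

lemma table_le_trans: "table_le T T' \<Longrightarrow> table_le T' T'' \<Longrightarrow> table_le T T''"
  by (simp add: table_le_def)

lemma walk_mono:
  assumes "table_ok T N" "table_le T T'" "walk T c ds \<noteq> 0"
  shows "walk T' c ds = walk T c ds"
  using assms(3)
proof (induction ds rule: rev_induct)
  case (snoc d ds)
  then have nz: "T (sym_code d, walk T c ds, walk T c ds) \<noteq> 0" by (simp add: walk_def)
  then have "walk T' c ds = walk T c ds"
    using snoc.IH table_okD(3)[OF assms(1) nz] by simp
  then show ?case using nz assms(2) by (simp add: walk_def table_le_def)
qed (simp add: walk_def)

text \<open>The reader stores numbers of formulas while the table still grows; this allows them to
  be interpreted in the final table. Only a number 0 may change later.\<close>

lemma node_mono:
  assumes "table_ok T N" "table_le T T'" "node T A \<noteq> 0"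
  shows "node T' A = node T A"
  using assms(3)
proof (induction A)
  case (Var i)
  then show ?case using walk_mono[OF assms(1,2)] by simp
next
  case (And A B)
  then show ?case using assms(2) table_okD(3,4)[OF assms(1), of 3 "node T A" "node T B"]
    by (simp add: table_le_def)
next
  case (Or A B)
  then show ?case using assms(2) table_okD(3,4)[OF assms(1), of 4 "node T A" "node T B"]
    by (simp add: table_le_def)
next
  case (Imp A B)
  then show ?case using assms(2) table_okD(3,4)[OF assms(1), of 5 "node T A" "node T B"]
    by (simp add: table_le_def)
qed simp_all

section \<open>Reading an instance\<close>

text \<open>A link \<open>(v, u, x)\<close> is the clause \<open>v \<and> u \<longrightarrow> x\<close>, recorded with its premise \<open>v\<close>. A clause with
  two different premises gives two links, one with a single premise has \<open>u = v\<close>.\<close>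

type_synonym link = "nat \<times> nat \<times> nat"
type_synonym adjacency = "nat \<Rightarrow> (nat \<times> nat) list"

text \<open>The clauses for the rules whose principal formula is the new node \<open>w\<close>.
  \<open>andI\<close> and \<open>impE\<close> have two premises and appear twice; elimination of
  \<or> applies only to equal operands. The axiom A \<rightarrow> A has no premise and is handled by
  \<open>mk\<close>; digits have no rules.\<close>

definition new_links :: "nat \<Rightarrow> nat \<Rightarrow> nat \<Rightarrow> nat \<Rightarrow> link list" where
  "new_links c l r w =
     (if c = 3 then [(w, w, l), (w, w, r), (l, r, w), (r, l, w)]
      else if c = 4 then [(l, l, w), (r, r, w)] @ (if l = r then [(w, w, l)] else [])
      else if c = 5 then [(r, r, w), (l, w, r), (w, l, r)]
      else [])"

section \<open>Adjacency lists and the clauses that they hold\<close>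

fun add_link :: "link \<Rightarrow> adjacency \<Rightarrow> adjacency" where
  "add_link (v, u, c) f = f(v := f v @ [(u, c)])"

definition link_set :: "adjacency \<Rightarrow> link set" where
  "link_set f = {(v, u, c). (u, c) \<in> set (f v)}"

definition table_links :: "table \<Rightarrow> link set" where
  "table_links T = {x. \<exists>c l r. T (c, l, r) \<noteq> 0 \<and> x \<in> set (new_links c l r (T (c, l, r)))}"

definition push :: "nat \<Rightarrow> nat list \<Rightarrow> nat list" where
  "push v ws = (if v \<in> set ws then ws else ws @ [v])"

lemma set_push [simp]: "set (push v ws) = insert v (set ws)"
  by (auto simp: push_def)

lemma distinct_push [simp]: "distinct (push v ws) \<longleftrightarrow> distinct ws"
  by (auto simp: push_def)

lemma link_set_add_links: "link_set (fold add_link ls f) = link_set f \<union> set ls"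
proof (induction ls arbitrary: f)
  case (Cons x ls)
  have "link_set (add_link x f) = insert x (link_set f)"
    by (cases x) (auto simp: link_set_def split: if_splits)
  then show ?case using Cons by auto
qed simp

lemma add_links_other: "v \<notin> fst ` set ls \<Longrightarrow> fold add_link ls f v = f v"
proof (induction ls arbitrary: f)
  case (Cons x ls)
  then show ?case by (cases x) auto
qed simp

text \<open>Yields at most four more entries per new node, hence a total length of at most
  \<open>4 * cnt a\<close>. This sum, rather than a bound for each node, makes the saturation
  linear.\<close>

lemma sum_add_links:
  assumes "\<forall>(v, u, c) \<in> set ls. v \<le> N"
  shows "(\<Sum>v\<le>N. length (fold add_link ls f v)) = (\<Sum>v\<le>(N::nat). length (f v)) + length ls"
  using assms
proof (induction ls arbitrary: f)
  case (Cons x ls)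
  obtain v u c where x: "x = (v, u, c)" by (cases x)
  have "(\<Sum>i\<le>N. length (add_link x f i)) = (\<Sum>i\<le>N. length (f i) + (if i = v then 1 else 0))"
    by (intro sum.cong) (auto simp: x)
  also have "\<dots> = (\<Sum>i\<le>N. length (f i)) + 1"
    using Cons.prems by (simp add: sum.distrib x)
  finally show ?case using Cons by simp
qed simp

lemma length_new_links: "length (new_links c l r w) \<le> 4"
  by (simp add: new_links_def)

lemma new_links_members:
  "(v, u, x) \<in> set (new_links c l r w) \<Longrightarrow> {v, u, x} \<subseteq> {l, r, w}"
  by (auto simp: new_links_def split: if_splits)

lemma new_links_sym:
  "(v, u, x) \<in> set (new_links c l r w) \<Longrightarrow> (u, v, x) \<in> set (new_links c l r w)"
  by (auto simp: new_links_def split: if_splits)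

lemma table_links_sym: "(v, u, x) \<in> table_links T \<Longrightarrow> (u, v, x) \<in> table_links T"
  using new_links_sym by (fastforce simp: table_links_def)

lemma table_links_update:
  assumes "T (c, l, r) = 0" "w \<noteq> 0"
  shows "table_links (T((c, l, r) := w)) = table_links T \<union> set (new_links c l r w)"
proof (intro equalityI subsetI)
  fix x assume "x \<in> table_links (T((c, l, r) := w))"
  then show "x \<in> table_links T \<union> set (new_links c l r w)"
    by (auto simp: table_links_def split: if_splits)
next
  fix x assume "x \<in> table_links T \<union> set (new_links c l r w)"
  then show "x \<in> table_links (T((c, l, r) := w))"
  proof
    assume "x \<in> table_links T"
    then obtain c' l' r' where *: "T (c', l', r') \<noteq> 0" "x \<in> set (new_links c' l' r' (T (c', l', r')))"
      by (auto simp: table_links_def)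
    then have "(c', l', r') \<noteq> (c, l, r)" using assms by metis
    then have "(T((c, l, r) := w)) (c', l', r') = T (c', l', r')" by (rule fun_upd_other)
    then show ?thesis using * unfolding table_links_def by (metis (mono_tags, lifting) mem_Collect_eq)
  next
    assume "x \<in> set (new_links c l r w)"
    then show ?thesis
      using assms(2) unfolding table_links_def
      by (intro CollectI exI[of _ c] exI[of _ l] exI[of _ r]) simp
  qed
qed

text \<open>\<open>cur\<close> is the node of the formula read last, \<open>cnt\<close> the largest node in use, \<open>stk\<close> holds the
  left operands and connectives that wait for their right operand, \<open>wl\<close> is the list of nodes known
  to be derivable, and \<open>qs\<close> the nodes of the queries. \<open>phase\<close> becomes 1 at the turnstile.\<close>

record pstate =
  cur :: nat
  cnt :: nat
  tab :: table
  stk :: "(nat \<times> nat) list"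
  adj :: adjacency
  wl :: "nat list"
  qs :: "nat list"
  phase :: nat

text \<open>Equal numbers mean equal formulas, so \<open>c = 5\<close> with \<open>l = r\<close>
  recognises an instance of the axiom A \<rightarrow> A, which is derivable as soon as its node
  exists.\<close>

definition mk :: "nat \<Rightarrow> nat \<Rightarrow> nat \<Rightarrow> pstate \<Rightarrow> pstate" where
  "mk c l r a =
     (if tab a (c, l, r) \<noteq> 0 then a\<lparr>cur := tab a (c, l, r)\<rparr>
      else let w = Suc (cnt a) in
        a\<lparr>cur := w, cnt := w, tab := (tab a)((c, l, r) := w),
          adj := fold add_link (new_links c l r w) (adj a),
          wl := (if c = 5 \<and> l = r then push w (wl a) else wl a)\<rparr>)"

text \<open>The notation is fully parenthesised, so a connective marks the formula just read as a
  left operand, and a closing parenthesis finds that operand on top of the stack.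
  \<open>SVar\<close> moves to the trie root, from where the digits walk down.\<close>

fun scan :: "sym \<Rightarrow> pstate \<Rightarrow> pstate" where
  "scan LParen a = a"
| "scan RParen a = mk (snd (last (stk a))) (fst (last (stk a))) (cur a) (a\<lparr>stk := butlast (stk a)\<rparr>)"
| "scan SAnd a = a\<lparr>stk := stk a @ [(cur a, 3)]\<rparr>"
| "scan SOr a = a\<lparr>stk := stk a @ [(cur a, 4)]\<rparr>"
| "scan SImp a = a\<lparr>stk := stk a @ [(cur a, 5)]\<rparr>"
| "scan STop a = a\<lparr>cur := 1\<rparr>"
| "scan SBot a = a\<lparr>cur := 2\<rparr>"
| "scan SVar a = a\<lparr>cur := 3\<rparr>"
| "scan Zero a = mk 9 (cur a) (cur a) a"
| "scan One a = mk 10 (cur a) (cur a) a"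
| "scan Comma a = (if phase a = 0 then a\<lparr>wl := push (cur a) (wl a)\<rparr> else a\<lparr>qs := qs a @ [cur a]\<rparr>)"
| "scan Turnstile a = a\<lparr>phase := 1\<rparr>"

text \<open>Nodes 1 to 3 are reserved, hence \<open>cnt\<close> 3. The worklist starts with node 1
  because \<top> is an axiom.\<close>

definition start :: pstate where
  "start = \<lparr>cur = 1, cnt = 3, tab = (\<lambda>_. 0), stk = [], adj = (\<lambda>_. []), wl = [1], qs = [], phase = 0\<rparr>"

text \<open>Meant to hold between any two symbols, also in the middle of a formula. It bounds what
  the machine has to store, and the bound on the sum will pay for the saturation.\<close>

definition in_range :: "pstate \<Rightarrow> bool" where
  "in_range a \<longleftrightarrow> table_ok (tab a) (cnt a) \<and> 3 \<le> cnt a \<and> cur a \<in> {1..cnt a} \<and>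
     (\<forall>(x, c) \<in> set (stk a). x \<in> {1..cnt a} \<and> c \<in> {3, 4, 5}) \<and>
     set (wl a) \<subseteq> {1..cnt a} \<and> distinct (wl a) \<and> set (qs a) \<subseteq> {1..cnt a} \<and>
     (\<Sum>v\<le>cnt a. length (adj a v)) \<le> 4 * cnt a \<and> (\<forall>v. cnt a < v \<longrightarrow> adj a v = []) \<and>
     link_set (adj a) = table_links (tab a) \<and> phase a \<le> 1"

text \<open>\<open>F\<close> is the set of nodes of the hypotheses read so far. The last conjunct
  keeps trie nodes that stand for no formula from becoming operands, so that the clauses of a node
  can be read as rules.\<close>

definition explained :: "nat set \<Rightarrow> pstate \<Rightarrow> bool" where
  "explained F a \<longleftrightarrow> in_range a \<and>
     set (wl a) = insert 1 F \<union> {w. w \<noteq> 0 \<and> (\<exists>l. tab a (5, l, l) = w)} \<and>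
     (\<forall>c l r. c \<in> {3, 4, 5} \<longrightarrow> tab a (c, l, r) \<noteq> 0 \<longrightarrow>
        l \<in> range (node (tab a)) \<and> r \<in> range (node (tab a)))"

section \<open>Preservation of the invariants by lookup and insertion\<close>

lemma table_ok_update:
  assumes ok: "table_ok T N" and "3 \<le> N" "l \<in> {1..N}" "r \<in> {1..N}"
  shows "table_ok (T((c, l, r) := Suc N)) (Suc N)"
  unfolding table_ok_def
proof (intro conjI allI HOL.impI)
  let ?T = "T((c, l, r) := Suc N)"
  fix c' l' r' assume nz: "?T (c', l', r') \<noteq> 0"
  have "3 < ?T (c', l', r') \<and> ?T (c', l', r') \<le> Suc N \<and> l' \<in> {1..Suc N} \<and> r' \<in> {1..Suc N}"
  proof (cases "(c', l', r') = (c, l, r)")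
    case True
    then show ?thesis using assms by auto
  next
    case False
    then have "?T (c', l', r') = T (c', l', r')" by (rule fun_upd_other)
    then show ?thesis using table_okD[OF ok, of c' l' r'] nz by auto
  qed
  then show "3 < ?T (c', l', r')" "?T (c', l', r') \<le> Suc N" "l' \<in> {1..Suc N}" "r' \<in> {1..Suc N}"
    by blast+
next
  let ?T = "T((c, l, r) := Suc N)"
  fix k k' assume *: "?T k = ?T k'" "?T k \<noteq> 0"
  have less: "T k \<noteq> Suc N" for k
  proof (cases k)
    case (fields c l r)
    then show ?thesis using table_okD(2)[OF ok, of c l r] by auto
  qed
  show "k = k'"
  proof (cases "k = (c, l, r) \<or> k' = (c, l, r)")
    case True
    then show ?thesis using *(1) less[of k] less[of k'] by (auto split: if_splits)
  next
    case False
    then show ?thesis using * table_ok_inject[OF ok, of k k'] by simp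
  qed
qed

text \<open>The condition that \<open>l\<close> and \<open>r\<close> are formulas is imposed for
  connectives only: the parent of a digit node is a trie node and may be no formula, as the root
  shows.\<close>

lemma explained_mk:
  assumes a: "explained F a" and l: "l \<in> {1..cnt a}" and r: "r \<in> {1..cnt a}"
    and form: "c \<in> {3, 4, 5} \<Longrightarrow> l \<in> range (node (tab a)) \<and> r \<in> range (node (tab a))"
  shows "explained F (mk c l r a)" "table_le (tab a) (tab (mk c l r a))"
    "cur (mk c l r a) = tab (mk c l r a) (c, l, r)" "stk (mk c l r a) = stk a"
    "qs (mk c l r a) = qs a" "phase (mk c l r a) = phase a"
proof -
  show "stk (mk c l r a) = stk a" "qs (mk c l r a) = qs a" "phase (mk c l r a) = phase a"
    "cur (mk c l r a) = tab (mk c l r a) (c, l, r)" and le: "table_le (tab a) (tab (mk c l r a))"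
    by (auto simp: mk_def Let_def table_le_def)
  have ok: "table_ok (tab a) (cnt a)" and ir: "in_range a"
    using a by (auto simp: explained_def in_range_def)
  show "explained F (mk c l r a)"
  proof (cases "tab a (c, l, r) = 0")
    case False
    have "tab a (c, l, r) \<in> {1..cnt a}" using table_okD[OF ok False] by simp
    then have "in_range (mk c l r a)" using ir False by (simp add: in_range_def mk_def)
    then show ?thesis using a False by (simp add: explained_def mk_def)
  next
    case new: True
    define w where "w = Suc (cnt a)"
    define b where "b = mk c l r a"
    have b: "cur b = w" "cnt b = w" "tab b = (tab a)((c, l, r) := w)" "stk b = stk a" "qs b = qs a"
      "adj b = fold add_link (new_links c l r w) (adj a)"
      "wl b = (if c = 5 \<and> l = r then push w (wl a) else wl a)" "phase b = phase a"
      using new by (auto simp: b_def mk_def w_def Let_def)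
    have members: "v \<le> w \<and> u \<le> w \<and> x \<le> w" if "(v, u, x) \<in> set (new_links c l r w)" for v u x
      using new_links_members[OF that] l r by (auto simp: w_def)
    \<comment> \<open>Formulas numbered 0 are left out because the insertion may number
      them.\<close>
    have node_le: "range (node (tab a)) - {0} \<subseteq> range (node (tab b))"
    proof
      fix x assume "x \<in> range (node (tab a)) - {0}"
      then obtain A where "x = node (tab a) A" "node (tab a) A \<noteq> 0" by auto
      then have "x = node (tab b) A" using node_mono[OF ok le] by (simp add: b_def)
      then show "x \<in> range (node (tab b))" by blast
    qed
    have "in_range b"
      unfolding in_range_def
    proof (intro conjI)
      show "table_ok (tab b) (cnt b)"
        using table_ok_update[OF ok _ l r] ir by (simp add: b w_def in_range_def)
      show "\<forall>(x, c) \<in> set (stk b). x \<in> {1..cnt b} \<and> c \<in> {3, 4, 5}"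
        using ir by (fastforce simp: b w_def in_range_def)
      show "(\<Sum>v\<le>cnt b. length (adj b v)) \<le> 4 * cnt b"
      proof -
        have "\<forall>(v, u, x) \<in> set (new_links c l r w). v \<le> w" using members by auto
        from sum_add_links[OF this]
        have "(\<Sum>v\<le>cnt b. length (adj b v)) = (\<Sum>v\<le>w. length (adj a v)) + length (new_links c l r w)"
          by (simp only: b)
        moreover have "(\<Sum>v\<le>w. length (adj a v)) \<le> 4 * cnt a"
          using ir by (simp add: w_def in_range_def)
        ultimately show ?thesis
          using length_new_links[of c l r w] by (simp add: b(2) w_def)
      qed
      show "\<forall>v. cnt b < v \<longrightarrow> adj b v = []"
      proof (intro allI HOL.impI)
        fix v assume v: "cnt b < v"
        then have "v \<notin> fst ` set (new_links c l r w)"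
          by (auto simp: b dest!: members)
        then show "adj b v = []"
          using add_links_other ir v by (simp add: b in_range_def w_def)
      qed
      show "link_set (adj b) = table_links (tab b)"
        using ir new by (simp add: b link_set_add_links table_links_update w_def in_range_def)
    qed (use ir in \<open>auto simp: b w_def in_range_def\<close>)
    moreover have "set (wl b) = insert 1 F \<union> {w. w \<noteq> 0 \<and> (\<exists>l. tab b (5, l, l) = w)}"
    proof -
      let ?X = "\<lambda>T. {w. w \<noteq> 0 \<and> (\<exists>l. T (5, l, l) = w)} :: nat set"
      have wl: "set (wl a) = insert 1 F \<union> ?X (tab a)"
        using a by (simp add: explained_def)
      have "?X (tab b) = (if c = 5 \<and> l = r then insert w (?X (tab a)) else ?X (tab a))"
      proof (cases "c = 5 \<and> l = r")
        case True
        have "x \<in> ?X (tab b) \<longleftrightarrow> x = w \<or> x \<in> ?X (tab a)" for x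
        proof
          assume "x \<in> ?X (tab b)"
          then show "x = w \<or> x \<in> ?X (tab a)" by (auto simp: b split: if_splits)
        next
          assume "x = w \<or> x \<in> ?X (tab a)"
          then show "x \<in> ?X (tab b)"
          proof
            assume "x = w"
            moreover have "tab b (5, l, l) = w" using True by (simp add: b)
            ultimately show ?thesis by (auto simp: w_def)
          next
            assume "x \<in> ?X (tab a)"
            then obtain i where i: "tab a (5, i, i) = x" "x \<noteq> 0" by blast
            then have "(5, i, i) \<noteq> (c, l, r)" using new by metis
            then have "tab b (5, i, i) = x" using i by (auto simp: b)
            then show ?thesis using i by blast
          qed
        qed
        then have "?X (tab b) = insert w (?X (tab a))" by blast
        then show ?thesis unfolding if_P[OF True] .
      next
        case False
        then have "tab b (5, i, i) = tab a (5, i, i)" for i by (auto simp: b)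
        then show ?thesis unfolding if_not_P[OF False] by simp
      qed
      moreover have "set (wl b) = (if c = 5 \<and> l = r then insert w (set (wl a)) else set (wl a))"
        unfolding b(7) by (rule if_cong[OF refl, THEN trans[OF if_distrib]]) simp_all
      ultimately show ?thesis
        unfolding wl by (cases "c = 5 \<and> l = r") (simp_all only: if_True if_False simp_thms, blast)
    qed
    moreover have "l' \<in> range (node (tab b)) \<and> r' \<in> range (node (tab b))"
      if "c' \<in> {3, 4, 5}" "tab b (c', l', r') \<noteq> 0" for c' l' r'
    proof (cases "(c', l', r') = (c, l, r)")
      case True
      then show ?thesis using form that(1) node_le l r by auto
    next
      case False
      then have nz: "tab a (c', l', r') \<noteq> 0" using that(2) by (auto simp: b)
      then have "l' \<in> range (node (tab a)) \<and> r' \<in> range (node (tab a))"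
        using a that(1) unfolding explained_def by blast
      then show ?thesis using table_okD(3,4)[OF ok nz] node_le by auto
    qed
    ultimately show ?thesis by (simp add: explained_def b_def)
  qed
qed

text \<open>Records the invariant before every symbol, since the machine has to respect its bounds
  throughout and must find a nonempty stack at each closing parenthesis.\<close>

fun path :: "pstate \<Rightarrow> sym list \<Rightarrow> pstate \<Rightarrow> bool" where
  "path a [] b \<longleftrightarrow> a = b"
| "path a (x # xs) b \<longleftrightarrow> in_range a \<and> (x = RParen \<longrightarrow> stk a \<noteq> []) \<and> path (scan x a) xs b"

lemma path_append: "path a xs b \<Longrightarrow> path b ys c \<Longrightarrow> path a (xs @ ys) c"
  by (induction xs arbitrary: a) auto

definition advances :: "pstate \<Rightarrow> sym list \<Rightarrow> pstate \<Rightarrow> bool" where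
  "advances a xs b \<longleftrightarrow> path a xs b \<and> in_range b \<and> table_le (tab a) (tab b) \<and>
     stk b = stk a \<and> phase b = phase a"

lemma advances_trans:
  "advances a xs b \<Longrightarrow> advances b ys c \<Longrightarrow> advances a (xs @ ys) c"
  by (auto simp: advances_def intro: path_append table_le_trans)

section \<open>Reading digits, formulas and lists of formulas\<close>

lemma explained_in_range: "explained F a \<Longrightarrow> in_range a"
  by (simp add: explained_def)

lemma in_range_cur: "in_range a \<Longrightarrow> cur a \<in> {1..cnt a}"
  by (simp add: in_range_def)

lemma in_range_ok: "in_range a \<Longrightarrow> table_ok (tab a) (cnt a)"
  by (simp add: in_range_def)

text \<open>The walk is taken in the table at the end, not in the one at the beginning: the entry
  found or created for the first digit survives the later ones.\<close>

lemma scan_digits: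
  assumes "explained F a" "set ds \<subseteq> {Zero, One}"
  shows "\<exists>b. advances a ds b \<and> explained F b \<and> qs b = qs a \<and> cur b = walk (tab b) (cur a) ds"
  using assms
proof (induction ds arbitrary: a)
  case Nil
  then show ?case
    by (auto simp: advances_def walk_def table_le_refl explained_in_range)
next
  case (Cons d ds)
  let ?a = "scan d a"
  have d: "?a = mk (sym_code d) (cur a) (cur a) a" "sym_code d \<notin> {3, 4, 5}" "d \<noteq> RParen"
    using Cons.prems by auto
  have cur: "cur a \<in> {1..cnt a}" using Cons.prems explained_in_range in_range_cur by blast
  note mk = explained_mk[OF Cons.prems(1) cur cur, of "sym_code d", folded d(1)]
  have ex: "explained F ?a" using mk d(2) by blast
  obtain b where b: "advances ?a ds b" "explained F b" "qs b = qs ?a"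
    "cur b = walk (tab b) (cur ?a) ds"
    using Cons.IH[OF ex] Cons.prems by auto
  have "tab ?a (sym_code d, cur a, cur a) = cur ?a" "cur ?a \<noteq> 0"
    using mk d(2) in_range_cur[OF explained_in_range[OF ex]] by auto
  then have "tab b (sym_code d, cur a, cur a) = cur ?a"
    using b(1) by (auto simp: advances_def table_le_def)
  then have "cur b = walk (tab b) (cur a) (d # ds)"
    using b(4) by (simp add: walk_def)
  moreover have "advances a [d] ?a"
    using mk d Cons.prems(1) ex by (simp add: advances_def explained_in_range)
  from advances_trans[OF this b(1)] have "advances a (d # ds) b" by simp
  moreover have "qs b = qs a" using b(3) mk d(2) by simp
  ultimately show ?case using b(2) by blast
qed

lemma explained_cur:
  assumes "explained F a" "x \<in> {1..cnt a}"
  shows "explained F (a\<lparr>cur := x\<rparr>)"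
proof -
  have "in_range (a\<lparr>cur := x\<rparr>)"
    using explained_in_range[OF assms(1)] assms(2) by (simp add: in_range_def)
  then show ?thesis using assms(1) by (simp add: explained_def)
qed

lemma explained_stk:
  assumes "explained F a" "\<forall>(x, c) \<in> set ss. x \<in> {1..cnt a} \<and> c \<in> {3, 4, 5}"
  shows "explained F (a\<lparr>stk := ss\<rparr>)"
proof -
  have "in_range (a\<lparr>stk := ss\<rparr>)"
    using explained_in_range[OF assms(1)] assms(2) by (simp add: in_range_def)
  then show ?thesis using assms(1) by (simp add: explained_def)
qed

lemma explained_phase:
  assumes "explained F a"
  shows "explained F (a\<lparr>phase := 1\<rparr>)"
proof -
  have "in_range (a\<lparr>phase := 1\<rparr>)"
    using explained_in_range[OF assms] by (simp add: in_range_def)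
  then show ?thesis using assms by (simp add: explained_def)
qed

text \<open>The step of \<open>scan_form\<close> common to the three connectives; the first two
  assumptions are its induction hypotheses for the operands.\<close>

lemma scan_binary:
  assumes A: "\<And>a. explained F a \<Longrightarrow> \<exists>b. advances a xs b \<and> explained F b \<and> qs b = qs a \<and>
      cur b = node (tab b) A"
    and B: "\<And>a. explained F a \<Longrightarrow> \<exists>b. advances a ys b \<and> explained F b \<and> qs b = qs a \<and>
      cur b = node (tab b) B"
    and c: "sym_code x \<in> {3, 4, 5}" and ex: "explained F a"
  shows "\<exists>b. advances a (LParen # xs @ x # ys @ [RParen]) b \<and> explained F b \<and> qs b = qs a \<and>
    cur b = tab b (sym_code x, node (tab b) A, node (tab b) B)"
proof -
  obtain a1 where a1: "advances a xs a1" "explained F a1" "qs a1 = qs a" "cur a1 = node (tab a1) A"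
    using A[OF ex] by blast
  define a2 where "a2 = a1\<lparr>stk := stk a1 @ [(cur a1, sym_code x)]\<rparr>"
  have cur1: "cur a1 \<in> {1..cnt a1}" using a1 explained_in_range in_range_cur by blast
  have "x \<in> {SAnd, SOr, SImp}" using c by (cases x) auto
  then have a2: "scan x a1 = a2" "x \<noteq> RParen" by (auto simp: a2_def)
  have "\<forall>(y, d) \<in> set (stk a1). y \<in> {1..cnt a1} \<and> d \<in> {3, 4, 5}"
    using explained_in_range[OF a1(2)] by (simp add: in_range_def)
  then have ex2: "explained F a2"
    unfolding a2_def using cur1 c by (intro explained_stk[OF a1(2)]) auto
  obtain a3 where a3: "advances a2 ys a3" "explained F a3" "qs a3 = qs a2" "cur a3 = node (tab a3) B"
    using B[OF ex2] by blast
  have stk3: "stk a3 = stk a1 @ [(cur a1, sym_code x)]" and phase3: "phase a3 = phase a1"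
    using a3(1) by (auto simp: advances_def a2_def)
  have le13: "table_le (tab a1) (tab a3)" using a3(1) by (simp add: advances_def a2_def)
  \<comment> \<open>The number stacked before the right operand was read still denotes
    \<open>A\<close> in the larger table.\<close>
  have A3: "cur a1 = node (tab a3) A"
    using node_mono[OF in_range_ok[OF explained_in_range[OF a1(2)]] le13, of A] a1(4) cur1 by simp
  let ?a3 = "a3\<lparr>stk := stk a1\<rparr>"
  have range3: "in_range a3" using a3(2) by (rule explained_in_range)
  have ex3: "explained F ?a3"
    using range3 stk3 by (intro explained_stk[OF a3(2)]) (auto simp: in_range_def)
  define b where "b = mk (sym_code x) (cur a1) (cur a3) ?a3"
  have b: "scan RParen a3 = b" using stk3 by (simp add: b_def)
  have args: "cur a1 \<in> {1..cnt ?a3}" "cur a3 \<in> {1..cnt ?a3}"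
    using range3 stk3 by (auto simp: in_range_def)
  note mk = explained_mk[OF ex3 args, of "sym_code x", folded b_def]
  have mk': "explained F b" "table_le (tab a3) (tab b)"
    "cur b = tab b (sym_code x, cur a1, cur a3)" "stk b = stk a1" "qs b = qs a3" "phase b = phase a3"
    using mk A3 a3(4) by auto
  have nodes: "node (tab b) A = cur a1" "node (tab b) B = cur a3"
    using node_mono[OF in_range_ok[OF range3] mk'(2)] A3 a3(4) args by auto
  have "path a1 (x # ys @ [RParen]) b"
    using a1(2) a2 a3(1) b range3 stk3
    by (auto simp: advances_def explained_in_range intro!: path_append)
  then have "advances a1 (x # ys @ [RParen]) b"
    using mk' le13 phase3 by (auto simp: advances_def explained_in_range intro: table_le_trans)
  moreover have "advances a [LParen] a"
    using ex by (simp add: advances_def explained_in_range table_le_refl)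
  ultimately have "advances a (LParen # xs @ x # ys @ [RParen]) b"
    using advances_trans[OF _ advances_trans[OF a1(1)]] by fastforce
  then show ?thesis using mk' nodes a1(3) a3(3) by (auto simp: a2_def)
qed

lemma scan_constant:
  assumes "explained F a" "scan x a = a\<lparr>cur := n\<rparr>" "x \<noteq> RParen" "n \<in> {1, 2, 3}"
  shows "advances a [x] (a\<lparr>cur := n\<rparr>)" "explained F (a\<lparr>cur := n\<rparr>)"
proof -
  have "n \<in> {1..cnt a}"
    using assms(4) explained_in_range[OF assms(1)] by (auto simp: in_range_def)
  then show ex: "explained F (a\<lparr>cur := n\<rparr>)" by (rule explained_cur[OF assms(1)])
  show "advances a [x] (a\<lparr>cur := n\<rparr>)"
    using assms ex by (simp add: advances_def explained_in_range table_le_refl)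
qed

lemma scan_form:
  assumes "explained F a"
  shows "\<exists>b. advances a (form_string A) b \<and> explained F b \<and> qs b = qs a \<and> cur b = node (tab b) A"
  using assms
proof (induction A arbitrary: a)
  case (Var i)
  note a = scan_constant[OF Var, of SVar 3]
  obtain b where b: "advances (a\<lparr>cur := 3\<rparr>) (numeral_string i) b" "explained F b"
    "qs b = qs a" "cur b = walk (tab b) 3 (numeral_string i)"
    using scan_digits[OF a(2) set_numeral_string[of i]] by auto
  with advances_trans[OF a(1) b(1)] show ?case by auto
next
  case Top
  show ?case using scan_constant[OF Top, of STop 1] by (intro exI[of _ "a\<lparr>cur := 1\<rparr>"]) simp
next
  case Bot
  show ?case using scan_constant[OF Bot, of SBot 2] by (intro exI[of _ "a\<lparr>cur := 2\<rparr>"]) simp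
next
  case (And A B)
  show ?case using scan_binary[of F "form_string A" A "form_string B" B SAnd a] And by simp
next
  case (Or A B)
  show ?case using scan_binary[of F "form_string A" A "form_string B" B SOr a] Or by simp
next
  case (Imp A B)
  show ?case using scan_binary[of F "form_string A" A "form_string B" B SImp a] Imp by simp
qed

lemma scan_hypotheses:
  assumes "explained F a" "phase a = 0"
  shows "\<exists>b. advances a (forms_string As) b \<and> explained (F \<union> node (tab b) ` set As) b \<and>
    qs b = qs a \<and> (\<forall>A \<in> set As. node (tab b) A \<noteq> 0)"
  using assms
proof (induction As arbitrary: F a)
  case Nil
  then show ?case
    by (auto simp: forms_string_def advances_def table_le_refl explained_in_range)
next
  case (Cons A As)
  obtain a1 where a1: "advances a (form_string A) a1" "explained F a1" "qs a1 = qs a"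
    "cur a1 = node (tab a1) A"
    using scan_form[OF Cons.prems(1)] by blast
  note range1 = explained_in_range[OF a1(2)]
  define a2 where "a2 = a1\<lparr>wl := push (cur a1) (wl a1)\<rparr>"
  have ph: "phase a1 = 0" using a1(1) Cons.prems by (simp add: advances_def)
  then have scan: "scan Comma a1 = a2" by (simp add: a2_def)
  have range2: "in_range a2" using range1 by (simp add: in_range_def a2_def)
  then have ex2: "explained (insert (cur a1) F) a2"
    using a1(2) by (auto simp: explained_def a2_def)
  have "advances a1 [Comma] a2"
    using range1 range2 scan by (simp add: advances_def) (simp add: a2_def table_le_refl)
  with a1(1) have adv: "advances a (form_string A @ [Comma]) a2" by (rule advances_trans)
  obtain b where b: "advances a2 (forms_string As) b"
    "explained (insert (cur a1) F \<union> node (tab b) ` set As) b" "qs b = qs a2"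
    "\<forall>A \<in> set As. node (tab b) A \<noteq> 0"
    using Cons.IH[OF ex2] ph by (auto simp: a2_def)
  have nz: "node (tab a1) A \<noteq> 0" using in_range_cur[OF range1] a1(4) by simp
  have node: "node (tab b) A = cur a1"
    using node_mono[OF in_range_ok[OF range1] _ nz, of "tab b"] b(1) a1(4)
    by (simp add: advances_def a2_def)
  have "advances a (forms_string (A # As)) b"
    using advances_trans[OF adv b(1)] by (simp add: forms_string_def)
  moreover have "explained (F \<union> node (tab b) ` set (A # As)) b"
    using b(2) node by (simp add: insert_commute)
  moreover have "\<forall>B \<in> set (A # As). node (tab b) B \<noteq> 0" using b(4) node nz a1(4) by simp
  moreover have "qs b = qs a" using b(3) a1(3) by (simp add: a2_def)
  ultimately show ?case by blast
qed

lemma scan_queries: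
  assumes "explained F a" "phase a = 1"
  shows "\<exists>b. advances a (forms_string As) b \<and> explained F b \<and>
    qs b = qs a @ map (node (tab b)) As \<and> (\<forall>A \<in> set As. node (tab b) A \<noteq> 0)"
  using assms
proof (induction As arbitrary: a)
  case Nil
  then show ?case
    by (auto simp: forms_string_def advances_def table_le_refl explained_in_range)
next
  case (Cons A As)
  obtain a1 where a1: "advances a (form_string A) a1" "explained F a1" "qs a1 = qs a"
    "cur a1 = node (tab a1) A"
    using scan_form[OF Cons.prems(1)] by blast
  note range1 = explained_in_range[OF a1(2)]
  define a2 where "a2 = a1\<lparr>qs := qs a1 @ [cur a1]\<rparr>"
  have ph: "phase a1 = 1" using a1(1) Cons.prems by (simp add: advances_def)
  then have scan: "scan Comma a1 = a2" by (simp add: a2_def)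
  have range2: "in_range a2" using range1 by (simp add: in_range_def a2_def)
  then have ex2: "explained F a2"
    using a1(2) by (auto simp: explained_def a2_def)
  have "advances a1 [Comma] a2"
    using range1 range2 scan by (simp add: advances_def) (simp add: a2_def table_le_refl)
  with a1(1) have adv: "advances a (form_string A @ [Comma]) a2" by (rule advances_trans)
  obtain b where b: "advances a2 (forms_string As) b"
    "explained F b" "qs b = qs a2 @ map (node (tab b)) As" "\<forall>A \<in> set As. node (tab b) A \<noteq> 0"
    using Cons.IH[OF ex2] ph by (auto simp: a2_def)
  have nz: "node (tab a1) A \<noteq> 0" using in_range_cur[OF range1] a1(4) by simp
  have node: "node (tab b) A = cur a1"
    using node_mono[OF in_range_ok[OF range1] _ nz, of "tab b"] b(1) a1(4)
    by (simp add: advances_def a2_def)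
  have "advances a (forms_string (A # As)) b"
    using advances_trans[OF adv b(1)] by (simp add: forms_string_def)
  moreover have "\<forall>B \<in> set (A # As). node (tab b) B \<noteq> 0" using b(4) node nz a1(4) by simp
  moreover have "qs b = qs a @ map (node (tab b)) (A # As)"
    using b(3) a1(3) node by (simp add: a2_def)
  ultimately show ?case using b(2) by blast
qed

lemma explained_start: "explained {} start"
  by (auto simp: explained_def in_range_def start_def table_ok_def link_set_def table_links_def)

lemma scan_instance:
  "\<exists>a. path start (instance_string (hs, gs)) a \<and> explained (node (tab a) ` set hs) a \<and>
    qs a = map (node (tab a)) gs \<and> (\<forall>A \<in> set hs \<union> set gs. node (tab a) A \<noteq> 0)"
proof -
  obtain a1 where a1: "advances start (forms_string hs) a1" "explained (node (tab a1) ` set hs) a1"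
    "qs a1 = []" "\<forall>A \<in> set hs. node (tab a1) A \<noteq> 0"
    using scan_hypotheses[OF explained_start] by (auto simp: start_def)
  let ?a2 = "a1\<lparr>phase := 1\<rparr>"
  have ex2: "explained (node (tab a1) ` set hs) ?a2"
    using a1(2) by (rule explained_phase)
  obtain b where b: "advances ?a2 (forms_string gs) b" "explained (node (tab a1) ` set hs) b"
    "qs b = map (node (tab b)) gs" "\<forall>A \<in> set gs. node (tab b) A \<noteq> 0"
    using scan_queries[OF ex2, of gs] a1(3) by auto
  \<comment> \<open>Reading the queries enlarges the table but keeps the nonzero nodes of the
    hypotheses.\<close>
  have node: "node (tab b) A = node (tab a1) A" if "A \<in> set hs" for A
    using node_mono[OF in_range_ok[OF explained_in_range[OF a1(2)]], of "tab b" A] b(1) a1(4) that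
    by (simp add: advances_def)
  then have "node (tab b) ` set hs = node (tab a1) ` set hs" by auto
  moreover have "path start (instance_string (hs, gs)) b"
    using a1 b explained_in_range
    by (auto simp: instance_string_def advances_def intro!: path_append)
  ultimately show ?thesis using b a1(4) node by (intro exI[of _ b]) auto
qed

section \<open>Saturation\<close>

text \<open>\<open>ws\<close> is the worklist, \<open>h\<close> the entry being processed and
  \<open>k\<close> the position in its adjacency list. Processed entries stay, so \<open>ws\<close>
  is at once the queue and the set of derived nodes.\<close>

fun saturate_step :: "adjacency \<Rightarrow> nat list \<times> nat \<times> nat \<Rightarrow> nat list \<times> nat \<times> nat" where
  "saturate_step f (ws, h, k) =
     (if k < length (f (ws ! h)) then
        (if fst (f (ws ! h) ! k) \<in> set ws then push (snd (f (ws ! h) ! k)) ws else ws, h, Suc k)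
      else (ws, Suc h, 0))"

text \<open>The number of steps made so far: a finished node has cost one step per link and one for
  moving on.\<close>

definition progress :: "adjacency \<Rightarrow> nat list \<times> nat \<times> nat \<Rightarrow> nat" where
  "progress f = (\<lambda>(ws, h, k). (\<Sum>i<h. Suc (length (f (ws ! i)))) + k)"

text \<open>A visited link of \<open>ws ! i\<close> is only required to have fired if its other premise
  was queued no later than \<open>ws ! i\<close>; symmetry of the links covers the other order.\<close>

definition saturating ::
  "adjacency \<Rightarrow> nat \<Rightarrow> nat list \<Rightarrow> (nat \<Rightarrow> bool) \<Rightarrow> nat list \<times> nat \<times> nat \<Rightarrow> bool" where
  "saturating f N vs G = (\<lambda>(ws, h, k).
     distinct ws \<and> set vs \<subseteq> set ws \<and> set ws \<subseteq> {1..N} \<and> (\<forall>x \<in> set ws. G x) \<and> h \<le> length ws \<and>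
     (if h < length ws then k \<le> length (f (ws ! h)) else k = 0) \<and>
     (\<forall>i j m. j \<le> i \<longrightarrow> i < length ws \<longrightarrow> m < length (f (ws ! i)) \<longrightarrow> i < h \<or> i = h \<and> m < k \<longrightarrow>
        fst (f (ws ! i) ! m) = ws ! j \<longrightarrow> snd (f (ws ! i) ! m) \<in> set ws))"

lemma push_prefix: "\<exists>us. push v ws = ws @ us"
  by (auto simp: push_def)

text \<open>\<open>G\<close> will be provability, so the invariant carries soundness. The list grows
  only at its end, so the entries up to a given position never change and what was established for
  them persists.\<close>

lemma saturating_step:
  assumes inv: "saturating f N vs G (ws, h, k)" and h: "h < length ws"
    and sound: "\<And>v u c. (v, u, c) \<in> link_set f \<Longrightarrow> G v \<Longrightarrow> G u \<Longrightarrow> G c"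
    and range: "\<And>v u c. (v, u, c) \<in> link_set f \<Longrightarrow> c \<in> {1..N}"
  shows "saturating f N vs G (saturate_step f (ws, h, k))"
    and "progress f (saturate_step f (ws, h, k)) = Suc (progress f (ws, h, k))"
proof -
  let ?v = "ws ! h"
  have inv': "distinct ws" "set vs \<subseteq> set ws" "set ws \<subseteq> {1..N}" "\<forall>x \<in> set ws. G x"
    "k \<le> length (f ?v)"
    and fired: "\<And>i j m. j \<le> i \<Longrightarrow> i < length ws \<Longrightarrow> m < length (f (ws ! i)) \<Longrightarrow> i < h \<or> i = h \<and> m < k \<Longrightarrow>
        fst (f (ws ! i) ! m) = ws ! j \<Longrightarrow> snd (f (ws ! i) ! m) \<in> set ws"
    using inv h by (auto simp: saturating_def)
  have "saturating f N vs G (saturate_step f (ws, h, k)) \<and>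
    progress f (saturate_step f (ws, h, k)) = Suc (progress f (ws, h, k))"
  proof (cases "k < length (f ?v)")
    case False
    then have k: "k = length (f ?v)" using inv' by simp
    have "snd (f (ws ! i) ! m) \<in> set ws"
      if "j \<le> i" "i < length ws" "m < length (f (ws ! i))" "i < Suc h" "fst (f (ws ! i) ! m) = ws ! j"
      for i j m
    proof (cases "i = h")
      case True
      then show ?thesis using fired[of j i m] that k by simp
    next
      case False
      then show ?thesis using fired[of j i m] that by simp
    qed
    then show ?thesis
      using False h inv' k by (simp add: saturating_def progress_def)
  next
    case True
    obtain u c where uc: "f ?v ! k = (u, c)" by (cases "f ?v ! k")
    then have link: "(?v, u, c) \<in> link_set f"
      using nth_mem[OF True] by (simp add: link_set_def)
    define ws' where "ws' = (if u \<in> set ws then push c ws else ws)"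
    obtain us where us: "ws' = ws @ us"
      using push_prefix[of c ws] unfolding ws'_def by (cases "u \<in> set ws") auto
    have step: "saturate_step f (ws, h, k) = (ws', h, Suc k)"
      using True uc by (simp add: ws'_def)
    have "u \<in> set ws \<Longrightarrow> G c"
      using sound[OF link] inv'(4) h nth_mem by blast
    then have basic: "distinct ws'" "set vs \<subseteq> set ws'" "set ws' \<subseteq> {1..N}" "\<forall>x \<in> set ws'. G x"
      using inv' range[OF link] by (auto simp: ws'_def)
    have nth: "ws' ! i = ws ! i" if "i < length ws" for i
      using that by (simp add: us nth_append)
    have fired': "snd (f (ws' ! i) ! m) \<in> set ws'"
      if ji: "j \<le> i" and i: "i < length ws'" and m: "m < length (f (ws' ! i))"
        and pos: "i < h \<or> i = h \<and> m < Suc k" and eq: "fst (f (ws' ! i) ! m) = ws' ! j" for i j m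
    proof -
      \<comment> \<open>Entries appended now lie behind position \<open>h\<close>, so both positions
        belong to the old list.\<close>
      have il: "i < length ws" "j < length ws" using pos h ji by auto
      show ?thesis
      \<comment> \<open>\<open>i = h\<close> with \<open>m = k\<close> is the link visited in this
        step. Its other premise was queued no later than \<open>ws ! h\<close>, so it is present and
        the link fires.\<close>
      proof (cases "i = h \<and> m = k")
        case True
        then have "u = ws ! j" using eq il uc by (simp add: nth)
        then have "c \<in> set ws'" using il by (simp add: ws'_def)
        then show ?thesis using True il uc by (simp add: nth)
      next
        case False
        then have "snd (f (ws ! i) ! m) \<in> set ws"
          using fired[of j i m] ji il m pos eq by (auto simp: nth)
        then show ?thesis unfolding nth[OF il(1)] by (simp add: us)
      qed
    qed
    have "(\<Sum>i<h. Suc (length (f (ws' ! i)))) = (\<Sum>i<h. Suc (length (f (ws ! i))))"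
      using h nth by (intro sum.cong) auto
    moreover have "saturating f N vs G (ws', h, Suc k)"
      unfolding saturating_def split_conv
    proof (intro conjI allI HOL.impI)
      fix i j m
      assume "j \<le> i" "i < length ws'" "m < length (f (ws' ! i))" "i < h \<or> i = h \<and> m < Suc k"
        "fst (f (ws' ! i) ! m) = ws' ! j"
      then show "snd (f (ws' ! i) ! m) \<in> set ws'" by (rule fired')
    qed (use basic True nth[OF h] h us in auto)
    ultimately show ?thesis
      unfolding step by (simp add: progress_def)
  qed
  then show "saturating f N vs G (saturate_step f (ws, h, k))"
    "progress f (saturate_step f (ws, h, k)) = Suc (progress f (ws, h, k))" by auto
qed

text \<open>Nodes are queued at most once, so the adjacency lists walked through belong to distinct
  nodes and their lengths add up to at most the total.\<close>

lemma progress_bound: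
  assumes inv: "saturating f N vs G (ws, h, k)" and h: "h < length ws"
  shows "progress f (ws, h, k) < (\<Sum>v\<le>N. length (f v)) + N"
proof -
  have ws: "distinct ws" "set ws \<subseteq> {1..N}" "k \<le> length (f (ws ! h))"
    using inv h by (auto simp: saturating_def)
  have "progress f (ws, h, k) < (\<Sum>i<Suc h. Suc (length (f (ws ! i))))"
    using ws(3) by (simp add: progress_def)
  also have "\<dots> = (\<Sum>v \<in> (\<lambda>i. ws ! i) ` {..<Suc h}. Suc (length (f v)))"
    using ws(1) h by (intro sum.reindex_cong[symmetric, OF _ refl refl]) (auto simp: inj_on_def nth_eq_iff_index_eq)
  also have "\<dots> \<le> (\<Sum>v \<in> {1..N}. Suc (length (f v)))"
    using ws(2) h by (intro sum_mono2) (auto simp del: atLeastAtMost_iff intro!: nth_mem[THEN subsetD[OF ws(2)]])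
  also have "\<dots> = (\<Sum>v \<in> {1..N}. length (f v)) + N"
    by (simp add: sum_Suc)
  also have "\<dots> \<le> (\<Sum>v\<le>N. length (f v)) + N"
    by (intro add_right_mono sum_mono2) auto
  finally show ?thesis .
qed

text \<open>Of the two links of a clause, the one at the premise queued later was visited when both
  premises were present, so it fired.\<close>

lemma saturated_closed:
  assumes inv: "saturating f N vs G (ws, length ws, k)"
    and sym: "\<And>v u c. (v, u, c) \<in> link_set f \<Longrightarrow> (u, v, c) \<in> link_set f"
    and link: "(v, u, c) \<in> link_set f" and mem: "v \<in> set ws" "u \<in> set ws"
  shows "c \<in> set ws"
proof -
  have *: "c \<in> set ws"
    if ij: "(ws ! i, ws ! j, c) \<in> link_set f" "j \<le> i" "i < length ws" for i j
  proof -
    have "(ws ! j, c) \<in> set (f (ws ! i))" using ij(1) by (simp add: link_set_def)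
    then obtain m where m: "m < length (f (ws ! i))" "f (ws ! i) ! m = (ws ! j, c)"
      unfolding in_set_conv_nth by blast
    have "\<forall>i j m. j \<le> i \<longrightarrow> i < length ws \<longrightarrow> m < length (f (ws ! i)) \<longrightarrow>
        fst (f (ws ! i) ! m) = ws ! j \<longrightarrow> snd (f (ws ! i) ! m) \<in> set ws"
      using inv by (simp add: saturating_def)
    then have "snd (f (ws ! i) ! m) \<in> set ws"
      using ij(2,3) m by (metis fst_conv)
    then show ?thesis using m(2) by simp
  qed
  obtain i j where "i < length ws" "v = ws ! i" "j < length ws" "u = ws ! j"
    using mem by (auto simp: in_set_conv_nth)
  then show ?thesis
    using *[of i j] *[of j i] link sym[OF link] by (cases "j \<le> i") auto
qed

section \<open>Soundness and completeness of the saturated set\<close>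

definition proves :: "table \<Rightarrow> form set \<Rightarrow> nat \<Rightarrow> bool" where
  "proves T H x \<longleftrightarrow> (\<exists>A. node T A = x \<and> H \<turnstile> A)"

lemma proves_node:
  assumes "table_ok T N" "node T A \<noteq> 0" "proves T H (node T A)"
  shows "H \<turnstile> A"
  using assms node_inject unfolding proves_def by metis

text \<open>Each clause is an instance of a rule, because the children of a connective node are
  formulas and a nonzero number determines its formula.\<close>

lemma proves_link:
  assumes ok: "table_ok T N"
    and form: "\<And>c l r. c \<in> {3, 4, 5} \<Longrightarrow> T (c, l, r) \<noteq> 0 \<Longrightarrow>
      l \<in> range (node T) \<and> r \<in> range (node T)"
    and link: "(v, u, x) \<in> table_links T" and v: "proves T H v" and u: "proves T H u"
  shows "proves T H x"
proof -
  obtain c l r where nz: "T (c, l, r) \<noteq> 0" and x: "(v, u, x) \<in> set (new_links c l r (T (c, l, r)))"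
    using link by (auto simp: table_links_def)
  then have c: "c \<in> {3, 4, 5}" by (auto simp: new_links_def split: if_splits)
  obtain A B where AB: "l = node T A" "r = node T B"
    using form[OF c nz] by blast
  have nz': "node T A \<noteq> 0" "node T B \<noteq> 0" using table_okD(3,4)[OF ok nz] AB by auto
  note pr = proves_node[OF ok nz'(1), of H] proves_node[OF ok nz'(2), of H]
  have intro: "proves T H (node T C)" if "H \<turnstile> C" for C
    using that by (auto simp: proves_def)
  consider "c = 3" | "c = 4" | "c = 5" using c by auto
  then show ?thesis
  proof cases
    case 1
    let ?w = "node T (A \<^bold>\<and> B)"
    have w: "?w \<noteq> 0" using nz AB 1 by simp
    note pw = proves_node[OF ok w, of H]
    consider "v = ?w" "x = node T A" | "v = ?w" "x = node T B"
      | "v = node T A" "u = node T B" "x = ?w" | "v = node T B" "u = node T A" "x = ?w"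
      using x AB 1 by (auto simp: new_links_def)
    then show ?thesis
    proof cases
      case 1
      then show ?thesis using intro[OF entails.andE1[OF pw]] v by simp
    next
      case 2
      then show ?thesis using intro[OF entails.andE2[OF pw]] v by simp
    next
      case 3
      then show ?thesis using intro[OF entails.andI[OF pr]] v u by simp
    next
      case 4
      then show ?thesis using intro[OF entails.andI[OF pr]] v u by simp
    qed
  next
    case 2
    let ?w = "node T (A \<^bold>\<or> B)"
    have w: "?w \<noteq> 0" using nz AB 2 by simp
    note pw = proves_node[OF ok w, of H]
    consider "v = node T A" "x = ?w" | "v = node T B" "x = ?w"
      | "v = ?w" "x = node T A" "node T A = node T B"
      using x AB 2 by (auto simp: new_links_def split: if_splits)
    then show ?thesis
    proof cases
      case 1
      then show ?thesis using intro[OF entails.orI1[OF pr(1)]] v by simp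
    next
      case 2
      then show ?thesis using intro[OF entails.orI2[OF pr(2)]] v by simp
    next
      case 3
      \<comment> \<open>Operands with equal numbers are the same formula, so \<open>orE\<close>
        applies.\<close>
      then have "A = B" using node_inject[OF ok _ nz'(1)] by blast
      then have "H \<turnstile> A \<^bold>\<or> A" using pw v 3 by blast
      then show ?thesis using intro[OF entails.orE] 3(2) by blast
    qed
  next
    case 3
    let ?w = "node T (A \<^bold>\<rightarrow> B)"
    have w: "?w \<noteq> 0" using nz AB 3 by simp
    note pw = proves_node[OF ok w, of H]
    consider "v = node T B" "x = ?w" | "v = node T A" "u = ?w" "x = node T B"
      | "v = ?w" "u = node T A" "x = node T B"
      using x AB 3 by (auto simp: new_links_def)
    then show ?thesis
    proof cases
      case 1
      then show ?thesis using intro[OF entails.impI[OF pr(2)]] v by simp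
    next
      case 2
      then show ?thesis using intro[OF entails.impE[OF pr(1) pw]] v u by simp
    next
      case 3
      then show ?thesis using intro[OF entails.impE[OF pr(1) pw]] v u by simp
    qed
  qed
qed

text \<open>Soundness is part of the assumption on \<open>D\<close>. For completeness,
  \<open>entails_in_closure\<close> is applied with the numbered formulas as \<open>S\<close>, which
  are closed under subformulas, and those with number in \<open>D\<close> as \<open>C\<close>; this
  requires 2, the number of \<bottom>, to be absent from \<open>D\<close>.\<close>

lemma closed_iff_entails:
  assumes ex: "explained (node (tab a) ` set hs) a"
    and hs: "\<forall>A \<in> set hs. node (tab a) A \<noteq> 0" and q: "node (tab a) q \<noteq> 0"
    and D: "set (wl a) \<subseteq> D" "\<forall>x \<in> D. proves (tab a) (set hs) x"
    and closed: "\<And>v u c. (v, u, c) \<in> table_links (tab a) \<Longrightarrow> v \<in> D \<Longrightarrow> u \<in> D \<Longrightarrow> c \<in> D"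
  shows "node (tab a) q \<in> D \<or> 2 \<in> D \<longleftrightarrow> set hs \<turnstile> q"
proof
  let ?T = "tab a"
  have ok: "table_ok ?T (cnt a)" using ex explained_in_range in_range_ok by blast
  {
    assume "node ?T q \<in> D \<or> 2 \<in> D"
    then show "set hs \<turnstile> q"
    proof
      assume "node ?T q \<in> D"
      then show ?thesis using D(2) proves_node[OF ok q] by blast
    next
      assume "2 \<in> D"
      then have "proves ?T (set hs) (node ?T \<^bold>\<bottom>)" using D(2) by simp
      then have "set hs \<turnstile> \<^bold>\<bottom>" by (intro proves_node[OF ok]) simp_all
      then show ?thesis by (rule entails.botE)
    qed
  next
    assume q': "set hs \<turnstile> q"
    show "node ?T q \<in> D \<or> 2 \<in> D"
    proof (rule ccontr)
      assume neg: "\<not> ?thesis"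
      let ?S = "{A. node ?T A \<noteq> 0}" and ?C = "{A. node ?T A \<noteq> 0 \<and> node ?T A \<in> D}"
      have wl: "set (wl a) = insert 1 (node ?T ` set hs) \<union> {w. w \<noteq> 0 \<and> (\<exists>l. ?T (5, l, l) = w)}"
        using ex by (simp add: explained_def)
      have args: "node ?T A \<noteq> 0 \<and> node ?T B \<noteq> 0" if "?T (c, node ?T A, node ?T B) \<noteq> 0" for c A B
        using table_okD(3,4)[OF ok that] by blast
      have fire: "x \<in> D" if "?T (c, l, r) \<noteq> 0" "(v, u, x) \<in> set (new_links c l r (?T (c, l, r)))"
        "v \<in> D" "u \<in> D" for c l r v u x
        using that by (intro closed[of v u x]) (auto simp: table_links_def)
      have "q \<in> ?C"
      proof (rule entails_in_closure[where S = ?S and H = "set hs"])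
        fix A B assume "A \<^bold>\<and> B \<in> ?S"
        then have nz: "?T (3, node ?T A, node ?T B) \<noteq> 0" by simp
        then show "A \<in> ?S \<and> B \<in> ?S" using args by simp
        show "A \<^bold>\<and> B \<in> ?C \<longleftrightarrow> A \<in> ?C \<and> B \<in> ?C"
          using nz args[OF nz] fire[OF nz, unfolded new_links_def] by auto
      next
        fix A B assume "A \<^bold>\<or> B \<in> ?S"
        then have nz: "?T (4, node ?T A, node ?T B) \<noteq> 0" by simp
        then show "A \<in> ?S \<and> B \<in> ?S" using args by simp
        show "A \<^bold>\<or> B \<in> ?C" if "A \<in> ?C \<or> B \<in> ?C"
          using that nz args[OF nz] fire[OF nz, unfolded new_links_def] by auto
      next
        fix A B assume "A \<^bold>\<rightarrow> B \<in> ?S"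
        then have nz: "?T (5, node ?T A, node ?T B) \<noteq> 0" by simp
        then show "A \<in> ?S \<and> B \<in> ?S" using args by simp
        show "A \<^bold>\<rightarrow> B \<in> ?C" if "B \<in> ?C"
          using that nz args[OF nz] fire[OF nz, unfolded new_links_def] by auto
        show "B \<in> ?C" if "A \<^bold>\<rightarrow> B \<in> ?C" "A \<in> ?C"
          using that nz args[OF nz] fire[OF nz, unfolded new_links_def] by auto
      next
        fix A assume "A \<^bold>\<or> A \<in> ?S" "A \<^bold>\<or> A \<in> ?C"
        then have nz: "?T (4, node ?T A, node ?T A) \<noteq> 0" "?T (4, node ?T A, node ?T A) \<in> D" by auto
        then show "A \<in> ?C"
          using args[OF nz(1)] fire[OF nz(1), unfolded new_links_def] by auto
      next
        fix A assume "A \<^bold>\<rightarrow> A \<in> ?S"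
        then show "A \<^bold>\<rightarrow> A \<in> ?C" using D(1) wl by auto
      qed (use q q' hs D(1) wl neg in auto)
      then show False using neg by simp
    qed
  }
qed

section \<open>A language with three-dimensional arrays and its translation to RAM code\<close>

datatype exp =
    Lit nat
  | Reg nat
  | Plus exp exp
  | Minus exp exp
  | Cell exp exp exp

text \<open>There are no loops: a command takes at most as many steps as its code is long, and the
  three loops of the program are built separately by \<open>loop_code\<close>.\<close>

datatype com =
    Skip
  | Asg nat exp
  | Upd exp exp exp exp
  | Input nat
  | Output exp
  | Seq com com
  | Cond exp com com

record vstate =
  reg :: "nat \<Rightarrow> nat"
  arr :: "nat \<times> nat \<times> nat \<Rightarrow> nat"
  vin :: "nat list"
  vout :: "nat list"

fun val :: "exp \<Rightarrow> vstate \<Rightarrow> nat" where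
  "val (Lit n) \<sigma> = n"
| "val (Reg r) \<sigma> = reg \<sigma> r"
| "val (Plus a b) \<sigma> = val a \<sigma> + val b \<sigma>"
| "val (Minus a b) \<sigma> = val a \<sigma> - val b \<sigma>"
| "val (Cell a i j) \<sigma> = arr \<sigma> (val a \<sigma>, val i \<sigma>, val j \<sigma>)"

text \<open>Bounds every intermediate value by \<open>W\<close>; a truncated difference inherits the
  bound of its first operand.\<close>

fun exp_safe :: "nat \<Rightarrow> exp \<Rightarrow> vstate \<Rightarrow> bool" where
  "exp_safe W (Lit n) \<sigma> \<longleftrightarrow> n \<le> W"
| "exp_safe W (Reg r) \<sigma> \<longleftrightarrow> reg \<sigma> r \<le> W"
| "exp_safe W (Plus a b) \<sigma> \<longleftrightarrow> exp_safe W a \<sigma> \<and> exp_safe W b \<sigma> \<and> val a \<sigma> + val b \<sigma> \<le> W"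
| "exp_safe W (Minus a b) \<sigma> \<longleftrightarrow> exp_safe W a \<sigma> \<and> exp_safe W b \<sigma>"
| "exp_safe W (Cell a i j) \<sigma> \<longleftrightarrow>
     exp_safe W a \<sigma> \<and> exp_safe W i \<sigma> \<and> exp_safe W j \<sigma> \<and> val (Cell a i j) \<sigma> \<le> W"

lemma exp_safe_val: "exp_safe W e \<sigma> \<Longrightarrow> val e \<sigma> \<le> W"
  by (induction e) auto

fun sem :: "com \<Rightarrow> vstate \<Rightarrow> vstate" where
  "sem Skip \<sigma> = \<sigma>"
| "sem (Asg r e) \<sigma> = \<sigma>\<lparr>reg := (reg \<sigma>)(r := val e \<sigma>)\<rparr>"
| "sem (Upd a i j e) \<sigma> = \<sigma>\<lparr>arr := (arr \<sigma>)((val a \<sigma>, val i \<sigma>, val j \<sigma>) := val e \<sigma>)\<rparr>"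
| "sem (Input r) \<sigma> =
     (case vin \<sigma> of [] \<Rightarrow> \<sigma>\<lparr>reg := (reg \<sigma>)(r := 0)\<rparr>
      | x # xs \<Rightarrow> \<sigma>\<lparr>reg := (reg \<sigma>)(r := x), vin := xs\<rparr>)"
| "sem (Output e) \<sigma> = \<sigma>\<lparr>vout := vout \<sigma> @ [val e \<sigma>]\<rparr>"
| "sem (Seq c d) \<sigma> = sem d (sem c \<sigma>)"
| "sem (Cond e c d) \<sigma> = (if val e \<sigma> \<noteq> 0 then sem c \<sigma> else sem d \<sigma>)"

fun safe :: "nat \<Rightarrow> com \<Rightarrow> vstate \<Rightarrow> bool" where
  "safe W Skip \<sigma> \<longleftrightarrow> True"
| "safe W (Asg r e) \<sigma> \<longleftrightarrow> exp_safe W e \<sigma>"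
| "safe W (Upd a i j e) \<sigma> \<longleftrightarrow>
     exp_safe W a \<sigma> \<and> exp_safe W i \<sigma> \<and> exp_safe W j \<sigma> \<and> exp_safe W e \<sigma>"
| "safe W (Input r) \<sigma> \<longleftrightarrow> (\<forall>x \<in> set (vin \<sigma>). x \<le> W)"
| "safe W (Output e) \<sigma> \<longleftrightarrow> exp_safe W e \<sigma>"
| "safe W (Seq c d) \<sigma> \<longleftrightarrow> safe W c \<sigma> \<and> safe W d (sem c \<sigma>)"
| "safe W (Cond e c d) \<sigma> \<longleftrightarrow>
     exp_safe W e \<sigma> \<and> (if val e \<sigma> \<noteq> 0 then safe W c \<sigma> else safe W d \<sigma>)"

section \<open>An injective quadratic coding of pairs and the memory layout\<close>

definition pairing :: "nat \<Rightarrow> nat \<Rightarrow> nat" where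
  "pairing i j = (i + j) * (i + j) + i"

text \<open>Since \<open>i\<close> is at most \<open>i + j\<close>, the value lies between the
  square of \<open>i + j\<close> and the next square, so it determines the sum. Unlike Cantor's
  pairing, this one involves no division.\<close>

lemma pairing_sum_le:
  assumes "pairing i j = pairing i' j'"
  shows "i + j \<le> i' + j'"
proof (rule ccontr)
  assume "\<not> ?thesis"
  then have "Suc (i' + j') * Suc (i' + j') \<le> (i + j) * (i + j)"
    by (intro mult_le_mono) auto
  with assms show False by (simp add: pairing_def)
qed

lemma pairing_inject [simp]: "pairing i j = pairing i' j' \<longleftrightarrow> i = i' \<and> j = j'"
proof
  assume eq: "pairing i j = pairing i' j'"
  have "i + j = i' + j'"
    using pairing_sum_le[OF eq] pairing_sum_le[OF eq[symmetric]] by simp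
  with eq show "i = i' \<and> j = j'" by (simp add: pairing_def)
qed simp

lemma pairing_mono: "i \<le> i' \<Longrightarrow> j \<le> j' \<Longrightarrow> pairing i j \<le> pairing i' j'"
  unfolding pairing_def by (intro add_mono mult_le_mono) auto

text \<open>Registers, temporaries and array cells live in different residue classes modulo 4.\<close>

definition reg_addr :: "nat \<Rightarrow> nat" where
  "reg_addr r = 4 * r"

definition temp_addr :: "nat \<Rightarrow> nat" where
  "temp_addr d = 4 * d + 1"

fun cell_addr :: "nat \<times> nat \<times> nat \<Rightarrow> nat" where
  "cell_addr (a, i, j) = 4 * pairing (pairing i j) a + 2"

lemma reg_addr_inject [simp]: "reg_addr r = reg_addr r' \<longleftrightarrow> r = r'"
  by (simp add: reg_addr_def)

lemma temp_addr_inject [simp]: "temp_addr d = temp_addr d' \<longleftrightarrow> d = d'"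
  by (simp add: temp_addr_def)

lemma cell_addr_inject [simp]: "cell_addr k = cell_addr k' \<longleftrightarrow> k = k'"
  by (cases k; cases k') auto

lemma addr_mod_4: "reg_addr r mod 4 = 0" "temp_addr d mod 4 = 1" "cell_addr k mod 4 = 2"
  by (cases k, simp add: reg_addr_def temp_addr_def mod_Suc)+

lemma addr_distinct [simp]:
  "reg_addr r \<noteq> temp_addr d" "temp_addr d \<noteq> reg_addr r"
  "reg_addr r \<noteq> cell_addr k" "cell_addr k \<noteq> reg_addr r"
  "temp_addr d \<noteq> cell_addr k" "cell_addr k \<noteq> temp_addr d"
  using addr_mod_4(1)[of r] addr_mod_4(2)[of d] addr_mod_4(3)[of k] by auto

declare cell_addr.simps [simp del]

section \<open>Compilation to instructions\<close>

definition addr_code :: "nat \<Rightarrow> instr list" where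
  "addr_code d =
    (let x = temp_addr d; y = temp_addr (Suc d); z = temp_addr (Suc (Suc d)) in
     [Add y x y, Mul y y y, Add x x y,
      Add y x z, Mul y y y, Add x x y,
      Const y 4, Mul x x y, Const y 2, Add x x y])"

text \<open>Temporaries form a stack: the result goes to number \<open>d\<close>, those above are
  scratch and those below are preserved. The indices are evaluated in the order \<open>i\<close>,
  \<open>j\<close>, \<open>a\<close> because \<open>addr_code\<close> pairs the first two and then
  adds the third.\<close>

fun exp_code :: "nat \<Rightarrow> exp \<Rightarrow> instr list" where
  "exp_code d (Lit n) = [Const (temp_addr d) n]"
| "exp_code d (Reg r) = [Move (temp_addr d) (reg_addr r)]"
| "exp_code d (Plus a b) =
     exp_code d a @ exp_code (Suc d) b @ [Add (temp_addr d) (temp_addr d) (temp_addr (Suc d))]"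
| "exp_code d (Minus a b) =
     exp_code d a @ exp_code (Suc d) b @ [Sub (temp_addr d) (temp_addr d) (temp_addr (Suc d))]"
| "exp_code d (Cell a i j) =
     exp_code d i @ exp_code (Suc d) j @ exp_code (Suc (Suc d)) a @ addr_code d @
     [Load (temp_addr d) (temp_addr d)]"

text \<open>Jump targets are absolute, so code depends on its position; its length does not, and is
  computed first in order to place the later parts.\<close>

fun com_length :: "com \<Rightarrow> nat" where
  "com_length Skip = 0"
| "com_length (Asg r e) = length (exp_code 0 e) + 1"
| "com_length (Upd a i j e) =
     length (exp_code 0 e) + length (exp_code 1 i) + length (exp_code 2 j) +
     length (exp_code 3 a) + length (addr_code 1) + 1"
| "com_length (Input r) = 1"
| "com_length (Output e) = length (exp_code 0 e) + 1"
| "com_length (Seq c d) = com_length c + com_length d"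
| "com_length (Cond e c d) = length (exp_code 0 e) + com_length c + com_length d + 2"

fun com_code :: "nat \<Rightarrow> com \<Rightarrow> instr list" where
  "com_code p Skip = []"
| "com_code p (Asg r e) = exp_code 0 e @ [Move (reg_addr r) (temp_addr 0)]"
| "com_code p (Upd a i j e) =
     exp_code 0 e @ exp_code 1 i @ exp_code 2 j @ exp_code 3 a @ addr_code 1 @
     [Store (temp_addr 1) (temp_addr 0)]"
| "com_code p (Input r) = [Read (reg_addr r)]"
| "com_code p (Output e) = exp_code 0 e @ [Write (temp_addr 0)]"
| "com_code p (Seq c d) = com_code p c @ com_code (p + com_length c) d"
| "com_code p (Cond e c d) =
     (let q = p + length (exp_code 0 e) + 1; r = q + com_length c + 1 in
      exp_code 0 e @ [JumpZero (temp_addr 0) r] @ com_code q c @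
      [Jump (r + com_length d)] @ com_code r d)"

lemma length_com_code [simp]: "length (com_code p c) = com_length c"
  by (induction c arbitrary: p) (auto simp: Let_def)

definition loop_length :: "exp \<Rightarrow> com \<Rightarrow> nat" where
  "loop_length e c = length (exp_code 0 e) + com_length c + 2"

definition loop_code :: "nat \<Rightarrow> exp \<Rightarrow> com \<Rightarrow> instr list" where
  "loop_code p e c =
     exp_code 0 e @ [JumpZero (temp_addr 0) (p + loop_length e c)] @
     com_code (p + length (exp_code 0 e) + 1) c @ [Jump p]"

lemma length_loop_code [simp]: "length (loop_code p e c) = loop_length e c"
  by (simp add: loop_code_def loop_length_def)

section \<open>Execution of code segments within the memory bound\<close>

definition code_at :: "instr list \<Rightarrow> nat \<Rightarrow> instr list \<Rightarrow> bool" where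
  "code_at P p xs \<longleftrightarrow> (\<exists>us vs. P = us @ xs @ vs \<and> length us = p)"

lemma code_at_append:
  "code_at P p (xs @ ys) \<Longrightarrow> code_at P p xs \<and> code_at P (p + length xs) ys"
  unfolding code_at_def
proof (elim exE conjE, intro conjI)
  fix us vs assume *: "P = us @ (xs @ ys) @ vs" "length us = p"
  show "\<exists>us vs. P = us @ xs @ vs \<and> length us = p"
    using * by (intro exI[of _ us] exI[of _ "ys @ vs"]) simp
  show "\<exists>us vs. P = us @ ys @ vs \<and> length us = p + length xs"
    using * by (intro exI[of _ "us @ xs"] exI[of _ vs]) simp
qed

lemma code_at_Cons:
  "code_at P p (x # xs) \<Longrightarrow> p < length P \<and> P ! p = x \<and> code_at P (Suc p) xs"
proof -
  assume *: "code_at P p (x # xs)"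
  then have "code_at P (Suc p) xs"
    using code_at_append[of P p "[x]" xs] by simp
  moreover obtain us vs where "P = us @ (x # xs) @ vs" "length us = p"
    using * by (auto simp only: code_at_def)
  then have "p < length P \<and> P ! p = x" by (simp add: nth_append)
  ultimately show ?thesis by blast
qed

definition bounded :: "nat \<Rightarrow> config \<Rightarrow> bool" where
  "bounded B s \<longleftrightarrow> (\<forall>a. mem s a < B)"

text \<open>The bound is demanded in every configuration passed through, as in
  \<open>linear_time_computable\<close>.\<close>

definition reach :: "instr list \<Rightarrow> nat \<Rightarrow> nat \<Rightarrow> config \<Rightarrow> config \<Rightarrow> bool" where
  "reach P B n s s' \<longleftrightarrow> (step P ^^ n) s = s' \<and> (\<forall>i\<le>n. bounded B ((step P ^^ i) s))"

lemma reach_0: "bounded B s \<Longrightarrow> reach P B 0 s s"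
  by (simp add: reach_def)

lemma reach_bounded: "reach P B n s s' \<Longrightarrow> bounded B s'"
  by (auto simp: reach_def)

lemma reach_trans:
  assumes "reach P B m s s'" "reach P B n s' s''"
  shows "reach P B (m + n) s s''"
proof -
  have *: "(step P ^^ (m + i)) s = (step P ^^ i) s'" for i
    using assms(1) by (simp add: reach_def add.commute[of m] funpow_add)
  have "bounded B ((step P ^^ i) s)" if "i \<le> m + n" for i
  proof (cases "i \<le> m")
    case False
    then show ?thesis using *[of "i - m"] assms(2) that by (auto simp: reach_def)
  qed (use assms(1) in \<open>auto simp: reach_def\<close>)
  then show ?thesis using * assms(2) by (auto simp: reach_def)
qed

lemma reach_exec:
  assumes "code_at P (pc s) (x # xs)" "bounded B s" "bounded B (exec x s)"
  shows "reach P B 1 s (exec x s)"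
proof -
  have "step P s = exec x s"
    using code_at_Cons[OF assms(1)] by (simp add: step_def halted_def)
  then show ?thesis using assms by (auto simp: reach_def le_Suc_eq)
qed

lemma bounded_assign [simp]: "bounded B s \<Longrightarrow> bounded B (assign a v s) \<longleftrightarrow> v < B"
  by (auto simp: bounded_def assign_def)

lemma mem_assign [simp]: "mem (assign a v s) = (mem s)(a := v)"
  and pc_assign [simp]: "pc (assign a v s) = Suc (pc s)"
  and inp_assign [simp]: "inp (assign a v s) = inp s"
  and outp_assign [simp]: "outp (assign a v s) = outp s"
  by (simp_all add: assign_def)

fun straight :: "nat \<Rightarrow> instr list \<Rightarrow> config \<Rightarrow> bool" where
  "straight B [] s \<longleftrightarrow> True"
| "straight B (x # xs) s \<longleftrightarrow>
     pc (exec x s) = Suc (pc s) \<and> bounded B (exec x s) \<and> straight B xs (exec x s)"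

lemma reach_straight:
  assumes "code_at P (pc s) xs" "bounded B s" "straight B xs s"
  shows "reach P B (length xs) s (fold exec xs s)"
  using assms
proof (induction xs arbitrary: s)
  case (Cons x xs)
  have "reach P B 1 s (exec x s)"
    using Cons.prems by (intro reach_exec[where xs = xs]) auto
  moreover have "reach P B (length xs) (exec x s) (fold exec xs (exec x s))"
    using Cons.prems code_at_Cons[OF Cons.prems(1)] by (intro Cons.IH) auto
  ultimately show ?case using reach_trans by fastforce
qed (simp add: reach_0)

text \<open>Temporaries are unconstrained, so code segments can be composed without tracking what
  they left behind.\<close>

definition represents :: "config \<Rightarrow> vstate \<Rightarrow> bool" where
  "represents s \<sigma> \<longleftrightarrow>
     (\<forall>r. mem s (reg_addr r) = reg \<sigma> r) \<and> (\<forall>k. mem s (cell_addr k) = arr \<sigma> k) \<and>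
     inp s = vin \<sigma> \<and> outp s = vout \<sigma>"

lemma represents_assign_temp [simp]:
  "represents (assign (temp_addr d) v s) \<sigma> \<longleftrightarrow> represents s \<sigma>"
  by (simp add: represents_def)

text \<open>Bounding addresses is enough, because the address of a cell is at least as large as its
  indices and so bounds the stored values too. \<open>4 \<le> W\<close> accounts for the constants
  in \<open>addr_code\<close>.\<close>

definition roomy :: "nat \<Rightarrow> nat \<Rightarrow> bool" where
  "roomy W B \<longleftrightarrow> 4 \<le> W \<and> (\<forall>a i j. a \<le> W \<longrightarrow> i \<le> W \<longrightarrow> j \<le> W \<longrightarrow> cell_addr (a, i, j) < B)"

lemma square_ge: "(x::nat) \<le> x * x"
  by (cases x) auto

lemma roomy_less:
  assumes "roomy W B" "v \<le> W"
  shows "v < B"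
proof -
  have "pairing v 0 \<le> pairing (pairing v 0) 0"
    using square_ge[of "pairing v 0"] by (simp add: pairing_def)
  then have "v \<le> cell_addr (0, v, 0)"
    by (simp add: cell_addr.simps pairing_def)
  also have "\<dots> < B"
    using assms by (simp add: roomy_def)
  finally show ?thesis .
qed

lemma addr_code_correct:
  assumes code: "code_at P (pc s) (addr_code d)"
    and s: "bounded B s" "represents s \<sigma>" and room: "roomy W B"
    and vals: "mem s (temp_addr d) = i" "mem s (temp_addr (Suc d)) = j"
      "mem s (temp_addr (Suc (Suc d))) = a"
    and le: "i \<le> W" "j \<le> W" "a \<le> W"
  shows "\<exists>s'. reach P B (length (addr_code d)) s s' \<and> pc s' = pc s + length (addr_code d) \<and>
    mem s' (temp_addr d) = cell_addr (a, i, j) \<and> represents s' \<sigma> \<and>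
    (\<forall>d'<d. mem s' (temp_addr d') = mem s (temp_addr d'))"
proof -
  \<comment> \<open>Naming the intermediate results turns the memory bounds into linear arithmetic:
    each of them is at most the final address, as a square dominates its root.\<close>
  obtain m u p m' q w w4 where defs: "i + j = m" "m * m = u" "i + u = p" "p + a = m'" "m' * m' = q"
    "p + q = w" "w * 4 = w4" by blast
  have addr: "w4 + 2 = cell_addr (a, i, j)"
    by (simp add: cell_addr.simps pairing_def add.commute mult.commute flip: defs)
  then have "w4 + 2 < B"
    using room le by (simp add: roomy_def)
  moreover have "m \<le> u" "m' \<le> q" "4 < B"
    using square_ge[of m, unfolded defs(2)] square_ge[of m', unfolded defs(5)]
      roomy_less[OF room, of 4] room by (simp_all add: roomy_def)
  ultimately have B: "m < B" "u < B" "p < B" "m' < B" "q < B" "w < B" "w4 < B" "w4 + 2 < B"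
    "4 < B" "2 < B"
    using defs(1,3,4,6,7) by linarith+
  have *: "straight B (addr_code d) s"
    using B s(1) by (simp add: addr_code_def Let_def vals defs del: add_2_eq_Suc')
  have "represents (fold exec (addr_code d) s) \<sigma>"
    using s(2) by (simp add: represents_def addr_code_def Let_def)
  moreover have "pc (fold exec (addr_code d) s) = pc s + length (addr_code d)"
    "\<forall>d'<d. mem (fold exec (addr_code d) s) (temp_addr d') = mem s (temp_addr d')"
    by (simp_all add: addr_code_def Let_def)
  moreover have "mem (fold exec (addr_code d) s) (temp_addr d) = cell_addr (a, i, j)"
    by (simp add: addr_code_def Let_def vals defs flip: addr)
  ultimately show ?thesis using reach_straight[OF code s(1) *] by blast
qed

lemma exp_code_correct:
  assumes "code_at P (pc s) (exp_code d e)" "exp_safe W e \<sigma>"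
    "bounded B s" "represents s \<sigma>" "roomy W B"
  shows "\<exists>s'. reach P B (length (exp_code d e)) s s' \<and> pc s' = pc s + length (exp_code d e) \<and>
    mem s' (temp_addr d) = val e \<sigma> \<and> represents s' \<sigma> \<and>
    (\<forall>d'<d. mem s' (temp_addr d') = mem s (temp_addr d'))"
  using assms
proof (induction e arbitrary: d s)
  case (Lit n)
  have "reach P B 1 s (exec (Const (temp_addr d) n) s)"
    using Lit by (intro reach_exec[where xs = "[]"]) (auto intro: roomy_less)
  then show ?case using Lit
    by (intro exI[of _ "exec (Const (temp_addr d) n) s"]) simp
next
  case (Reg r)
  have "reach P B 1 s (exec (Move (temp_addr d) (reg_addr r)) s)"
    using Reg by (intro reach_exec[where xs = "[]"]) (auto intro: roomy_less simp: represents_def)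
  then show ?case using Reg
    by (intro exI[of _ "exec (Move (temp_addr d) (reg_addr r)) s"]) (simp add: represents_def)
next
  case (Plus a b)
  note code = code_at_append[OF Plus.prems(1)[unfolded exp_code.simps]]
  obtain s1 where s1: "reach P B (length (exp_code d a)) s s1"
    "pc s1 = pc s + length (exp_code d a)" "mem s1 (temp_addr d) = val a \<sigma>" "represents s1 \<sigma>"
    "\<forall>d'<d. mem s1 (temp_addr d') = mem s (temp_addr d')"
    using Plus.IH(1)[of s d] Plus.prems code by auto
  note code1 = code_at_append[OF code[THEN conjunct2, folded s1(2)]]
  obtain s2 where s2: "reach P B (length (exp_code (Suc d) b)) s1 s2"
    "pc s2 = pc s1 + length (exp_code (Suc d) b)" "mem s2 (temp_addr (Suc d)) = val b \<sigma>"
    "represents s2 \<sigma>" "\<forall>d'<Suc d. mem s2 (temp_addr d') = mem s1 (temp_addr d')"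
    using Plus.IH(2)[of s1 "Suc d"] Plus.prems code1 reach_bounded[OF s1(1)] s1 by auto
  let ?x = "Add (temp_addr d) (temp_addr d) (temp_addr (Suc d))"
  have "reach P B 1 s2 (exec ?x s2)"
    using code1 s2 s1 reach_bounded[OF s2(1)] Plus.prems
    by (intro reach_exec[where xs = "[]"]) (auto intro: roomy_less)
  from reach_trans[OF s1(1) reach_trans[OF s2(1) this]]
  have "reach P B (length (exp_code d (Plus a b))) s (exec ?x s2)" by simp
  moreover have "represents (exec ?x s2) \<sigma>"
    using s2(4) by simp
  ultimately show ?case using s1 s2 by (intro exI[of _ "exec ?x s2"]) auto
next
  case (Minus a b)
  note code = code_at_append[OF Minus.prems(1)[unfolded exp_code.simps]]
  obtain s1 where s1: "reach P B (length (exp_code d a)) s s1"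
    "pc s1 = pc s + length (exp_code d a)" "mem s1 (temp_addr d) = val a \<sigma>" "represents s1 \<sigma>"
    "\<forall>d'<d. mem s1 (temp_addr d') = mem s (temp_addr d')"
    using Minus.IH(1)[of s d] Minus.prems code by auto
  note code1 = code_at_append[OF code[THEN conjunct2, folded s1(2)]]
  obtain s2 where s2: "reach P B (length (exp_code (Suc d) b)) s1 s2"
    "pc s2 = pc s1 + length (exp_code (Suc d) b)" "mem s2 (temp_addr (Suc d)) = val b \<sigma>"
    "represents s2 \<sigma>" "\<forall>d'<Suc d. mem s2 (temp_addr d') = mem s1 (temp_addr d')"
    using Minus.IH(2)[of s1 "Suc d"] Minus.prems code1 reach_bounded[OF s1(1)] s1 by auto
  let ?x = "Sub (temp_addr d) (temp_addr d) (temp_addr (Suc d))"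
  have "val a \<sigma> - val b \<sigma> < B"
    using exp_safe_val[of W a \<sigma>] Minus.prems by (intro roomy_less[of W]) auto
  then have "reach P B 1 s2 (exec ?x s2)"
    using code1 s2 s1 reach_bounded[OF s2(1)]
    by (intro reach_exec[where xs = "[]"]) auto
  from reach_trans[OF s1(1) reach_trans[OF s2(1) this]]
  have "reach P B (length (exp_code d (Minus a b))) s (exec ?x s2)" by simp
  moreover have "represents (exec ?x s2) \<sigma>"
    using s2(4) by simp
  ultimately show ?case using s1 s2 by (intro exI[of _ "exec ?x s2"]) auto
next
  case (Cell a i j)
  have sf: "exp_safe W a \<sigma>" "exp_safe W i \<sigma>" "exp_safe W j \<sigma>" and vle: "val (Cell a i j) \<sigma> \<le> W"
    using Cell.prems(2) by auto
  note code = code_at_append[OF Cell.prems(1)[unfolded exp_code.simps]]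
  obtain s1 where s1: "reach P B (length (exp_code d i)) s s1"
    "pc s1 = pc s + length (exp_code d i)" "mem s1 (temp_addr d) = val i \<sigma>" "represents s1 \<sigma>"
    "\<forall>d'<d. mem s1 (temp_addr d') = mem s (temp_addr d')"
    using Cell.IH(2)[of s d] Cell.prems code by auto
  note code1 = code_at_append[OF code[THEN conjunct2, folded s1(2)]]
  obtain s2 where s2: "reach P B (length (exp_code (Suc d) j)) s1 s2"
    "pc s2 = pc s1 + length (exp_code (Suc d) j)" "mem s2 (temp_addr (Suc d)) = val j \<sigma>"
    "represents s2 \<sigma>" "\<forall>d'<Suc d. mem s2 (temp_addr d') = mem s1 (temp_addr d')"
    using Cell.IH(3)[of s1 "Suc d"] Cell.prems code1 reach_bounded[OF s1(1)] s1 by auto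
  note code2 = code_at_append[OF code1[THEN conjunct2, folded s2(2)]]
  obtain s3 where s3: "reach P B (length (exp_code (Suc (Suc d)) a)) s2 s3"
    "pc s3 = pc s2 + length (exp_code (Suc (Suc d)) a)"
    "mem s3 (temp_addr (Suc (Suc d))) = val a \<sigma>"
    "represents s3 \<sigma>" "\<forall>d'<Suc (Suc d). mem s3 (temp_addr d') = mem s2 (temp_addr d')"
    using Cell.IH(1)[of s2 "Suc (Suc d)"] Cell.prems code2 reach_bounded[OF s2(1)] s2 by auto
  note code3 = code_at_append[OF code2[THEN conjunct2, folded s3(2)]]
  obtain s4 where s4: "reach P B (length (addr_code d)) s3 s4"
    "pc s4 = pc s3 + length (addr_code d)"
    "mem s4 (temp_addr d) = cell_addr (val a \<sigma>, val i \<sigma>, val j \<sigma>)"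
    "represents s4 \<sigma>" "\<forall>d'<d. mem s4 (temp_addr d') = mem s3 (temp_addr d')"
    using addr_code_correct[OF code3[THEN conjunct1] reach_bounded[OF s3(1)] s3(4) Cell.prems(5),
        of "val i \<sigma>" "val j \<sigma>" "val a \<sigma>"] s1 s2 s3 sf[THEN exp_safe_val] by auto
  let ?x = "Load (temp_addr d) (temp_addr d)"
  have x: "exec ?x s4 = assign (temp_addr d) (val (Cell a i j) \<sigma>) s4"
    using s4 by (simp add: represents_def)
  have "reach P B 1 s4 (exec ?x s4)"
    using code3 s4 reach_bounded[OF s4(1)] roomy_less[OF Cell.prems(5) vle]
    by (intro reach_exec[where xs = "[]"]) (auto simp: x simp del: exec.simps val.simps)
  from reach_trans[OF s1(1) reach_trans[OF s2(1) reach_trans[OF s3(1)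
      reach_trans[OF s4(1) this]]]]
  have "reach P B (length (exp_code d (Cell a i j))) s (exec ?x s4)" by (simp add: add.assoc)
  moreover have "represents (exec ?x s4) \<sigma>"
    using s4(4) by simp
  ultimately show ?case
    using s1 s2 s3 s4 by (intro exI[of _ "exec ?x s4"]) (auto simp: x simp del: exec.simps)
qed

section \<open>Simulation of commands and loops\<close>

definition simulates ::
  "instr list \<Rightarrow> nat \<Rightarrow> nat \<Rightarrow> nat \<Rightarrow> vstate \<Rightarrow> nat \<Rightarrow> vstate \<Rightarrow> bool" where
  "simulates P B t p \<sigma> q \<sigma>' \<longleftrightarrow>
     (\<forall>s. pc s = p \<and> represents s \<sigma> \<and> bounded B s \<longrightarrow>
        (\<exists>n\<le>t. \<exists>s'. reach P B n s s' \<and> pc s' = q \<and> represents s' \<sigma>'))"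

text \<open>Composition works because \<open>simulates\<close> covers every machine state that
  represents the intermediate state, whatever its temporaries hold.\<close>

lemma simulates_trans:
  assumes "simulates P B t p \<sigma> p' \<sigma>'" "simulates P B u p' \<sigma>' p'' \<sigma>''"
  shows "simulates P B (t + u) p \<sigma> p'' \<sigma>''"
  unfolding simulates_def
proof (intro allI HOL.impI)
  fix s assume s: "pc s = p \<and> represents s \<sigma> \<and> bounded B s"
  then obtain n s' where 1: "n \<le> t" "reach P B n s s'" "pc s' = p'" "represents s' \<sigma>'"
    using assms(1) by (auto simp: simulates_def)
  then obtain m s'' where 2: "m \<le> u" "reach P B m s' s''" "pc s'' = p''" "represents s'' \<sigma>''"
    using assms(2) reach_bounded by (auto simp: simulates_def)
  show "\<exists>n\<le>t + u. \<exists>s'. reach P B n s s' \<and> pc s' = p'' \<and> represents s' \<sigma>''"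
    using 1 2 reach_trans[OF 1(2) 2(2)]
    by (intro exI[of _ "n + m"] conjI exI[of _ s'']) auto
qed

lemma simulates_mono: "simulates P B t p \<sigma> q \<sigma>' \<Longrightarrow> t \<le> u \<Longrightarrow> simulates P B u p \<sigma> q \<sigma>'"
  unfolding simulates_def by (blast intro: le_trans)

lemma simulates_test:
  assumes "code_at P p (exp_code 0 e @ JumpZero (temp_addr 0) l # xs)"
    "exp_safe W e \<sigma>" "roomy W B"
  shows "simulates P B (length (exp_code 0 e) + 1) p \<sigma>
    (if val e \<sigma> = 0 then l else p + length (exp_code 0 e) + 1) \<sigma>"
  unfolding simulates_def
proof (intro allI HOL.impI)
  fix s assume s: "pc s = p \<and> represents s \<sigma> \<and> bounded B s"
  note code = code_at_append[OF assms(1)]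
  obtain s1 where s1: "reach P B (length (exp_code 0 e)) s s1"
    "pc s1 = p + length (exp_code 0 e)" "mem s1 (temp_addr 0) = val e \<sigma>" "represents s1 \<sigma>"
    using exp_code_correct[of P s 0 e W \<sigma> B] s assms code by auto
  let ?x = "JumpZero (temp_addr 0) l"
  have b: "bounded B s1" "bounded B (exec ?x s1)"
    using reach_bounded[OF s1(1)] by (auto simp: bounded_def)
  have "reach P B 1 s1 (exec ?x s1)"
    using code s1 b by (intro reach_exec[where xs = xs]) auto
  from reach_trans[OF s1(1) this]
  show "\<exists>n\<le>length (exp_code 0 e) + 1. \<exists>s'. reach P B n s s' \<and>
    pc s' = (if val e \<sigma> = 0 then l else p + length (exp_code 0 e) + 1) \<and> represents s' \<sigma>"
    using s1 by (intro exI[of _ "length (exp_code 0 e) + 1"] conjI exI[of _ "exec ?x s1"])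
      (auto simp: represents_def)
qed

lemma simulates_Jump:
  assumes "code_at P p (Jump l # xs)"
  shows "simulates P B 1 p \<sigma> l \<sigma>"
  unfolding simulates_def
proof (intro allI HOL.impI)
  fix s assume s: "pc s = p \<and> represents s \<sigma> \<and> bounded B s"
  have "reach P B 1 s (exec (Jump l) s)"
    using assms s by (intro reach_exec[where xs = xs]) (auto simp: bounded_def)
  then show "\<exists>n\<le>1. \<exists>s'. reach P B n s s' \<and> pc s' = l \<and> represents s' \<sigma>"
    using s by (intro exI[of _ 1] conjI exI[of _ "exec (Jump l) s"]) (auto simp: represents_def)
qed

text \<open>Jumps inside a command only go forward, so the length of its code bounds the running
  time.\<close>

lemma simulates_com:
  assumes "code_at P p (com_code p c)" "safe W c \<sigma>" "roomy W B"
  shows "simulates P B (com_length c) p \<sigma> (p + com_length c) (sem c \<sigma>)"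
  using assms
proof (induction c arbitrary: p \<sigma>)
  case Skip
  show ?case by (auto simp: simulates_def intro: reach_0)
next
  case (Asg r e)
  show ?case
    unfolding simulates_def
  proof (intro allI HOL.impI)
    fix s assume s: "pc s = p \<and> represents s \<sigma> \<and> bounded B s"
    note code = code_at_append[OF Asg.prems(1)[unfolded com_code.simps]]
    obtain s1 where s1: "reach P B (length (exp_code 0 e)) s s1"
      "pc s1 = p + length (exp_code 0 e)" "mem s1 (temp_addr 0) = val e \<sigma>" "represents s1 \<sigma>"
      using exp_code_correct[of P s 0 e W \<sigma> B] s Asg.prems code by auto
    let ?x = "Move (reg_addr r) (temp_addr 0)"
    have "reach P B 1 s1 (exec ?x s1)"
      using code s1 reach_bounded[OF s1(1)] Asg.prems exp_safe_val[of W e \<sigma>]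
      by (intro reach_exec[where xs = "[]"]) (auto intro: roomy_less)
    from reach_trans[OF s1(1) this]
    show "\<exists>n\<le>com_length (Asg r e). \<exists>s'. reach P B n s s' \<and> pc s' = p + com_length (Asg r e) \<and>
        represents s' (sem (Asg r e) \<sigma>)"
      using s1 by (intro exI[of _ "length (exp_code 0 e) + 1"] conjI exI[of _ "exec ?x s1"])
        (auto simp: represents_def)
  qed
next
  case (Upd a i j e)
  show ?case
    unfolding simulates_def
  proof (intro allI HOL.impI)
    fix s assume s: "pc s = p \<and> represents s \<sigma> \<and> bounded B s"
    have sf: "exp_safe W e \<sigma>" "exp_safe W i \<sigma>" "exp_safe W j \<sigma>" "exp_safe W a \<sigma>"
      using Upd.prems(2) by auto
    note code0 = code_at_append[OF Upd.prems(1)[unfolded com_code.simps]]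
    obtain s1 where s1: "reach P B (length (exp_code 0 e)) s s1"
      "pc s1 = p + length (exp_code 0 e)" "mem s1 (temp_addr 0) = val e \<sigma>" "represents s1 \<sigma>"
      using exp_code_correct[of P s 0 e W \<sigma> B] s Upd.prems code0 by auto
    note code1 = code_at_append[OF code0[THEN conjunct2, folded s1(2)]]
    obtain s2 where s2: "reach P B (length (exp_code 1 i)) s1 s2"
      "pc s2 = pc s1 + length (exp_code 1 i)" "mem s2 (temp_addr 1) = val i \<sigma>" "represents s2 \<sigma>"
      "\<forall>d<1. mem s2 (temp_addr d) = mem s1 (temp_addr d)"
      using exp_code_correct[OF code1[THEN conjunct1] sf(2) reach_bounded[OF s1(1)] s1(4)
          Upd.prems(3)] by blast
    note code2 = code_at_append[OF code1[THEN conjunct2, folded s2(2)]]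
    obtain s3 where s3: "reach P B (length (exp_code 2 j)) s2 s3"
      "pc s3 = pc s2 + length (exp_code 2 j)" "mem s3 (temp_addr 2) = val j \<sigma>" "represents s3 \<sigma>"
      "\<forall>d<2. mem s3 (temp_addr d) = mem s2 (temp_addr d)"
      using exp_code_correct[OF code2[THEN conjunct1] sf(3) reach_bounded[OF s2(1)] s2(4)
          Upd.prems(3)] by blast
    note code3 = code_at_append[OF code2[THEN conjunct2, folded s3(2)]]
    obtain s4 where s4: "reach P B (length (exp_code 3 a)) s3 s4"
      "pc s4 = pc s3 + length (exp_code 3 a)" "mem s4 (temp_addr 3) = val a \<sigma>" "represents s4 \<sigma>"
      "\<forall>d<3. mem s4 (temp_addr d) = mem s3 (temp_addr d)"
      using exp_code_correct[OF code3[THEN conjunct1] sf(4) reach_bounded[OF s3(1)] s3(4)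
          Upd.prems(3)] by blast
    note code4 = code_at_append[OF code3[THEN conjunct2, folded s4(2)]]
    have "mem s4 (temp_addr 1) = val i \<sigma>" "mem s4 (temp_addr (Suc 1)) = val j \<sigma>"
      "mem s4 (temp_addr (Suc (Suc 1))) = val a \<sigma>"
      using s2 s3 s4 by (simp_all add: numeral_2_eq_2 numeral_3_eq_3)
    then obtain s5 where s5: "reach P B (length (addr_code 1)) s4 s5"
      "pc s5 = pc s4 + length (addr_code 1)"
      "mem s5 (temp_addr 1) = cell_addr (val a \<sigma>, val i \<sigma>, val j \<sigma>)" "represents s5 \<sigma>"
      "\<forall>d<1. mem s5 (temp_addr d) = mem s4 (temp_addr d)"
      using addr_code_correct[OF code4[THEN conjunct1] reach_bounded[OF s4(1)] s4(4) Upd.prems(3)]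
        sf[THEN exp_safe_val] by blast
    have v: "mem s5 (temp_addr 0) = val e \<sigma>"
      using s1 s2 s3 s4 s5 by simp
    let ?x = "Store (temp_addr 1) (temp_addr 0)"
    have "reach P B 1 s5 (exec ?x s5)"
      using code4 s5 v reach_bounded[OF s5(1)] roomy_less[OF Upd.prems(3)] sf(1)[THEN exp_safe_val]
      by (intro reach_exec[where xs = "[]"]) auto
    from reach_trans[OF s1(1) reach_trans[OF s2(1) reach_trans[OF s3(1)
        reach_trans[OF s4(1) reach_trans[OF s5(1) this]]]]]
    have "reach P B (com_length (Upd a i j e)) s (exec ?x s5)" by (simp add: add.assoc)
    then show "\<exists>n\<le>com_length (Upd a i j e). \<exists>s'. reach P B n s s' \<and>
        pc s' = p + com_length (Upd a i j e) \<and> represents s' (sem (Upd a i j e) \<sigma>)"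
      using s1 s2 s3 s4 s5 v
      by (intro exI[of _ "com_length (Upd a i j e)"] conjI exI[of _ "exec ?x s5"])
        (auto simp: represents_def)
  qed
next
  case (Input r)
  show ?case
    unfolding simulates_def
  proof (intro allI HOL.impI)
    fix s assume s: "pc s = p \<and> represents s \<sigma> \<and> bounded B s"
    have *: "bounded B (assign (reg_addr r) x s\<lparr>inp := xs\<rparr>)" if "x < B" for x xs
      using s that by (auto simp: bounded_def)
    have "reach P B 1 s (exec (Read (reg_addr r)) s)"
      using Input s roomy_less[OF Input(3)]
      by (intro reach_exec[where xs = "[]"])
        (auto simp: represents_def * split: list.split)
    then show "\<exists>n\<le>com_length (Input r). \<exists>s'. reach P B n s s' \<and> pc s' = p + com_length (Input r) \<and>
        represents s' (sem (Input r) \<sigma>)"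
      using s by (intro exI[of _ 1] conjI exI[of _ "exec (Read (reg_addr r)) s"])
        (auto simp: represents_def split: list.split)
  qed
next
  case (Output e)
  show ?case
    unfolding simulates_def
  proof (intro allI HOL.impI)
    fix s assume s: "pc s = p \<and> represents s \<sigma> \<and> bounded B s"
    note code = code_at_append[OF Output.prems(1)[unfolded com_code.simps]]
    obtain s1 where s1: "reach P B (length (exp_code 0 e)) s s1"
      "pc s1 = p + length (exp_code 0 e)" "mem s1 (temp_addr 0) = val e \<sigma>" "represents s1 \<sigma>"
      using exp_code_correct[of P s 0 e W \<sigma> B] s Output.prems code by auto
    let ?x = "Write (temp_addr 0)"
    have "bounded B s1" "bounded B (exec ?x s1)"
      using reach_bounded[OF s1(1)] by (auto simp: bounded_def)
    then have "reach P B 1 s1 (exec ?x s1)"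
      using code s1 by (intro reach_exec[where xs = "[]"]) auto
    from reach_trans[OF s1(1) this]
    show "\<exists>n\<le>com_length (Output e). \<exists>s'. reach P B n s s' \<and> pc s' = p + com_length (Output e) \<and>
        represents s' (sem (Output e) \<sigma>)"
      using s1 by (intro exI[of _ "length (exp_code 0 e) + 1"] conjI exI[of _ "exec ?x s1"])
        (auto simp: represents_def)
  qed
next
  case (Seq c d)
  note code = code_at_append[OF Seq.prems(1)[unfolded com_code.simps]]
  show ?case
    using simulates_trans[OF Seq.IH(1) Seq.IH(2)] Seq.prems code by (auto simp: add.assoc)
next
  case (Cond e c d)
  define q where "q = p + length (exp_code 0 e) + 1"
  define r where "r = q + com_length c + 1"
  have code: "code_at P p (exp_code 0 e @ JumpZero (temp_addr 0) r # com_code q c @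
      [Jump (r + com_length d)] @ com_code r d)"
    using Cond.prems(1) by (simp add: Let_def q_def r_def)
  from code_at_Cons[OF code_at_append[OF code, THEN conjunct2]]
  have q: "code_at P q (com_code q c @ [Jump (r + com_length d)] @ com_code r d)"
    by (simp add: q_def)
  note cq = code_at_append[OF q]
  from code_at_Cons[of P "q + com_length c" "Jump (r + com_length d)" "com_code r d"] cq
  have r: "code_at P r (com_code r d)" by (simp add: r_def)
  have test: "simulates P B (length (exp_code 0 e) + 1) p \<sigma> (if val e \<sigma> = 0 then r else q) \<sigma>"
    using simulates_test[OF code _ Cond.prems(3)] Cond.prems(2) unfolding q_def by fastforce
  show ?case
  proof (cases "val e \<sigma> = 0")
    case True
    have "simulates P B (com_length d) r \<sigma> (r + com_length d) (sem d \<sigma>)"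
      using Cond.IH(2)[OF r] Cond.prems True by simp
    from simulates_trans[OF test[unfolded if_P[OF True]] this] show ?thesis
      using True by (auto elim!: simulates_mono simp: r_def q_def add_ac)
  next
    case False
    have "simulates P B (com_length c) q \<sigma> (q + com_length c) (sem c \<sigma>)"
      using Cond.IH(1)[of q] cq Cond.prems False by simp
    moreover have "simulates P B 1 (q + com_length c) (sem c \<sigma>) (r + com_length d) (sem c \<sigma>)"
      using simulates_Jump cq by auto
    ultimately have "simulates P B (com_length c + 1) q \<sigma> (r + com_length d) (sem c \<sigma>)"
      by (rule simulates_trans)
    from simulates_trans[OF test[unfolded if_not_P[OF False]] this] show ?thesis
      using False by (auto elim!: simulates_mono simp: r_def q_def add_ac)
  qed
qed

text \<open>\<open>m\<close> is a budget that every round lowers by at least one; the extra 1 in the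
  time bound pays for the last, failing test.\<close>

lemma simulates_loop:
  assumes code: "code_at P p (loop_code p e c)" and room: "roomy W B"
    and inv: "\<And>m \<sigma>. I m \<sigma> \<Longrightarrow> exp_safe W e \<sigma> \<and>
      (val e \<sigma> \<noteq> 0 \<longrightarrow> safe W c \<sigma> \<and> (\<exists>m'<m. I m' (sem c \<sigma>)))"
    and "I m \<sigma>"
  shows "\<exists>m' \<sigma>'. simulates P B ((m + 1) * loop_length e c) p \<sigma> (p + loop_length e c) \<sigma>' \<and>
    I m' \<sigma>' \<and> val e \<sigma>' = 0"
  using \<open>I m \<sigma>\<close>
proof (induction m arbitrary: \<sigma> rule: less_induct)
  case (less m)
  let ?q = "p + length (exp_code 0 e) + 1" and ?r = "p + loop_length e c"
  have code': "code_at P p (exp_code 0 e @ JumpZero (temp_addr 0) ?r # com_code ?q c @ [Jump p])"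
    using code by (simp add: loop_code_def)
  from code_at_Cons[OF code_at_append[OF code', THEN conjunct2]]
  have q: "code_at P ?q (com_code ?q c @ [Jump p])" by simp
  note cq = code_at_append[OF q]
  have test: "simulates P B (length (exp_code 0 e) + 1) p \<sigma> (if val e \<sigma> = 0 then ?r else ?q) \<sigma>"
    using simulates_test[OF code' _ room] inv[OF less.prems] by simp
  show ?case
  proof (cases "val e \<sigma> = 0")
    case True
    then show ?thesis
      using simulates_mono[OF test, of "(m + 1) * loop_length e c"] less.prems
      by (intro exI[of _ m] exI[of _ \<sigma>]) (simp add: loop_length_def)
  next
    case False
    then obtain m' where m': "m' < m" "I m' (sem c \<sigma>)" "safe W c \<sigma>"
      using inv[OF less.prems] by auto
    obtain m'' \<sigma>' where *: "simulates P B ((m' + 1) * loop_length e c) p (sem c \<sigma>) ?r \<sigma>'"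
      "I m'' \<sigma>'" "val e \<sigma>' = 0"
      using less.IH[OF m'(1,2)] by blast
    have body: "simulates P B (com_length c) ?q \<sigma> (?q + com_length c) (sem c \<sigma>)"
      using simulates_com[of P ?q c] cq m' room by auto
    have again: "simulates P B 1 (?q + com_length c) (sem c \<sigma>) p (sem c \<sigma>)"
      using simulates_Jump cq by auto
    have "simulates P B (loop_length e c + (m' + 1) * loop_length e c) p \<sigma> ?r \<sigma>'"
      using simulates_trans[OF simulates_trans[OF test[unfolded if_not_P[OF False]]
          simulates_trans[OF body again]] *(1)] by (simp add: loop_length_def)
    moreover have "(m' + 2) * loop_length e c \<le> (m + 1) * loop_length e c"
      using m'(1) by (intro mult_le_mono1) auto
    ultimately have "simulates P B ((m + 1) * loop_length e c) p \<sigma> ?r \<sigma>'"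
      by (auto elim!: simulates_mono)
    then show ?thesis using * by blast
  qed
qed

section \<open>The program\<close>

text \<open>A weakest precondition that includes the bound on values, so that the simplifier can
  execute commands symbolically and collect both kinds of obligations.\<close>

definition runs :: "nat \<Rightarrow> com \<Rightarrow> vstate \<Rightarrow> (vstate \<Rightarrow> bool) \<Rightarrow> bool" where
  "runs W c \<sigma> Q \<longleftrightarrow> safe W c \<sigma> \<and> Q (sem c \<sigma>)"

lemma runs_simps [simp]:
  "runs W Skip \<sigma> Q \<longleftrightarrow> Q \<sigma>"
  "runs W (Asg r e) \<sigma> Q \<longleftrightarrow> exp_safe W e \<sigma> \<and> Q (\<sigma>\<lparr>reg := (reg \<sigma>)(r := val e \<sigma>)\<rparr>)"
  "runs W (Upd a i j e) \<sigma> Q \<longleftrightarrow>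
     exp_safe W a \<sigma> \<and> exp_safe W i \<sigma> \<and> exp_safe W j \<sigma> \<and> exp_safe W e \<sigma> \<and>
     Q (\<sigma>\<lparr>arr := (arr \<sigma>)((val a \<sigma>, val i \<sigma>, val j \<sigma>) := val e \<sigma>)\<rparr>)"
  "runs W (Output e) \<sigma> Q \<longleftrightarrow> exp_safe W e \<sigma> \<and> Q (\<sigma>\<lparr>vout := vout \<sigma> @ [val e \<sigma>]\<rparr>)"
  "runs W (Seq c d) \<sigma> Q \<longleftrightarrow> runs W c \<sigma> (\<lambda>\<tau>. runs W d \<tau> Q)"
  "runs W (Cond e c d) \<sigma> Q \<longleftrightarrow>
     exp_safe W e \<sigma> \<and> (if val e \<sigma> \<noteq> 0 then runs W c \<sigma> Q else runs W d \<sigma> Q)"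
  by (auto simp: runs_def)

lemma runs_mono: "runs W c \<sigma> Q \<Longrightarrow> (\<And>\<tau>. Q \<tau> \<Longrightarrow> R \<tau>) \<Longrightarrow> runs W c \<sigma> R"
  by (simp add: runs_def)

text \<open>Under truncated subtraction the sum of the two differences is the distance of
  \<open>a\<close> and \<open>b\<close>; subtracting it from 1 tests it for 0.\<close>

definition same :: "exp \<Rightarrow> exp \<Rightarrow> exp" where
  "same a b = Minus (Lit 1) (Plus (Minus a b) (Minus b a))"

lemma val_same [simp]: "val (same a b) \<sigma> = (if val a \<sigma> = val b \<sigma> then 1 else 0)"
  by (auto simp: same_def)

text \<open>One of the two truncated differences is 0, so their sum is at most the larger
  operand.\<close>

lemma exp_safe_same:
  assumes "1 \<le> W" "exp_safe W a \<sigma>" "exp_safe W b \<sigma>"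
  shows "exp_safe W (same a b) \<sigma>"
  using assms exp_safe_val[of W a \<sigma>] exp_safe_val[of W b \<sigma>] by (simp add: same_def)

text \<open>Registers: 0 input symbol, 1 \<open>cur\<close>, 2 length of \<open>stk\<close>, 3 \<open>cnt\<close>, 4 \<open>phase\<close>, 5 length of \<open>wl\<close>,
  6 length of \<open>qs\<close>, 7 to 9 left child, connective and right child of the node under construction,
  10 and 11 position in the saturation, 12 position in \<open>qs\<close>. The layout of the arrays is given by
  \<open>stored\<close> below.\<close>

fun link_com :: "link \<Rightarrow> com" where
  "link_com (p, q, r) =
     Seq (Upd (Lit 25) (Reg p) (Cell (Lit 24) (Reg p) (Lit 0)) (Reg q))
    (Seq (Upd (Lit 26) (Reg p) (Cell (Lit 24) (Reg p) (Lit 0)) (Reg r))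
         (Upd (Lit 24) (Reg p) (Lit 0) (Plus (Cell (Lit 24) (Reg p) (Lit 0)) (Lit 1))))"

fun links_com :: "link list \<Rightarrow> com" where
  "links_com [] = Skip"
| "links_com (x # xs) = Seq (link_com x) (links_com xs)"

text \<open>Array 23 is the characteristic function of the worklist and makes the membership test of
  \<open>push\<close> a single access.\<close>

definition push_com :: "nat \<Rightarrow> com" where
  "push_com r =
     Cond (Cell (Lit 23) (Reg r) (Lit 0)) Skip
    (Seq (Upd (Lit 23) (Reg r) (Lit 0) (Lit 1))
    (Seq (Upd (Lit 22) (Reg 5) (Lit 0) (Reg r))
         (Asg 5 (Plus (Reg 5) (Lit 1)))))"

text \<open>Mirrors \<open>new_links\<close> with registers in place of nodes: 1 holds
  \<open>w\<close>, 7 and 9 hold \<open>l\<close> and \<open>r\<close>. The push under code 5 is the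
  axiom A \<rightarrow> A from \<open>mk\<close>.\<close>

definition new_com :: com where
  "new_com =
     Cond (same (Reg 8) (Lit 3)) (links_com [(1, 1, 7), (1, 1, 9), (7, 9, 1), (9, 7, 1)])
    (Cond (same (Reg 8) (Lit 4))
       (Seq (links_com [(7, 7, 1), (9, 9, 1)])
         (Cond (same (Reg 7) (Reg 9)) (links_com [(1, 1, 7)]) Skip))
    (Cond (same (Reg 8) (Lit 5))
       (Seq (links_com [(9, 9, 1), (7, 1, 9), (1, 7, 9)])
         (Cond (same (Reg 7) (Reg 9)) (push_com 1) Skip))
     Skip))"

definition mk_com :: com where
  "mk_com =
     Seq (Asg 1 (Cell (Reg 8) (Reg 7) (Reg 9)))
    (Cond (Reg 1) Skip
    (Seq (Asg 3 (Plus (Reg 3) (Lit 1)))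
    (Seq (Asg 1 (Reg 3))
    (Seq (Upd (Reg 8) (Reg 7) (Reg 9) (Reg 1))
         new_com))))"

definition rparen_com :: com where
  "rparen_com =
     Seq (Asg 2 (Minus (Reg 2) (Lit 1)))
    (Seq (Asg 7 (Cell (Lit 20) (Reg 2) (Lit 0)))
    (Seq (Asg 8 (Cell (Lit 21) (Reg 2) (Lit 0)))
    (Seq (Asg 9 (Reg 1))
         mk_com)))"

definition connective_com :: com where
  "connective_com =
     Seq (Upd (Lit 20) (Reg 2) (Lit 0) (Reg 1))
    (Seq (Upd (Lit 21) (Reg 2) (Lit 0) (Reg 0))
         (Asg 2 (Plus (Reg 2) (Lit 1))))"

definition digit_com :: com where
  "digit_com = Seq (Asg 7 (Reg 1)) (Seq (Asg 9 (Reg 1)) (Seq (Asg 8 (Reg 0)) mk_com))"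

definition comma_com :: com where
  "comma_com =
     Cond (Reg 4)
       (Seq (Upd (Lit 27) (Reg 6) (Lit 0) (Reg 1)) (Asg 6 (Plus (Reg 6) (Lit 1))))
       (push_com 1)"

fun switch :: "(nat \<times> com) list \<Rightarrow> com" where
  "switch [] = Skip"
| "switch ((n, c) # ncs) = Cond (same (Reg 0) (Lit n)) c (switch ncs)"

text \<open>Code 1, the opening parenthesis, falls through all tests. Connectives and digits share
  one command each because it takes the code from register 0.\<close>

definition scan_com :: com where
  "scan_com = switch
     [(2, rparen_com), (3, connective_com), (4, connective_com), (5, connective_com),
      (6, Asg 1 (Lit 1)), (7, Asg 1 (Lit 2)), (8, Asg 1 (Lit 3)),
      (9, digit_com), (10, digit_com), (11, comma_com), (12, Asg 4 (Lit 1))]"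

text \<open>The table is addressed by the symbol codes themselves; the other arrays are named 20 to
  27, which are no symbol codes. Lists are described only up to their length, so popped cells may
  keep old values, whereas arrays 23 and 24 are described everywhere and rely on memory being 0 at
  the start.\<close>

definition stored :: "pstate \<Rightarrow> (nat \<times> nat \<times> nat \<Rightarrow> nat) \<Rightarrow> bool" where
  "stored a M \<longleftrightarrow>
     (\<forall>c \<in> {3, 4, 5, 9, 10}. \<forall>l r. M (c, l, r) = tab a (c, l, r)) \<and>
     (\<forall>i < length (stk a). M (20, i, 0) = fst (stk a ! i) \<and> M (21, i, 0) = snd (stk a ! i)) \<and>
     (\<forall>i < length (wl a). M (22, i, 0) = wl a ! i) \<and>
     (\<forall>v. M (23, v, 0) = of_bool (v \<in> set (wl a))) \<and>
     (\<forall>v. M (24, v, 0) = length (adj a v)) \<and>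
     (\<forall>v. \<forall>i < length (adj a v). M (25, v, i) = fst (adj a v ! i) \<and> M (26, v, i) = snd (adj a v ! i)) \<and>
     (\<forall>i < length (qs a). M (27, i, 0) = qs a ! i)"

definition implements :: "pstate \<Rightarrow> vstate \<Rightarrow> bool" where
  "implements a \<sigma> \<longleftrightarrow> stored a (arr \<sigma>) \<and>
     reg \<sigma> 1 = cur a \<and> reg \<sigma> 2 = length (stk a) \<and> reg \<sigma> 3 = cnt a \<and> reg \<sigma> 4 = phase a \<and>
     reg \<sigma> 5 = length (wl a) \<and> reg \<sigma> 6 = length (qs a)"

section \<open>Correctness of the commands for reading\<close>

lemma stored_link:
  assumes "stored a M" "k = length (adj a v)"
  shows "stored (a\<lparr>adj := add_link (v, u, c) (adj a)\<rparr>)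
    (M((25, v, k) := u, (26, v, k) := c, (24, v, 0) := Suc k))"
  using assms by (auto simp: stored_def nth_append)

text \<open>The concrete updates are hidden behind an arbitrary \<open>M\<close> satisfying
  \<open>stored\<close>, which is all that the following commands rely on.\<close>

lemma runs_link_com:
  assumes "stored a (arr \<sigma>)" "reg \<sigma> p \<le> W" "reg \<sigma> q \<le> W" "reg \<sigma> r \<le> W" "26 \<le> W"
    "length (adj a (reg \<sigma> p)) < W"
    and Q: "\<And>M. stored (a\<lparr>adj := add_link (reg \<sigma> p, reg \<sigma> q, reg \<sigma> r) (adj a)\<rparr>) M \<Longrightarrow> Q (\<sigma>\<lparr>arr := M\<rparr>)"
  shows "runs W (link_com (p, q, r)) \<sigma> Q"
proof -
  have "arr \<sigma> (24, reg \<sigma> p, 0) = length (adj a (reg \<sigma> p))"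
    using assms(1) by (simp add: stored_def)
  then show ?thesis
    using assms(2-6) Q[OF stored_link[OF assms(1) refl]] by simp
qed

lemma runs_links_com:
  assumes "stored a (arr \<sigma>)" "\<forall>(p, q, r) \<in> set ls. reg \<sigma> p \<le> W \<and> reg \<sigma> q \<le> W \<and> reg \<sigma> r \<le> W"
    "26 \<le> W" "\<forall>v. length (adj a v) + length ls \<le> W"
    and Q: "\<And>M. stored (a\<lparr>adj := fold add_link (map (\<lambda>(p, q, r). (reg \<sigma> p, reg \<sigma> q, reg \<sigma> r)) ls) (adj a)\<rparr>) M
      \<Longrightarrow> Q (\<sigma>\<lparr>arr := M\<rparr>)"
  shows "runs W (links_com ls) \<sigma> Q"
  using assms
proof (induction ls arbitrary: a \<sigma>)
  case Nil
  then show ?case using Nil(5)[of "arr \<sigma>"] by simp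
next
  case (Cons x ls)
  obtain p q r where x: "x = (p, q, r)" by (cases x)
  let ?a = "a\<lparr>adj := add_link (reg \<sigma> p, reg \<sigma> q, reg \<sigma> r) (adj a)\<rparr>"
  have "runs W (link_com (p, q, r)) \<sigma> (\<lambda>\<tau>. runs W (links_com ls) \<tau> Q)"
  proof (rule runs_link_com[OF Cons.prems(1)])
    show "length (adj a (reg \<sigma> p)) < W"
      using Cons.prems(4)[rule_format, of "reg \<sigma> p"] by simp
    fix M assume M: "stored ?a M"
    show "runs W (links_com ls) (\<sigma>\<lparr>arr := M\<rparr>) Q"
    proof (rule Cons.IH[of ?a])
      show "\<forall>v. length (adj ?a v) + length ls \<le> W"
      proof
        fix v
        show "length (adj ?a v) + length ls \<le> W"
          using Cons.prems(4)[rule_format, of v] by auto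
      qed
      fix N assume "stored (?a\<lparr>adj := fold add_link (map (\<lambda>(p, q, r).
          (reg (\<sigma>\<lparr>arr := M\<rparr>) p, reg (\<sigma>\<lparr>arr := M\<rparr>) q, reg (\<sigma>\<lparr>arr := M\<rparr>) r)) ls) (adj ?a)\<rparr>) N"
      then show "Q (\<sigma>\<lparr>arr := M, arr := N\<rparr>)"
        using Cons.prems(5)[of N] x by (simp del: add_link.simps)
    qed (use M Cons.prems x in auto)
  qed (use Cons.prems x in auto)
  then show ?case by (simp add: x)
qed

declare link_com.simps [simp del] links_com.simps [simp del]

lemma stored_push:
  assumes "stored a M" "v \<notin> set (wl a)" "k = length (wl a)"
  shows "stored (a\<lparr>wl := push v (wl a)\<rparr>) (M((23, v, 0) := 1, (22, k, 0) := v))"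
  using assms by (auto simp: stored_def push_def nth_append)

lemma runs_push_com:
  assumes st: "stored a (arr \<sigma>)" and n: "reg \<sigma> 5 = length (wl a)" and r: "r \<noteq> 5"
    and W: "reg \<sigma> r \<le> W" "23 \<le> W" "length (wl a) < W"
    and Q: "\<And>M. stored (a\<lparr>wl := push (reg \<sigma> r) (wl a)\<rparr>) M \<Longrightarrow>
      Q (\<sigma>\<lparr>arr := M, reg := (reg \<sigma>)(5 := length (push (reg \<sigma> r) (wl a)))\<rparr>)"
  shows "runs W (push_com r) \<sigma> Q"
proof (cases "reg \<sigma> r \<in> set (wl a)")
  case True
  then have "arr \<sigma> (23, reg \<sigma> r, 0) = 1" using st by (simp add: stored_def)
  moreover have "\<sigma>\<lparr>arr := arr \<sigma>, reg := (reg \<sigma>)(5 := length (push (reg \<sigma> r) (wl a)))\<rparr> = \<sigma>"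
    using True n by (simp add: push_def flip: n)
  then have "Q \<sigma>" using Q[of "arr \<sigma>"] st True by (simp add: push_def)
  ultimately show ?thesis using W by (simp add: push_com_def)
next
  case False
  then have "arr \<sigma> (23, reg \<sigma> r, 0) = 0" using st by (simp add: stored_def)
  moreover have "length (push (reg \<sigma> r) (wl a)) = Suc (reg \<sigma> 5)" using False n by (simp add: push_def)
  ultimately show ?thesis
    using Q[OF stored_push[OF st False n]] W n r by (simp add: push_com_def)
qed

lemma length_adj_le:
  assumes "in_range a"
  shows "length (adj a v) \<le> 4 * cnt a"
proof (cases "v \<le> cnt a")
  case True
  then have "length (adj a v) \<le> (\<Sum>v\<le>cnt a. length (adj a v))"
    by (intro member_le_sum) auto
  then show ?thesis using assms by (simp add: in_range_def)
qed (use assms in \<open>simp add: in_range_def\<close>)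

lemma distinct_length_le:
  assumes "distinct ws" "set ws \<subseteq> {1..N}"
  shows "length ws \<le> N"
  using card_mono[OF _ assms(2)] distinct_card[OF assms(1)] by simp

lemma length_wl_le: "in_range a \<Longrightarrow> length (wl a) \<le> cnt a"
  by (simp add: in_range_def distinct_length_le)

lemma stored_tab:
  assumes "stored a M" "c \<in> {3, 4, 5, 9, 10}"
  shows "stored (a\<lparr>cur := x, cnt := y, tab := (tab a)((c, l, r) := w)\<rparr>) (M((c, l, r) := w))"
  using assms by (auto simp: stored_def)

lemma runs_new_com:
  assumes st: "stored a (arr \<sigma>)" and c: "reg \<sigma> 8 = c" "c \<in> {3, 4, 5, 9, 10}"
    and reg: "reg \<sigma> 1 = w" "reg \<sigma> 7 = l" "reg \<sigma> 9 = r" "reg \<sigma> 5 = length (wl a)"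
    and W: "w \<le> W" "l \<le> W" "r \<le> W" "26 \<le> W" "length (wl a) < W" "\<And>v. length (adj a v) + 4 \<le> W"
    and Q: "\<And>M n. stored (a\<lparr>adj := fold add_link (new_links c l r w) (adj a),
        wl := (if c = 5 \<and> l = r then push w (wl a) else wl a)\<rparr>) M \<Longrightarrow>
      n = length (if c = 5 \<and> l = r then push w (wl a) else wl a) \<Longrightarrow>
      Q (\<sigma>\<lparr>arr := M, reg := (reg \<sigma>)(5 := n)\<rparr>)"
  shows "runs W new_com \<sigma> Q"
proof -
  have safe: "exp_safe W (same (Reg 8) (Lit 3)) \<sigma>" "exp_safe W (same (Reg 8) (Lit 4)) \<sigma>"
    "exp_safe W (same (Reg 8) (Lit 5)) \<sigma>" and safe': "exp_safe W (same (Reg 7) (Reg 9)) (\<sigma>\<lparr>arr := M\<rparr>)" for M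
    using W c reg by (auto intro!: exp_safe_same)
  \<comment> \<open>Without a push, register 5 would be rewritten with its old value, so that update
    is the identity.\<close>
  have Q': "Q (\<sigma>\<lparr>arr := M\<rparr>)"
    if "stored (a\<lparr>adj := fold add_link (new_links c l r w) (adj a)\<rparr>) M" "\<not> (c = 5 \<and> l = r)" for M
  proof -
    have "\<sigma>\<lparr>arr := M, reg := (reg \<sigma>)(5 := length (wl a))\<rparr> = \<sigma>\<lparr>arr := M\<rparr>"
      by (simp flip: reg(4))
    then show ?thesis using Q[of M "length (wl a)"] that by simp
  qed
  have len: "\<forall>v. length (adj a v) + length ls \<le> W" if "length ls \<le> 4" for ls :: "link list"
  proof
    fix v
    show "length (adj a v) + length ls \<le> W" using W(6)[of v] that by linarith
  qed
  consider "c = 3" | "c = 4" | "c = 5" | "c \<notin> {3, 4, 5}" by blast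
  then show ?thesis
  proof cases
    case 1
    have "runs W (links_com [(1, 1, 7), (1, 1, 9), (7, 9, 1), (9, 7, 1)]) \<sigma> Q"
    proof (rule runs_links_com[OF st _ W(4) len])
      fix M assume "stored (a\<lparr>adj := fold add_link (map (\<lambda>(p, q, r). (reg \<sigma> p, reg \<sigma> q, reg \<sigma> r))
        [(1, 1, 7), (1, 1, 9), (7, 9, 1), (9, 7, 1)]) (adj a)\<rparr>) M"
      moreover have "map (\<lambda>(p, q, r). (reg \<sigma> p, reg \<sigma> q, reg \<sigma> r))
        [(1, 1, 7), (1, 1, 9), (7, 9, 1), (9, 7, 1)] = new_links c l r w"
        using reg 1 by (simp add: new_links_def)
      ultimately have "stored (a\<lparr>adj := fold add_link (new_links c l r w) (adj a)\<rparr>) M"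
        by (simp only:)
      then show "Q (\<sigma>\<lparr>arr := M\<rparr>)" using 1 by (intro Q') simp_all
    qed (use W(1-3) reg in auto)
    then show ?thesis using safe c 1 by (simp add: new_com_def)
  next
    case 2
    have "runs W (links_com [(7, 7, 1), (9, 9, 1)]) \<sigma>
        (\<lambda>\<tau>. runs W (Cond (same (Reg 7) (Reg 9)) (links_com [(1, 1, 7)]) Skip) \<tau> Q)"
    proof (rule runs_links_com[OF st _ W(4) len])
      fix M
      let ?a = "a\<lparr>adj := fold add_link [(l, l, w), (r, r, w)] (adj a)\<rparr>"
      assume "stored (a\<lparr>adj := fold add_link (map (\<lambda>(p, q, r). (reg \<sigma> p, reg \<sigma> q, reg \<sigma> r))
        [(7, 7, 1), (9, 9, 1)]) (adj a)\<rparr>) M"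
      then have M: "stored ?a M" using reg by (simp del: add_link.simps)
      show "runs W (Cond (same (Reg 7) (Reg 9)) (links_com [(1, 1, 7)]) Skip) (\<sigma>\<lparr>arr := M\<rparr>) Q"
      proof (cases "l = r")
        case True
        have len': "\<forall>v. length (adj ?a v) + length [(1, 1, 7) :: link] \<le> W"
        proof
          fix v
          show "length (adj ?a v) + length [(1, 1, 7) :: link] \<le> W" using W(6)[of v] by auto
        qed
        have "runs W (links_com [(1, 1, 7)]) (\<sigma>\<lparr>arr := M\<rparr>) Q"
        proof (rule runs_links_com[OF _ _ W(4) len'])
          fix N assume "stored (?a\<lparr>adj := fold add_link (map (\<lambda>(p, q, r).
            (reg (\<sigma>\<lparr>arr := M\<rparr>) p, reg (\<sigma>\<lparr>arr := M\<rparr>) q, reg (\<sigma>\<lparr>arr := M\<rparr>) r)) [(1, 1, 7)]) (adj ?a)\<rparr>) N"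
          moreover have "new_links c l r w = [(l, l, w), (r, r, w), (w, w, l)]"
            using 2 True by (simp add: new_links_def)
          ultimately show "Q (\<sigma>\<lparr>arr := M, arr := N\<rparr>)"
            using Q'[of N] 2 reg by (simp del: add_link.simps)
        qed (use M W(1-3) reg in auto)
        then show ?thesis using safe' reg True by simp
      next
        case False
        then show ?thesis using safe' reg Q'[of M] M 2 by (simp add: new_links_def del: add_link.simps)
      qed
    qed (use W(1-3) reg in auto)
    then show ?thesis using safe c 2 by (simp add: new_com_def)
  next
    case 3
    have "runs W (links_com [(9, 9, 1), (7, 1, 9), (1, 7, 9)]) \<sigma>
        (\<lambda>\<tau>. runs W (Cond (same (Reg 7) (Reg 9)) (push_com 1) Skip) \<tau> Q)"
    proof (rule runs_links_com[OF st _ W(4) len])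
      fix M
      let ?a = "a\<lparr>adj := fold add_link (new_links c l r w) (adj a)\<rparr>"
      assume "stored (a\<lparr>adj := fold add_link (map (\<lambda>(p, q, r). (reg \<sigma> p, reg \<sigma> q, reg \<sigma> r))
        [(9, 9, 1), (7, 1, 9), (1, 7, 9)]) (adj a)\<rparr>) M"
      then have M: "stored ?a M" using reg 3 by (simp add: new_links_def del: add_link.simps)
      show "runs W (Cond (same (Reg 7) (Reg 9)) (push_com 1) Skip) (\<sigma>\<lparr>arr := M\<rparr>) Q"
      proof (cases "l = r")
        case True
        have "runs W (push_com 1) (\<sigma>\<lparr>arr := M\<rparr>) Q"
          using M W reg Q 3 True by (intro runs_push_com[of ?a]) auto
        then show ?thesis using safe' reg True by simp
      next
        case False
        then show ?thesis using safe' reg Q'[of M] M 3 by (simp del: add_link.simps)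
      qed
    qed (use W(1-3) reg in auto)
    then show ?thesis using safe c 3 by (simp add: new_com_def)
  next
    case 4
    then have "Q \<sigma>" using Q'[of "arr \<sigma>"] st by (simp add: new_links_def)
    then show ?thesis using safe c 4 by (simp add: new_com_def)
  qed
qed

text \<open>An adjacency list has length at most \<open>4 * cnt a\<close>; 40 leaves room for four
  new entries and for the array names, which occur as constants.\<close>

lemma runs_mk_com:
  assumes imp: "implements a \<sigma>" and a: "in_range a"
    and reg: "reg \<sigma> 7 = l" "reg \<sigma> 8 = c" "reg \<sigma> 9 = r"
    and lr: "l \<in> {1..cnt a}" "r \<in> {1..cnt a}" and c: "c \<in> {3, 4, 5, 9, 10}" and W: "4 * cnt a + 40 \<le> W"
    and Q: "\<And>\<tau>. implements (mk c l r a) \<tau> \<Longrightarrow> vin \<tau> = vin \<sigma> \<Longrightarrow> vout \<tau> = vout \<sigma> \<Longrightarrow> Q \<tau>"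
  shows "runs W mk_com \<sigma> Q"
proof -
  have st: "stored a (arr \<sigma>)" and tab: "arr \<sigma> (c, l, r) = tab a (c, l, r)"
    using imp c by (auto simp: implements_def stored_def)
  have le: "l \<le> W" "r \<le> W" "c \<le> W" "cnt a \<le> W" "reg \<sigma> 3 = cnt a" using lr c W imp by (auto simp: implements_def)
  show ?thesis
  proof (cases "tab a (c, l, r) = 0")
    case False
    have "tab a (c, l, r) \<le> W" using table_okD(2)[OF in_range_ok[OF a] False] W by simp
    then show ?thesis
      using False imp reg tab le
      by (auto simp: mk_com_def mk_def implements_def stored_def intro!: Q)
  next
    case True
    let ?w = "Suc (cnt a)"
    let ?a = "a\<lparr>cur := ?w, cnt := ?w, tab := (tab a)((c, l, r) := ?w)\<rparr>"
    let ?\<sigma> = "\<sigma>\<lparr>reg := (reg \<sigma>)(1 := ?w, 3 := ?w), arr := (arr \<sigma>)((c, l, r) := ?w)\<rparr>"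
    have "runs W new_com ?\<sigma> Q"
    proof (rule runs_new_com[where a = ?a and \<sigma> = ?\<sigma> and c = c and w = ?w and l = l and r = r and Q = Q])
      show "stored ?a (arr ?\<sigma>)" using stored_tab[OF st c] by simp
      show "length (adj ?a v) + 4 \<le> W" for v using length_adj_le[OF a, of v] W by simp
      show "length (wl ?a) < W" using length_wl_le[OF a] W by simp
      fix M n
      assume *: "stored (?a\<lparr>adj := fold add_link (new_links c l r ?w) (adj ?a),
          wl := if c = 5 \<and> l = r then push ?w (wl ?a) else wl ?a\<rparr>) M"
        "n = length (if c = 5 \<and> l = r then push ?w (wl ?a) else wl ?a)"
      show "Q (?\<sigma>\<lparr>arr := M, reg := (reg ?\<sigma>)(5 := n)\<rparr>)"
        using * True imp by (intro Q) (auto simp: implements_def mk_def Let_def)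
    qed (use reg c imp le W in \<open>auto simp: implements_def\<close>)
    then show ?thesis
      using True reg tab le W by (simp add: mk_com_def fun_upd_twist)
  qed
qed

lemma stored_stk:
  assumes "stored a M" "k = length (stk a)"
  shows "stored (a\<lparr>stk := stk a @ [(x, c)]\<rparr>) (M((20, k, 0) := x, (21, k, 0) := c))"
  using assms by (auto simp: stored_def nth_append)

lemma stored_qs:
  assumes "stored a M" "k = length (qs a)"
  shows "stored (a\<lparr>qs := qs a @ [x]\<rparr>) (M((27, k, 0) := x))"
  using assms by (auto simp: stored_def nth_append)

lemma runs_switch:
  assumes "reg \<sigma> 0 \<le> W" "1 \<le> W" "\<forall>(n, c) \<in> set ncs. n \<le> W" "distinct (map fst ncs)"
    and "(reg \<sigma> 0, c) \<in> set ncs" "runs W c \<sigma> Q"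
  shows "runs W (switch ncs) \<sigma> Q"
  using assms(3-5)
proof (induction ncs)
  case (Cons nc ncs)
  obtain n d where nc: "nc = (n, d)" by (cases nc)
  have "exp_safe W (same (Reg 0) (Lit n)) \<sigma>"
    using assms(1,2) Cons.prems(1) nc by (intro exp_safe_same) auto
  moreover have "reg \<sigma> 0 = n \<Longrightarrow> d = c"
    using Cons.prems nc by force
  moreover have "reg \<sigma> 0 \<noteq> n \<Longrightarrow> runs W (switch ncs) \<sigma> Q"
    using Cons nc by auto
  ultimately show ?case using nc assms(6) by auto
qed simp

lemma runs_switch_none:
  assumes "reg \<sigma> 0 \<le> W" "1 \<le> W" "\<forall>(n, c) \<in> set ncs. n \<le> W" "reg \<sigma> 0 \<notin> fst ` set ncs" "Q \<sigma>"
  shows "runs W (switch ncs) \<sigma> Q"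
  using assms(3,4)
proof (induction ncs)
  case (Cons nc ncs)
  obtain n d where nc: "nc = (n, d)" by (cases nc)
  have "exp_safe W (same (Reg 0) (Lit n)) \<sigma>"
    using assms(1,2) Cons.prems(1) nc by (intro exp_safe_same) auto
  then show ?case using Cons nc by auto
qed (simp add: assms)

lemma runs_scan_com:
  assumes imp: "implements a \<sigma>" and a: "in_range a"
    and x: "reg \<sigma> 0 = sym_code x" "x = RParen \<longrightarrow> stk a \<noteq> []"
    and W: "4 * cnt a + 40 \<le> W" "length (stk a) < W" "length (qs a) < W"
    and Q: "\<And>\<tau>. implements (scan x a) \<tau> \<Longrightarrow> vin \<tau> = vin \<sigma> \<Longrightarrow> vout \<tau> = vout \<sigma> \<Longrightarrow> Q \<tau>"
  shows "runs W scan_com \<sigma> Q"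
proof -
  have st: "stored a (arr \<sigma>)"
    and reg: "reg \<sigma> (Suc 0) = cur a" "reg \<sigma> 2 = length (stk a)" "reg \<sigma> 3 = cnt a" "reg \<sigma> 4 = phase a"
      "reg \<sigma> 5 = length (wl a)" "reg \<sigma> 6 = length (qs a)"
    using imp by (auto simp: implements_def)
  have cur: "cur a \<in> {1..cnt a}" "cur a \<le> W" "phase a \<le> W" using a W by (auto simp: in_range_def)
  have digit: "runs W digit_com \<sigma> Q" if "scan x a = mk c (cur a) (cur a) a" "sym_code x = c" "c \<in> {9, 10}" for c
  proof -
    let ?\<sigma> = "\<sigma>\<lparr>reg := (reg \<sigma>)(7 := cur a, 9 := cur a, 8 := c)\<rparr>"
    have "runs W mk_com ?\<sigma> Q"
    proof (rule runs_mk_com[OF _ a])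
      show "implements a ?\<sigma>" using imp by (simp add: implements_def)
    qed (use that cur W Q in auto)
    then show ?thesis using reg cur W that x by (auto simp: digit_com_def)
  qed
  have connective: "runs W connective_com \<sigma> Q"
    if "scan x a = a\<lparr>stk := stk a @ [(cur a, c)]\<rparr>" "sym_code x = c" "c \<in> {3, 4, 5}" for c
  proof -
    have "implements (scan x a) (\<sigma>\<lparr>arr := (arr \<sigma>)((20, length (stk a), 0) := cur a, (21, length (stk a), 0) := c),
        reg := (reg \<sigma>)(2 := Suc (length (stk a)))\<rparr>)"
      using stored_stk[OF st refl, of "cur a" c] reg that(1) by (simp add: implements_def)
    from Q[OF this] show ?thesis using reg cur W that(2,3) x by (auto simp: connective_com_def)
  qed
  have const: "runs W (Asg 1 (Lit n)) \<sigma> Q" if "scan x a = a\<lparr>cur := n\<rparr>" "n \<le> 3" for n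
  proof -
    have "implements (scan x a) (\<sigma>\<lparr>reg := (reg \<sigma>)(1 := n)\<rparr>)"
      using imp that(1) by (simp add: implements_def stored_def)
    from Q[OF this] show ?thesis using that(2) W by simp
  qed
  let ?ncs = "[(2, rparen_com), (3, connective_com), (4, connective_com), (5, connective_com),
      (6, Asg 1 (Lit 1)), (7, Asg 1 (Lit 2)), (8, Asg 1 (Lit 3)),
      (9, digit_com), (10, digit_com), (11, comma_com), (12, Asg 4 (Lit 1))] :: (nat \<times> com) list"
  have le: "reg \<sigma> 0 \<le> W" "1 \<le> W" "\<forall>(n, c) \<in> set ?ncs. n \<le> W"
    using W x by (cases x; simp)+
  have choose: "runs W scan_com \<sigma> Q" if "(sym_code x, c) \<in> set ?ncs" "runs W c \<sigma> Q" for c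
    unfolding scan_com_def using that x(1) by (intro runs_switch[OF le]) auto
  show ?thesis
  proof (cases x)
    case LParen
    then have "implements (scan x a) \<sigma>" using imp by simp
    from Q[OF this] show ?thesis
      unfolding scan_com_def using x LParen by (intro runs_switch_none[OF le]) auto
  next
    case RParen
    let ?b = "a\<lparr>stk := butlast (stk a)\<rparr>"
    obtain ss l c where ss: "stk a = ss @ [(l, c)]"
      using x RParen by (cases "stk a" rule: rev_cases) auto
    have lc: "l \<in> {1..cnt a}" "c \<in> {3, 4, 5}" using a ss by (auto simp: in_range_def)
    have arr: "arr \<sigma> (20, length ss, 0) = l" "arr \<sigma> (21, length ss, 0) = c"
      using st ss by (auto simp: stored_def)
    let ?\<sigma> = "\<sigma>\<lparr>reg := (reg \<sigma>)(2 := length ss, 7 := l, 8 := c, 9 := cur a)\<rparr>"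
    \<comment> \<open>Popping does not clear the cells: \<open>stored\<close> only speaks of indices
      below the new length.\<close>
    have "stored ?b (arr \<sigma>)" using st ss by (auto simp: stored_def nth_append)
    then have imp': "implements ?b ?\<sigma>" using imp ss by (simp add: implements_def)
    have range': "in_range ?b" using a ss by (simp add: in_range_def)
    have "runs W mk_com ?\<sigma> Q"
      using lc cur W Q RParen ss by (intro runs_mk_com[OF imp' range', of l c "cur a"]) auto
    then have "runs W rparen_com \<sigma> Q"
      using reg ss arr lc cur W by (auto simp: rparen_com_def)
    then show ?thesis using RParen by (intro choose[of rparen_com]) simp
  next
    case Comma
    have "runs W comma_com \<sigma> Q"
    proof (cases "phase a = 0")
      case True
      have "runs W (push_com 1) \<sigma> Q"
      proof (rule runs_push_com[OF st])
        show "length (wl a) < W" using length_wl_le[OF a] W by simp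
        fix M assume M: "stored (a\<lparr>wl := push (reg \<sigma> 1) (wl a)\<rparr>) M"
        show "Q (\<sigma>\<lparr>arr := M, reg := (reg \<sigma>)(5 := length (push (reg \<sigma> 1) (wl a)))\<rparr>)"
          using M True Comma reg by (intro Q) (auto simp: implements_def)
      qed (use reg cur W in auto)
      then show ?thesis using True reg by (simp add: comma_com_def)
    next
      case False
      have "implements (scan x a) (\<sigma>\<lparr>arr := (arr \<sigma>)((27, length (qs a), 0) := cur a),
          reg := (reg \<sigma>)(6 := Suc (length (qs a)))\<rparr>)"
        using stored_qs[OF st refl, of "cur a"] reg False Comma by (simp add: implements_def)
      from Q[OF this] show ?thesis using False reg cur W by (simp add: comma_com_def)
    qed
    then show ?thesis using Comma by (intro choose[of comma_com]) simp
  next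
    case Turnstile
    have "implements (scan x a) (\<sigma>\<lparr>reg := (reg \<sigma>)(4 := 1)\<rparr>)"
      using imp Turnstile by (simp add: implements_def stored_def)
    from Q[OF this] have "runs W (Asg 4 (Lit 1)) \<sigma> Q" using W by simp
    then show ?thesis using Turnstile by (intro choose[of "Asg 4 (Lit 1)"]) simp
  next
    case SAnd
    then show ?thesis by (intro choose[of connective_com] connective[of 3]) simp_all
  next
    case SOr
    then show ?thesis by (intro choose[of connective_com] connective[of 4]) simp_all
  next
    case SImp
    then show ?thesis by (intro choose[of connective_com] connective[of 5]) simp_all
  next
    case STop
    then show ?thesis by (intro choose[of "Asg 1 (Lit 1)"] const[of 1]) simp_all
  next
    case SBot
    then show ?thesis by (intro choose[of "Asg 1 (Lit 2)"] const[of 2]) simp_all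
  next
    case SVar
    then show ?thesis by (intro choose[of "Asg 1 (Lit 3)"] const[of 3]) simp_all
  next
    case Zero
    then show ?thesis by (intro choose[of digit_com] digit[of 9]) simp_all
  next
    case One
    then show ?thesis by (intro choose[of digit_com] digit[of 10]) simp_all
  qed
qed

section \<open>The reading loop and its potential\<close>

definition psize :: "pstate \<Rightarrow> nat" where
  "psize a = cnt a + length (stk a) + length (qs a)"

text \<open>A symbol creates at most one node, stack entry or query. Hence \<open>psize\<close> plus
  the number of unread symbols never increases, and its initial value n + 3 bounds all three
  quantities.\<close>

lemma psize_scan: "psize (scan x a) \<le> Suc (psize a)"
  by (cases x) (auto simp: psize_def mk_def Let_def)

text \<open>Register 0 is one symbol of lookahead, so \<open>vin\<close> lacks the first element of
  \<open>xs\<close>. At the end of the input the register is 0, which is no symbol code and stops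
  the loop.\<close>

definition reads :: "sym list \<Rightarrow> vstate \<Rightarrow> bool" where
  "reads xs \<sigma> \<longleftrightarrow> reg \<sigma> 0 = (case xs of [] \<Rightarrow> 0 | x # _ \<Rightarrow> sym_code x) \<and> vin \<sigma> = map sym_code (tl xs)"

definition parsing :: "nat \<Rightarrow> pstate \<Rightarrow> nat \<Rightarrow> vstate \<Rightarrow> bool" where
  "parsing n b m \<sigma> \<longleftrightarrow> (\<exists>a xs. m = length xs \<and> path a xs b \<and> psize a + length xs \<le> n + 3 \<and>
     implements a \<sigma> \<and> reads xs \<sigma> \<and> vout \<sigma> = [])"

lemma sym_code_le: "sym_code x \<le> 12"
  by (cases x) auto

lemma runs_Input:
  assumes "vin \<sigma> = map sym_code xs" "12 \<le> W"
    and "\<And>\<tau>. reads xs \<tau> \<Longrightarrow> arr \<tau> = arr \<sigma> \<Longrightarrow> vout \<tau> = vout \<sigma> \<Longrightarrow>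
      (\<forall>r. r \<noteq> 0 \<longrightarrow> reg \<tau> r = reg \<sigma> r) \<Longrightarrow> Q \<tau>"
  shows "runs W (Input 0) \<sigma> Q"
proof -
  have "sym_code x \<le> W" for x using sym_code_le[of x] assms(2) by simp
  then have "\<forall>x \<in> set (vin \<sigma>). x \<le> W" using assms(1) by auto
  then show ?thesis
    using assms(1,3) by (auto simp: runs_def reads_def split: list.splits)
qed

lemma parsing_step:
  assumes inv: "parsing n b m \<sigma>" and W: "4 * n + 60 \<le> W" and nz: "reg \<sigma> 0 \<noteq> 0"
  shows "runs W (Seq scan_com (Input 0)) \<sigma> (\<lambda>\<tau>. \<exists>m' < m. parsing n b m' \<tau>)"
proof -
  obtain a xs where m: "m = length xs" and path: "path a xs b" and size: "psize a + length xs \<le> n + 3"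
    and imp: "implements a \<sigma>" and reads: "reads xs \<sigma>" and out: "vout \<sigma> = []"
    using inv by (auto simp: parsing_def)
  obtain x ys where xs: "xs = x # ys" using reads nz by (cases xs) (auto simp: reads_def)
  have "runs W scan_com \<sigma> (\<lambda>\<tau>. runs W (Input 0) \<tau> (\<lambda>\<tau>. \<exists>m' < m. parsing n b m' \<tau>))"
  proof (rule runs_scan_com[OF imp])
    show "in_range a" "x = RParen \<longrightarrow> stk a \<noteq> []" using path xs by auto
    show "reg \<sigma> 0 = sym_code x" using reads xs by (simp add: reads_def)
    \<comment> \<open>\<open>cnt a\<close> is at most \<open>n + 3\<close>, and
      \<open>4 * (n + 3) + 40\<close> is \<open>4 * n + 52\<close>.\<close>
    show "4 * cnt a + 40 \<le> W" "length (stk a) < W" "length (qs a) < W"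
      using size xs W by (auto simp: psize_def)
    fix \<tau> assume \<tau>: "implements (scan x a) \<tau>" "vin \<tau> = vin \<sigma>" "vout \<tau> = vout \<sigma>"
    have vin: "vin \<tau> = map sym_code ys" using \<tau>(2) reads xs by (simp add: reads_def)
    show "runs W (Input 0) \<tau> (\<lambda>\<tau>. \<exists>m' < m. parsing n b m' \<tau>)"
    proof (rule runs_Input[OF vin])
      fix \<tau>' assume \<tau>': "reads ys \<tau>'" "arr \<tau>' = arr \<tau>" "vout \<tau>' = vout \<tau>"
        "\<forall>r. r \<noteq> 0 \<longrightarrow> reg \<tau>' r = reg \<tau> r"
      have "parsing n b (length ys) \<tau>'"
        unfolding parsing_def
      proof (intro exI conjI)
        show "path (scan x a) ys b" using path xs by simp
        show "psize (scan x a) + length ys \<le> n + 3" using psize_scan[of x a] size xs by simp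
        show "implements (scan x a) \<tau>'" using \<tau>(1) \<tau>' by (simp add: implements_def)
        show "vout \<tau>' = []" using \<tau>(3) \<tau>'(3) out by simp
      qed (use \<tau>' in auto)
      then show "\<exists>m' < m. parsing n b m' \<tau>'" using m xs by auto
    qed (use W in simp)
  qed
  then show ?thesis by simp
qed

lemma parsing_done:
  assumes "parsing n b m \<sigma>" "reg \<sigma> 0 = 0"
  shows "implements b \<sigma> \<and> vout \<sigma> = [] \<and> psize b \<le> n + 3"
proof -
  obtain a xs where *: "path a xs b" "psize a + length xs \<le> n + 3" "implements a \<sigma>" "reads xs \<sigma>"
    "vout \<sigma> = []"
    using assms(1) by (auto simp: parsing_def)
  have "xs = []"
  proof (cases xs)
    case (Cons x ys)
    then show ?thesis using *(4) assms(2) by (cases x) (auto simp: reads_def)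
  qed
  then show ?thesis using * by simp
qed

definition init_com :: com where
  "init_com = Seq (Asg 3 (Lit 3)) (Seq (Asg 1 (Lit 1)) (Seq (push_com 1) (Input 0)))"

lemma runs_init_com:
  assumes "\<sigma> = \<lparr>reg = \<lambda>_. 0, arr = \<lambda>_. 0, vin = map sym_code xs, vout = []\<rparr>"
    and "path start xs b" "60 \<le> W"
  shows "runs W init_com \<sigma> (parsing (length xs) b (length xs))"
proof -
  \<comment> \<open>With registers 1 and 3 set, zeroed memory represents \<open>start\<close> with
    an empty worklist; the first push adds the node of \<top>.\<close>
  let ?a = "start\<lparr>wl := []\<rparr>" and ?\<sigma> = "\<sigma>\<lparr>reg := (reg \<sigma>)(3 := 3, 1 := 1)\<rparr>"
  have "runs W (push_com 1) ?\<sigma> (\<lambda>\<tau>. runs W (Input 0) \<tau> (parsing (length xs) b (length xs)))"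
  proof (rule runs_push_com[of ?a])
    show "stored ?a (arr ?\<sigma>)" using assms(1) by (simp add: stored_def start_def)
    fix M assume M: "stored (?a\<lparr>wl := push (reg ?\<sigma> 1) (wl ?a)\<rparr>) M"
    let ?\<tau> = "?\<sigma>\<lparr>arr := M, reg := (reg ?\<sigma>)(5 := length (push (reg ?\<sigma> 1) (wl ?a)))\<rparr>"
    show "runs W (Input 0) ?\<tau> (parsing (length xs) b (length xs))"
    proof (rule runs_Input[of _ xs])
      fix \<tau>' assume \<tau>': "reads xs \<tau>'" "arr \<tau>' = arr ?\<tau>" "vout \<tau>' = vout ?\<tau>"
        "\<forall>r. r \<noteq> 0 \<longrightarrow> reg \<tau>' r = reg ?\<tau> r"
      have "implements start \<tau>'"
        using M \<tau>' assms(1) by (simp add: implements_def start_def push_def)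
      moreover have "psize start = 3" by (simp add: psize_def start_def)
      moreover have "vout \<tau>' = []" using \<tau>'(3) assms(1) by simp
      ultimately show "parsing (length xs) b (length xs) \<tau>'"
        unfolding parsing_def using assms(2) \<tau>'(1) by (intro exI[of _ start] exI[of _ xs]) simp
    qed (use assms in auto)
  qed (use assms in \<open>auto simp: start_def\<close>)
  then show ?thesis using assms(3) by (simp add: init_com_def)
qed

section \<open>The saturation loop\<close>

lemma table_links_range:
  assumes "table_ok T N" "(v, u, x) \<in> table_links T"
  shows "{v, u, x} \<subseteq> {1..N}"
proof -
  obtain c l r where nz: "T (c, l, r) \<noteq> 0" and mem: "(v, u, x) \<in> set (new_links c l r (T (c, l, r)))"
    using assms(2) by (auto simp: table_links_def)
  have "{l, r, T (c, l, r)} \<subseteq> {1..N}" using table_okD[OF assms(1) nz] by auto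
  then show ?thesis using new_links_members[OF mem] by blast
qed

lemma in_range_link:
  assumes "in_range a" "k < length (adj a v)"
  shows "(v, adj a v ! k) \<in> link_set (adj a)" "fst (adj a v ! k) \<le> cnt a" "snd (adj a v ! k) \<le> cnt a"
proof -
  show link: "(v, adj a v ! k) \<in> link_set (adj a)"
  proof -
    obtain u c where uc: "adj a v ! k = (u, c)" by (cases "adj a v ! k")
    then have "(u, c) \<in> set (adj a v)" using nth_mem[OF assms(2)] by simp
    then show ?thesis by (simp add: uc link_set_def)
  qed
  then have "(v, fst (adj a v ! k), snd (adj a v ! k)) \<in> table_links (tab a)"
    using assms(1) by (simp add: in_range_def)
  from table_links_range[OF in_range_ok[OF assms(1)] this]
  show "fst (adj a v ! k) \<le> cnt a" "snd (adj a v ! k) \<le> cnt a" by auto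
qed

definition fire_com :: com where
  "fire_com =
     Cond (Cell (Lit 23) (Cell (Lit 25) (Reg 7) (Reg 11)) (Lit 0))
       (Seq (Asg 8 (Cell (Lit 26) (Reg 7) (Reg 11))) (push_com 8))
       Skip"

definition saturate_com :: com where
  "saturate_com =
     Seq (Asg 7 (Cell (Lit 22) (Reg 10) (Lit 0)))
    (Cond (Minus (Cell (Lit 24) (Reg 7) (Lit 0)) (Reg 11))
       (Seq fire_com
            (Asg 11 (Plus (Reg 11) (Lit 1))))
       (Seq (Asg 10 (Plus (Reg 10) (Lit 1))) (Asg 11 (Lit 0))))"

text \<open>Registers 1 to 4 belong to the reading phase and are dropped; register 6 is carried
  along for the loop over the queries.\<close>

fun queue_state :: "pstate \<Rightarrow> nat list \<times> nat \<times> nat \<Rightarrow> vstate \<Rightarrow> bool" where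
  "queue_state a (ws, h, k) \<sigma> \<longleftrightarrow> stored (a\<lparr>wl := ws\<rparr>) (arr \<sigma>) \<and> reg \<sigma> 5 = length ws \<and>
     reg \<sigma> 6 = length (qs a) \<and> reg \<sigma> 10 = h \<and> reg \<sigma> 11 = k \<and> vout \<sigma> = []"

lemma runs_saturate_com:
  assumes a: "in_range a" and q: "queue_state a (ws, h, k) \<sigma>" and h: "h < length ws"
    and ws: "set ws \<subseteq> {1..cnt a}" "distinct ws" and k: "k \<le> length (adj a (ws ! h))"
    and W: "4 * cnt a + 40 \<le> W"
  shows "runs W saturate_com \<sigma> (queue_state a (saturate_step (adj a) (ws, h, k)))"
proof -
  let ?v = "ws ! h" and ?Q = "queue_state a (saturate_step (adj a) (ws, h, k))"
  have st: "stored (a\<lparr>wl := ws\<rparr>) (arr \<sigma>)" and reg: "reg \<sigma> 5 = length ws" "reg \<sigma> 6 = length (qs a)"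
    "reg \<sigma> 10 = h" "reg \<sigma> 11 = k" and out: "vout \<sigma> = []"
    using q by auto
  have v: "?v \<le> cnt a" using ws h nth_mem by fastforce
  have len: "length ws \<le> cnt a" using ws by (intro distinct_length_le)
  have deg: "length (adj a ?v) \<le> 4 * cnt a" by (rule length_adj_le[OF a])
  have arr: "arr \<sigma> (22, h, 0) = ?v" "\<And>v. arr \<sigma> (24, v, 0) = length (adj a v)"
    "\<And>v. arr \<sigma> (23, v, 0) = of_bool (v \<in> set ws)"
    using st h by (auto simp: stored_def)
  have le: "?v \<le> W" "h \<le> W" "k \<le> W" "Suc h \<le> W" "length (adj a ?v) \<le> W" "27 \<le> W" "length ws < W"
    using v W h len deg k by auto
  show ?thesis
  proof (cases "k < length (adj a ?v)")
    case False
    then show ?thesis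
      using st reg out arr le by (simp add: saturate_com_def)
  next
    case True
    define u c where "u = fst (adj a ?v ! k)" and "c = snd (adj a ?v ! k)"
    have uc: "arr \<sigma> (25, ?v, k) = u" "arr \<sigma> (26, ?v, k) = c" "u \<le> W" "c \<le> W"
      using st True in_range_link[OF a True] W by (auto simp: stored_def u_def c_def)
    let ?\<sigma> = "\<sigma>\<lparr>reg := (reg \<sigma>)(7 := ?v)\<rparr>"
    have fire: "runs W fire_com ?\<sigma> (\<lambda>\<tau>. runs W (Asg 11 (Plus (Reg 11) (Lit 1))) \<tau> ?Q)"
    proof (cases "u \<in> set ws")
      case u: True
      let ?\<rho> = "\<sigma>\<lparr>reg := (reg \<sigma>)(7 := ?v, 8 := c)\<rparr>"
      have "runs W (push_com 8) ?\<rho> (\<lambda>\<tau>. runs W (Asg 11 (Plus (Reg 11) (Lit 1))) \<tau> ?Q)"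
        using st reg le uc u True out by (intro runs_push_com[of "a\<lparr>wl := ws\<rparr>"]) (auto simp flip: u_def c_def)
      then show ?thesis using reg arr uc le u by (simp add: fire_com_def)
    next
      case u: False
      then show ?thesis
        using reg arr uc le st out True by (simp add: fire_com_def flip: u_def c_def)
    qed
    moreover have "runs W saturate_com \<sigma> Q"
      if "runs W fire_com ?\<sigma> (\<lambda>\<tau>. runs W (Asg 11 (Plus (Reg 11) (Lit 1))) \<tau> Q)" for Q
      using that reg arr le True by (simp add: saturate_com_def)
    ultimately show ?thesis by blast
  qed
qed

text \<open>\<open>m\<close> is what remains of the total budget, one step per link and one per
  node, after the work already done.\<close>

definition saturation :: "pstate \<Rightarrow> (nat \<Rightarrow> bool) \<Rightarrow> nat \<Rightarrow> vstate \<Rightarrow> bool" where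
  "saturation a G m \<sigma> \<longleftrightarrow> (\<exists>x. queue_state a x \<sigma> \<and> saturating (adj a) (cnt a) (wl a) G x \<and>
     m + progress (adj a) x = (\<Sum>v\<le>cnt a. length (adj a v)) + cnt a)"

lemma saturation_step:
  assumes a: "in_range a" and inv: "saturation a G m \<sigma>" and W: "4 * cnt a + 40 \<le> W"
    and sound: "\<And>v u c. (v, u, c) \<in> link_set (adj a) \<Longrightarrow> G v \<Longrightarrow> G u \<Longrightarrow> G c"
  shows "exp_safe W (Minus (Reg 5) (Reg 10)) \<sigma> \<and> (val (Minus (Reg 5) (Reg 10)) \<sigma> \<noteq> 0 \<longrightarrow>
    runs W saturate_com \<sigma> (\<lambda>\<tau>. \<exists>m' < m. saturation a G m' \<tau>))"
proof -
  obtain ws h k where q: "queue_state a (ws, h, k) \<sigma>"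
    and sat: "saturating (adj a) (cnt a) (wl a) G (ws, h, k)"
    and m: "m + progress (adj a) (ws, h, k) = (\<Sum>v\<le>cnt a. length (adj a v)) + cnt a"
    using inv by (auto simp: saturation_def)
  have ws: "set ws \<subseteq> {1..cnt a}" "distinct ws" "h \<le> length ws"
    using sat by (auto simp: saturating_def)
  have "length ws \<le> W" using distinct_length_le[OF ws(2,1)] W by simp
  then have safe: "exp_safe W (Minus (Reg 5) (Reg 10)) \<sigma>" using q ws by simp
  have "runs W saturate_com \<sigma> (\<lambda>\<tau>. \<exists>m' < m. saturation a G m' \<tau>)" if h: "h < length ws"
  proof -
    have range: "c \<in> {1..cnt a}" if "(v, u, c) \<in> link_set (adj a)" for v u c
      using table_links_range[OF in_range_ok[OF a]] that a by (auto simp: in_range_def)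
    let ?x = "saturate_step (adj a) (ws, h, k)"
    have step: "saturating (adj a) (cnt a) (wl a) G ?x"
      "progress (adj a) ?x = Suc (progress (adj a) (ws, h, k))"
      by (rule saturating_step[OF sat h]; blast intro: sound range)+
    have k: "k \<le> length (adj a (ws ! h))" using sat h by (simp add: saturating_def)
    show ?thesis
    proof (rule runs_mono[OF runs_saturate_com[OF a q h ws(1,2) k W]])
      fix \<tau> assume \<tau>: "queue_state a (saturate_step (adj a) (ws, h, k)) \<tau>"
      \<comment> \<open>\<open>progress_bound\<close> makes \<open>m\<close> positive, so the
        truncated difference is a true decrease.\<close>
      have "m - 1 < m" "m - 1 + progress (adj a) ?x = (\<Sum>v\<le>cnt a. length (adj a v)) + cnt a"
        using step(2) m progress_bound[OF sat h] by simp_all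
      then have "saturation a G (m - 1) \<tau>" "m - 1 < m"
        unfolding saturation_def using \<tau> step(1) by blast+
      then show "\<exists>m' < m. saturation a G m' \<tau>" by blast
    qed
  qed
  then show ?thesis using safe q by simp
qed

text \<open>\<open>1 - (1 - x)\<close> is the sign of \<open>x\<close>; applied to the sum of two
  bits it is their disjunction. Cell \<open>(23, 2, 0)\<close> tells whether \<bottom> was derived,
  in which case every query holds.\<close>

definition answer_com :: com where
  "answer_com =
     Seq (Output (Minus (Lit 1) (Minus (Lit 1)
            (Plus (Cell (Lit 23) (Cell (Lit 27) (Reg 12) (Lit 0)) (Lit 0)) (Cell (Lit 23) (Lit 2) (Lit 0))))))
         (Asg 12 (Plus (Reg 12) (Lit 1)))"

definition answering :: "pstate \<Rightarrow> nat \<Rightarrow> vstate \<Rightarrow> bool" where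
  "answering a m \<sigma> \<longleftrightarrow> (\<exists>i \<le> length (qs a). m = length (qs a) - i \<and> stored a (arr \<sigma>) \<and>
     reg \<sigma> 6 = length (qs a) \<and> reg \<sigma> 12 = i \<and>
     vout \<sigma> = map (\<lambda>x. of_bool (x \<in> set (wl a) \<or> 2 \<in> set (wl a))) (take i (qs a)))"

lemma answering_step:
  assumes inv: "answering a m \<sigma>" and W: "length (qs a) < W" "40 \<le> W" "\<forall>x \<in> set (qs a). x \<le> W"
  shows "exp_safe W (Minus (Reg 6) (Reg 12)) \<sigma> \<and> (val (Minus (Reg 6) (Reg 12)) \<sigma> \<noteq> 0 \<longrightarrow>
    runs W answer_com \<sigma> (\<lambda>\<tau>. \<exists>m' < m. answering a m' \<tau>))"
proof -
  obtain i where i: "i \<le> length (qs a)" and m: "m = length (qs a) - i" and st: "stored a (arr \<sigma>)"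
    and reg: "reg \<sigma> 6 = length (qs a)" "reg \<sigma> 12 = i"
    and out: "vout \<sigma> = map (\<lambda>x. of_bool (x \<in> set (wl a) \<or> 2 \<in> set (wl a))) (take i (qs a))"
    using inv by (auto simp: answering_def)
  have "runs W answer_com \<sigma> (\<lambda>\<tau>. \<exists>m' < m. answering a m' \<tau>)" if less: "i < length (qs a)"
  proof -
    have arr: "arr \<sigma> (27, i, 0) = qs a ! i" "\<And>v. arr \<sigma> (23, v, 0) = of_bool (v \<in> set (wl a))"
      using st less by (auto simp: stored_def)
    have q: "qs a ! i \<le> W" using W(3) less by simp
    let ?\<tau> = "\<sigma>\<lparr>vout := vout \<sigma> @ [of_bool (qs a ! i \<in> set (wl a) \<or> 2 \<in> set (wl a))],
      reg := (reg \<sigma>)(12 := Suc i)\<rparr>"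
    have "answering a (m - 1) ?\<tau>" "m - 1 < m"
      unfolding answering_def using less m st reg out
      by (auto intro!: exI[of _ "Suc i"] simp: take_Suc_conv_app_nth)
    then have "\<exists>m' < m. answering a m' ?\<tau>" by blast
    then show ?thesis
      using reg arr q W less by (auto simp: answer_com_def split: if_splits)
  qed
  then show ?thesis using reg i W by simp
qed

text \<open>With indices up to \<open>W\<close>, the inner pairing is at most
  \<open>5 * (W * W)\<close> and the outer one at most 41 times the fourth power of
  \<open>W\<close>; four times that, plus 2, is less than 256 times the fourth power.\<close>

lemma roomy_bound:
  assumes "4 \<le> W" "(4 * W) ^ 4 \<le> B"
  shows "roomy W B"
  unfolding roomy_def
proof (intro conjI allI HOL.impI)
  fix a i j assume le: "a \<le> W" "i \<le> W" "j \<le> W"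
  have W: "1 \<le> W * W" "W \<le> W * W" using assms(1) by (simp_all add: square_ge)
  have "pairing i j \<le> pairing W W" using le by (intro pairing_mono)
  also have "\<dots> \<le> 5 * (W * W)" using W by (simp add: pairing_def algebra_simps)
  finally have "pairing (pairing i j) a \<le> pairing (5 * (W * W)) (W * W)"
    using le_trans[OF le(1) W(2)] by (intro pairing_mono)
  also have "\<dots> = 36 * ((W * W) * (W * W)) + 5 * (W * W)"
    by (simp add: pairing_def algebra_simps)
  also have "\<dots> \<le> 41 * ((W * W) * (W * W))"
    using square_ge[of "W * W"] by linarith
  finally have "cell_addr (a, i, j) \<le> 164 * ((W * W) * (W * W)) + 2"
    by (simp add: cell_addr.simps)
  also have "\<dots> < 256 * ((W * W) * (W * W))"
    using W square_ge[of "W * W"] by linarith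
  also have "\<dots> = (4 * W) ^ 4" by (simp add: power4_eq_xxxx)
  finally show "cell_addr (a, i, j) < B" using assms(2) by simp
qed (rule assms)

text \<open>\<open>implements\<close> says nothing about registers 10 and 11, so they are set before
  the saturation.\<close>

definition reset_com :: com where
  "reset_com = Seq (Asg 10 (Lit 0)) (Asg 11 (Lit 0))"

section \<open>Assembly of the program and its running time\<close>

abbreviation parse_length :: nat where
  "parse_length \<equiv> loop_length (Reg 0) (Seq scan_com (Input 0))"

abbreviation saturate_length :: nat where
  "saturate_length \<equiv> loop_length (Minus (Reg 5) (Reg 10)) saturate_com"

abbreviation answer_length :: nat where
  "answer_length \<equiv> loop_length (Minus (Reg 6) (Reg 12)) answer_com"

definition program :: "instr list" where
  "program =
     (let p1 = com_length init_com; p2 = p1 + parse_length;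
          p3 = p2 + com_length reset_com; p4 = p3 + saturate_length;
          p5 = p4 + com_length (Asg 12 (Lit 0)) in
      com_code 0 init_com @
      loop_code p1 (Reg 0) (Seq scan_com (Input 0)) @
      com_code p2 reset_com @
      loop_code p3 (Minus (Reg 5) (Reg 10)) saturate_com @
      com_code p4 (Asg 12 (Lit 0)) @
      loop_code p5 (Minus (Reg 6) (Reg 12)) answer_com)"

lemma simulates_runs:
  assumes "code_at P p (com_code p c)" "roomy W B" "runs W c \<sigma> Q"
  shows "\<exists>\<tau>. simulates P B (com_length c) p \<sigma> (p + com_length c) \<tau> \<and> Q \<tau>"
  using simulates_com[OF assms(1) _ assms(2)] assms(3) by (auto simp: runs_def)

lemma simulates_runs_loop:
  assumes "code_at P p (loop_code p e c)" "roomy W B"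
    and "\<And>m \<sigma>. I m \<sigma> \<Longrightarrow> exp_safe W e \<sigma> \<and> (val e \<sigma> \<noteq> 0 \<longrightarrow> runs W c \<sigma> (\<lambda>\<tau>. \<exists>m' < m. I m' \<tau>))"
    and "I m \<sigma>"
  shows "\<exists>m' \<tau>. simulates P B ((m + 1) * loop_length e c) p \<sigma> (p + loop_length e c) \<tau> \<and>
    I m' \<tau> \<and> val e \<tau> = 0"
  using assms by (intro simulates_loop) (auto simp: runs_def)

text \<open>With at most n + 3 nodes there are at most 5 * (n + 3) saturation steps, and one more
  than that is at most 16 * (n + 1). The loop over at most n + 3 queries likewise makes at most 4 *
  (n + 1) tests.\<close>

definition time_factor :: nat where
  "time_factor = com_length init_com + parse_length + com_length reset_com + 16 * saturate_length +
     com_length (Asg 12 (Lit 0)) + 4 * answer_length"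

lemma program_correct:
  assumes n: "n = length (instance_string (hs, gs))" and W: "4 * n + 60 \<le> W" and room: "roomy W B"
  shows "\<exists>\<tau>. simulates program B (time_factor * (n + 1)) 0
      \<lparr>reg = \<lambda>_. 0, arr = \<lambda>_. 0, vin = encode_instance (hs, gs), vout = []\<rparr> (length program) \<tau> \<and>
    vout \<tau> = encode_answer (multi_entailment (hs, gs))"
proof -
  define p1 p2 p3 p4 p5 where "p1 = com_length init_com" and "p2 = p1 + parse_length"
    and "p3 = p2 + com_length reset_com" and "p4 = p3 + saturate_length"
    and "p5 = p4 + com_length (Asg 12 (Lit 0))"
  have "code_at program 0 (com_code 0 init_com @
      loop_code p1 (Reg 0) (Seq scan_com (Input 0)) @ com_code p2 reset_com @
      loop_code p3 (Minus (Reg 5) (Reg 10)) saturate_com @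
      com_code p4 (Asg 12 (Lit 0)) @
      loop_code p5 (Minus (Reg 6) (Reg 12)) answer_com)"
    unfolding code_at_def program_def Let_def p1_def p2_def p3_def p4_def p5_def by simp
  note code0 = code_at_append[OF this]
  note code1 = code_at_append[OF code0[THEN conjunct2]]
  note code2 = code_at_append[OF code1[THEN conjunct2]]
  note code3 = code_at_append[OF code2[THEN conjunct2]]
  note code4 = code_at_append[OF code3[THEN conjunct2]]
  have code: "code_at program 0 (com_code 0 init_com)"
    "code_at program p1 (loop_code p1 (Reg 0) (Seq scan_com (Input 0)))"
    "code_at program p2 (com_code p2 reset_com)"
    "code_at program p3 (loop_code p3 (Minus (Reg 5) (Reg 10)) saturate_com)"
    "code_at program p4 (com_code p4 (Asg 12 (Lit 0)))"
    "code_at program p5 (loop_code p5 (Minus (Reg 6) (Reg 12)) answer_com)"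
    using code0 code1 code2 code3 code4 by (simp_all del: com_code.simps com_length.simps add: p1_def p2_def p3_def p4_def p5_def)
  have len: "length program = p5 + answer_length"
    by (simp add: program_def Let_def p1_def p2_def p3_def p4_def p5_def)
  obtain a where path: "path start (instance_string (hs, gs)) a"
    and ex: "explained (node (tab a) ` set hs) a" and qs: "qs a = map (node (tab a)) gs"
    and nz: "\<forall>A \<in> set hs \<union> set gs. node (tab a) A \<noteq> 0"
    using scan_instance by blast
  have a: "in_range a" using ex by (rule explained_in_range)
  let ?\<sigma> = "\<lparr>reg = \<lambda>_. 0, arr = \<lambda>_. 0, vin = encode_instance (hs, gs), vout = []\<rparr>"
  have "runs W init_com ?\<sigma> (parsing n a n)"
    unfolding n using W by (intro runs_init_com[OF _ path]) (auto simp: encode_instance_def)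
  then obtain \<sigma>1 where \<sigma>1: "simulates program B p1 0 ?\<sigma> p1 \<sigma>1" "parsing n a n \<sigma>1"
    using simulates_runs[OF code(1) room] by (auto simp: p1_def)
  have "exp_safe W (Reg 0) \<sigma> \<and> (val (Reg 0) \<sigma> \<noteq> 0 \<longrightarrow>
      runs W (Seq scan_com (Input 0)) \<sigma> (\<lambda>\<tau>. \<exists>m' < m. parsing n a m' \<tau>))" if inv: "parsing n a m \<sigma>" for m \<sigma>
  proof -
    obtain xs where "reads xs \<sigma>" using inv by (auto simp: parsing_def)
    then have "reg \<sigma> 0 \<le> 12" using sym_code_le by (cases xs) (auto simp: reads_def)
    then have "exp_safe W (Reg 0) \<sigma>" using W by simp
    then show ?thesis using parsing_step[OF inv W] by simp
  qed
  from simulates_runs_loop[OF code(2) room this \<sigma>1(2)]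
  obtain m2 \<sigma>2 where \<sigma>2: "simulates program B ((n + 1) * parse_length) p1 \<sigma>1 p2 \<sigma>2"
    "parsing n a m2 \<sigma>2" "reg \<sigma>2 0 = 0"
    by (auto simp: p2_def)
  have imp: "implements a \<sigma>2" and out2: "vout \<sigma>2 = []" and size: "psize a \<le> n + 3"
    using parsing_done[OF \<sigma>2(2,3)] by auto
  have bounds: "cnt a \<le> n + 3" "length (qs a) \<le> n + 3" "4 * cnt a + 40 \<le> W" "length (qs a) < W"
    using size W a by (auto simp: psize_def in_range_def)
  let ?G = "proves (tab a) (set hs)"
    and ?total = "(\<Sum>v\<le>cnt a. length (adj a v)) + cnt a"
  have links: "link_set (adj a) = table_links (tab a)" and ok: "table_ok (tab a) (cnt a)"
    using a by (auto simp: in_range_def)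
  have form: "l \<in> range (node (tab a)) \<and> r \<in> range (node (tab a))"
    if "c \<in> {3, 4, 5}" "tab a (c, l, r) \<noteq> 0" for c l r
    using ex that unfolding explained_def by blast
  have sound: "?G c" if "(v, u, c) \<in> link_set (adj a)" "?G v" "?G u" for v u c
    using proves_link[OF ok form _ that(2,3)] that(1) links by simp
  have start: "\<forall>x \<in> set (wl a). ?G x"
  proof
    fix x assume "x \<in> set (wl a)"
    then consider "x = 1" | A where "A \<in> set hs" "x = node (tab a) A" | l where "tab a (5, l, l) = x" "x \<noteq> 0"
      using ex by (auto simp: explained_def)
    then show "?G x"
    proof cases
      case 1
      then show ?thesis using entails.top_ax by (auto simp: proves_def intro!: exI[of _ "\<^bold>\<top>"])
    next
      case 2
      then show ?thesis using entails.hyp by (auto simp: proves_def)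
    next
      case 3
      then obtain A where "l = node (tab a) A" using form[of 5 l l] by auto
      then have "node (tab a) (A \<^bold>\<rightarrow> A) = x" using 3 by simp
      then show ?thesis using entails.imp_ax unfolding proves_def by blast
    qed
  qed
  have "runs W reset_com \<sigma>2 (saturation a ?G ?total)"
  proof -
    have "saturating (adj a) (cnt a) (wl a) ?G (wl a, 0, 0)"
      using a start by (auto simp: saturating_def in_range_def)
    moreover have "progress (adj a) (wl a, 0, 0) = 0" by (simp add: progress_def)
    moreover have "a\<lparr>wl := wl a\<rparr> = a" by simp
    then have "queue_state a (wl a, 0, 0) (\<sigma>2\<lparr>reg := (reg \<sigma>2)(10 := 0, 11 := 0)\<rparr>)"
      using imp out2 by (simp add: implements_def)
    ultimately have "saturation a ?G ?total (\<sigma>2\<lparr>reg := (reg \<sigma>2)(10 := 0, 11 := 0)\<rparr>)"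
      unfolding saturation_def by (intro exI[of _ "(wl a, 0, 0)"]) (simp del: queue_state.simps)
    then show ?thesis by (simp add: reset_com_def)
  qed
  then obtain \<sigma>3 where \<sigma>3: "simulates program B (com_length reset_com) p2 \<sigma>2 p3 \<sigma>3"
    "saturation a ?G ?total \<sigma>3"
    using simulates_runs[OF code(3) room] by (auto simp: p3_def)
  have "exp_safe W (Minus (Reg 5) (Reg 10)) \<sigma> \<and> (val (Minus (Reg 5) (Reg 10)) \<sigma> \<noteq> 0 \<longrightarrow>
    runs W saturate_com \<sigma> (\<lambda>\<tau>. \<exists>m' < m. saturation a ?G m' \<tau>))" if "saturation a ?G m \<sigma>" for m \<sigma>
    by (rule saturation_step[OF a that bounds(3)]) (blast intro: sound)
  from simulates_runs_loop[OF code(4) room this \<sigma>3(2)]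
  obtain m4 \<sigma>4 where \<sigma>4: "simulates program B ((?total + 1) * saturate_length) p3 \<sigma>3 p4 \<sigma>4"
    "saturation a ?G m4 \<sigma>4" "reg \<sigma>4 5 \<le> reg \<sigma>4 10"
    by (auto simp: p4_def)
  obtain ws h k where queue: "queue_state a (ws, h, k) \<sigma>4"
    and sat': "saturating (adj a) (cnt a) (wl a) ?G (ws, h, k)"
    using \<sigma>4(2) by (auto simp: saturation_def)
  \<comment> \<open>The loop ends with \<open>length ws \<le> h\<close>, and the invariant provides
    the converse.\<close>
  then have "h = length ws" using \<sigma>4(3) by (simp add: saturating_def)
  with sat' have sat: "saturating (adj a) (cnt a) (wl a) ?G (ws, length ws, k)" by simp
  let ?a = "a\<lparr>wl := ws\<rparr>"
  have answer: "node (tab a) g \<in> set ws \<or> 2 \<in> set ws \<longleftrightarrow> set hs \<turnstile> g" if "g \<in> set gs" for g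
  proof (rule closed_iff_entails[OF ex])
    show "set (wl a) \<subseteq> set ws" "\<forall>x \<in> set ws. ?G x" using sat by (auto simp: saturating_def)
    fix v u c assume "(v, u, c) \<in> table_links (tab a)" "v \<in> set ws" "u \<in> set ws"
    then show "c \<in> set ws"
      using saturated_closed[OF sat] table_links_sym links by metis
  qed (use nz that in auto)
  have "runs W (Asg 12 (Lit 0)) \<sigma>4 (answering ?a (length (qs a)))"
    using queue by (auto simp: answering_def)
  from simulates_runs[OF code(5) room this]
  obtain \<sigma>5 where \<sigma>5: "simulates program B (com_length (Asg 12 (Lit 0))) p4 \<sigma>4 p5 \<sigma>5"
    "answering ?a (length (qs a)) \<sigma>5"
    unfolding p5_def by blast
  have "exp_safe W (Minus (Reg 6) (Reg 12)) \<sigma> \<and> (val (Minus (Reg 6) (Reg 12)) \<sigma> \<noteq> 0 \<longrightarrow>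
    runs W answer_com \<sigma> (\<lambda>\<tau>. \<exists>m' < m. answering ?a m' \<tau>))" if "answering ?a m \<sigma>" for m \<sigma>
  proof (rule answering_step[OF that])
    show "\<forall>x \<in> set (qs ?a). x \<le> W" using a bounds(3) by (fastforce simp: in_range_def)
  qed (use bounds W in auto)
  from simulates_runs_loop[OF code(6) room this \<sigma>5(2)]
  obtain m6 \<sigma>6 where \<sigma>6:
    "simulates program B ((length (qs a) + 1) * answer_length) p5 \<sigma>5 (length program) \<sigma>6"
    "answering ?a m6 \<sigma>6" "reg \<sigma>6 6 \<le> reg \<sigma>6 12"
    by (auto simp: len)
  have "vout \<sigma>6 = map (\<lambda>x. of_bool (x \<in> set ws \<or> 2 \<in> set ws)) (qs a)"
    using \<sigma>6(2,3) by (auto simp: answering_def)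
  also have "\<dots> = encode_answer (multi_entailment (hs, gs))"
    using answer by (auto simp: qs encode_answer_def multi_entailment_def)
  finally have out: "vout \<sigma>6 = encode_answer (multi_entailment (hs, gs))" .
  have "(\<Sum>v\<le>cnt a. length (adj a v)) \<le> 4 * cnt a" using a by (simp add: in_range_def)
  then have rounds: "?total + 1 \<le> 16 * (n + 1)" "length (qs a) + 1 \<le> 4 * (n + 1)"
    using bounds by simp_all
  have "(?total + 1) * saturate_length \<le> 16 * (n + 1) * saturate_length"
    "(length (qs a) + 1) * answer_length \<le> 4 * (n + 1) * answer_length"
    by (rule mult_le_mono1, fact rounds)+
  then have time: "p1 + ((n + 1) * parse_length + (com_length reset_com +
      ((?total + 1) * saturate_length + (com_length (Asg 12 (Lit 0)) +
      (length (qs a) + 1) * answer_length)))) \<le> time_factor * (n + 1)"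
    unfolding time_factor_def p1_def by (simp add: algebra_simps del: com_length.simps)
  from simulates_trans[OF \<sigma>1(1) simulates_trans[OF \<sigma>2(1) simulates_trans[OF \<sigma>3(1)
      simulates_trans[OF \<sigma>4(1) simulates_trans[OF \<sigma>5(1) \<sigma>6(1)]]]]]
  have "simulates program B (time_factor * (n + 1)) 0 ?\<sigma> (length program) \<sigma>6"
    by (rule simulates_mono[OF _ time])
  then show ?thesis using out by blast
qed

theorem theorem5p6:
  "linear_time_computable encode_instance encode_answer multi_entailment"
  unfolding linear_time_computable_def Let_def
proof (rule exI[of _ program], rule exI[of _ time_factor], rule exI[of _ 36], rule allI)
  fix I :: "form list \<times> form list"
  obtain hs gs where I: "I = (hs, gs)" by (cases I)
  let ?xs = "encode_instance I"
  let ?n = "length ?xs"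
  \<comment> \<open>\<open>?W\<close> is at least \<open>4 * ?n + 60\<close>. By
    \<open>roomy_bound\<close>, \<open>?B\<close> must be at least \<open>(4 * ?W) ^ 4\<close>, the
    fourth power of \<open>256 * (?n + 2)\<close>; as 256 is \<open>2 ^ 8\<close> and 2 is at most
    \<open>?n + 2\<close>, the exponent (8 + 1) * 4 = 36 suffices.\<close>
  let ?B = "(?n + 2) ^ 36" and ?W = "64 * (?n + 2)"
  have "(2::nat) ^ 8 \<le> (?n + 2) ^ 8" by (intro power_mono) auto
  then have "256 * (?n + 2) \<le> (?n + 2) ^ 8 * (?n + 2)" by (intro mult_le_mono1) simp
  then have "4 * ?W \<le> (?n + 2) ^ 8 * (?n + 2)" by simp
  then have "(4 * ?W) ^ 4 \<le> ((?n + 2) ^ 8 * (?n + 2)) ^ 4" by (intro power_mono) auto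
  also have "\<dots> = ?B"
  proof -
    have "(x ^ 8 * x) ^ 4 = x ^ 36" for x :: nat
      by (simp add: power_mult_distrib flip: power_mult power_add)
    then show ?thesis .
  qed
  finally have room: "roomy ?W ?B" by (intro roomy_bound) auto
  have n: "?n = length (instance_string (hs, gs))" by (simp add: I encode_instance_def)
  obtain \<tau> where sim: "simulates program ?B (time_factor * (?n + 1)) 0
      \<lparr>reg = \<lambda>_. 0, arr = \<lambda>_. 0, vin = encode_instance (hs, gs), vout = []\<rparr> (length program) \<tau>"
    and out: "vout \<tau> = encode_answer (multi_entailment (hs, gs))"
    using program_correct[OF n _ room] by auto
  have "represents (initial ?xs) \<lparr>reg = \<lambda>_. 0, arr = \<lambda>_. 0, vin = encode_instance (hs, gs), vout = []\<rparr>"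
    by (simp add: represents_def initial_def I)
  moreover have "bounded ?B (initial ?xs)" by (simp add: bounded_def initial_def)
  moreover have "pc (initial ?xs) = 0" by (simp add: initial_def)
  ultimately obtain t s where t: "t \<le> time_factor * (?n + 1)" and r: "reach program ?B t (initial ?xs) s"
    and s: "pc s = length program" "represents s \<tau>"
    using sim unfolding simulates_def by blast
  have "run program ?xs t = s" using r by (simp add: run_def reach_def)
  then have "halted program (run program ?xs t)" "outp (run program ?xs t) = encode_answer (multi_entailment I)"
    using s out by (simp_all add: halted_def represents_def I)
  moreover have "\<forall>t' \<le> t. \<forall>a. mem (run program ?xs t') a < ?B"
    using r by (simp add: reach_def bounded_def run_def)
  ultimately show "\<exists>t \<le> time_factor * (?n + 1). halted program (run program ?xs t) \<and>
      outp (run program ?xs t) = encode_answer (multi_entailment I) \<and>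
      (\<forall>t' \<le> t. \<forall>a. mem (run program ?xs t') a < ?B)"
    using t by blast
qed

end
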